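(* Let $n\ge 2$. (Necessity) Let $\mathcal F$ be a transversely $C^1$ totally umbilical codimension $1$ foliation of $\mathbb H^n$ orthogonal to an arc-length parametrized geodesic line $\gamma:\mathbb R\to\mathbb H^n$, and let $h(t)$ be the mean curvature of the leaf through $\gamma(t)$ (with transversal orientation opposite to $\gamma$). Then there are $t_-,t_+\in[-\infty,+\infty]$ such that (i) $h\equiv -1$ on $(-\infty,t_-]$; (ii) $h'\ge h^2-1$; (iii) $h\equiv 1$ on $[t_+,+\infty)$. (Sufficiency) Conversely, if $h:\mathbb R\to[-1,1]$ is a $C^1$ function for which there are $t_-,t_+\in[-\infty,+\infty]$ satisfying (i), (ii), (iii), then $h$ is an umbilical route along any geodesic line in $\mathbb H^n$.
   Context: $\mathbb H^n$ is the real hyperbolic space of constant curvature $-1$; in the half-space model it is $\Pi^{n,+}=\{x\in\mathbb R^n: x_n>0\}$ with metric $x_n^{-2}\langle\cdot,\cdot\rangle$ and ideal boundary $(\mathbb R^{n-1}\times\{0\})\cup\{\infty\}$. Intervals $(-\infty,t_-]$ and $[t_+,+\infty)$ are taken within $\mathbb R$: for $t_-=-\infty$ (resp. $t_+=+\infty$) condition (i) (resp. (iii)) is empty, and for $t_-=+\infty$ (resp. $t_+=-\infty$) the interval is all of $\mathbb R$. A generalized hypersphere is a complete hypersurface of $\mathbb H^n$ which is a horosphere, a totally geodesic hypersurface, or a hypersphere (a connected component of the set of points at a fixed positive distance from a totally geodesic hypersurface). In the half-space model these are the nonempty intersections with $\Pi^{n,+}$ of spheres or hyperplanes meeting or tangent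 to the ideal boundary (tangency point removed; hyperplanes parallel to $\mathbb R^{n-1}\times\{0\}$ included as horospheres). A submanifold is totally umbilical if at each of its points all eigenvalues of the shape operator are equal; a totally umbilical foliation is a foliation all of whose leaves are totally umbilical (for $n=2$, where this condition on curves is vacuous, it is understood that the leaves are generalized hyperspheres, i.e. geodesics, horocycles and equidistant curves). A foliation is orthogonal to a curve $\gamma$ if at each $\gamma(t)$ the leaf through $\gamma(t)$ is orthogonal to $\gamma'(t)$. Sign convention: the mean curvature of an oriented totally umbilical hypersurface with unit normal $N$ is the common eigenvalue of $X\mapsto\nabla_XN$; "orientation opposite to $\gamma$" means that at $\gamma(t)$ the unit normal of the leaf is $-\gamma'(t)$. Thus a horosphere centered at the ideal point $\gamma(+\infty)$ has mean curvature $+1$ and one centered at $\gamma(-\infty)$ has mean curvature $-1$. A function $h:\mathbb R\to\mathbb R$ is an umbilical route along an arc-length parametrized curve $\gamma:\mathbb R\to\mathbb H^n$ if the family $(L_t)_{t\in\mathbb R}$, where $L_t$ is the generalized hypersphere through $\gamma(t)$, orthogonal to $\gamma$ there and having mean curvature $h(t)$ (orientation opposite to $\gamma$), can be extended to a totally umbilical foliation of $\mathbb H^n$ (i.e. there is such a foliation having every $L_t$ as a leaf). *)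

theory Defs
  imports "HOL-Analysis.Analysis"
begin

section \<open>The half-space model\<close>

text \<open>
  The model of dimension \<open>n\<close> lives in \<open>'a \<times> real\<close> with \<open>'a\<close> an arbitrary Euclidean space,
  so \<open>n = DIM('a) + 1\<close> ranges over all integers \<open>n \<ge> 2\<close>; the second component is the
  coordinate \<open>x\<^sub>n\<close>.  Tangent spaces of the half-space are identified with \<open>'a \<times> real\<close>.
\<close>

definition half_space :: "('a::euclidean_space \<times> real) set" where
  "half_space = {p. snd p > 0}"

definition hyp_inner ::
    "'a::euclidean_space \<times> real \<Rightarrow> 'a \<times> real \<Rightarrow> 'a \<times> real \<Rightarrow> real" where
  "hyp_inner p v w = (v \<bullet> w) / (snd p)\<^sup>2"

definition hyp_norm :: "'a::euclidean_space \<times> real \<Rightarrow> 'a \<times> real \<Rightarrow> real" where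
  "hyp_norm p v = sqrt (hyp_inner p v v)"

text \<open>
  Christoffel form of the Levi-Civita connection of the conformal metric \<open>x\<^sub>n\<^sup>-\<^sup>2\<langle>_,_\<rangle>\<close>,
  so that \<open>\<nabla>\<^sub>X Y = D\<^sub>X Y + \<Gamma>(X,Y)\<close>.  The two lemmas after it (no torsion, compatibility with
  the metric, both on constant fields) determine it.
\<close>

definition christoffel ::
    "'a::euclidean_space \<times> real \<Rightarrow> 'a \<times> real \<Rightarrow> 'a \<times> real \<Rightarrow> 'a \<times> real" where
  "christoffel p X Y =
     (1 / snd p) *\<^sub>R ((X \<bullet> Y) *\<^sub>R (0, 1) - snd X *\<^sub>R Y - snd Y *\<^sub>R X)"

lemma christoffel_commute: "christoffel p X Y = christoffel p Y X"
  by (simp add: christoffel_def inner_commute algebra_simps)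

lemma christoffel_metric:
  assumes "p \<in> half_space"
  shows "((\<lambda>q. hyp_inner q Y Z) has_derivative
           (\<lambda>X. hyp_inner p (christoffel p X Y) Z + hyp_inner p Y (christoffel p X Z))) (at p)"
proof -
  have p: "snd p > 0" using assms by (simp add: half_space_def)
  have "((\<lambda>q. (Y \<bullet> Z) / (snd q)\<^sup>2) has_derivative
          (\<lambda>X. - 2 * (Y \<bullet> Z) * snd X / (snd p)^3)) (at p)"
    using p by (auto intro!: derivative_eq_intros simp: field_simps power2_eq_square power3_eq_cube)
  moreover have "hyp_inner p (christoffel p X Y) Z + hyp_inner p Y (christoffel p X Z)
      = - 2 * (Y \<bullet> Z) * snd X / (snd p)^3" for X
  proof -
    have *: "christoffel p X A \<bullet> B
        = ((X \<bullet> A) * snd B - snd X * (A \<bullet> B) - snd A * (X \<bullet> B)) / snd p" for A B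
    proof -
      have "((0, 1) :: 'a \<times> real) \<bullet> B = snd B" by (simp add: inner_prod_def)
      then show ?thesis
        unfolding christoffel_def by (simp only: inner_scaleR_left inner_diff_left) simp
    qed
    show ?thesis
      using p unfolding hyp_inner_def inner_commute[of Y "christoffel p X Z"] *
      by (simp add: inner_commute[of Z Y] field_simps power2_eq_square power3_eq_cube)
  qed
  ultimately show ?thesis by (simp add: hyp_inner_def)
qed

text \<open>\<open>\<nabla>\<^sub>X Y\<close> at \<open>p\<close>.\<close>

definition cov_deriv ::
    "('a::euclidean_space \<times> real \<Rightarrow> 'a \<times> real) \<Rightarrow> 'a \<times> real \<Rightarrow> 'a \<times> real \<Rightarrow> 'a \<times> real" where
  "cov_deriv Y p X = frechet_derivative Y (at p) X + christoffel p X (Y p)"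


section \<open>Curves and geodesic lines\<close>

definition velocity :: "(real \<Rightarrow> 'b::real_normed_vector) \<Rightarrow> real \<Rightarrow> 'b" where
  "velocity \<gamma> t = vector_derivative \<gamma> (at t)"

definition arc_length_curve :: "(real \<Rightarrow> 'a::euclidean_space \<times> real) \<Rightarrow> bool" where
  "arc_length_curve \<gamma> \<longleftrightarrow>
     range \<gamma> \<subseteq> half_space \<and> \<gamma> C1_differentiable_on UNIV \<and>
     (\<forall>t. hyp_norm (\<gamma> t) (velocity \<gamma> t) = 1)"

definition geodesic_line :: "(real \<Rightarrow> 'a::euclidean_space \<times> real) \<Rightarrow> bool" where
  "geodesic_line \<gamma> \<longleftrightarrow>
     arc_length_curve \<gamma> \<and>
     (\<forall>t. velocity \<gamma> differentiable (at t) \<and>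
          velocity (velocity \<gamma>) t + christoffel (\<gamma> t) (velocity \<gamma> t) (velocity \<gamma> t) = 0)"


section \<open>Hypersurfaces, shape operator, totally umbilical hypersurfaces\<close>

text \<open>\<open>C\<^sup>k\<close> real functions; meant for open \<open>S\<close>.\<close>

primrec Ck_on :: "nat \<Rightarrow> ('b::euclidean_space \<Rightarrow> real) \<Rightarrow> 'b set \<Rightarrow> bool" where
  "Ck_on 0 f S \<longleftrightarrow> continuous_on S f"
| "Ck_on (Suc k) f S \<longleftrightarrow>
     (\<forall>x\<in>S. f differentiable (at x)) \<and>
     (\<forall>v. Ck_on k (\<lambda>x. frechet_derivative f (at x) v) S)"

definition smooth_on :: "('b::euclidean_space \<Rightarrow> real) \<Rightarrow> 'b set \<Rightarrow> bool" where
  "smooth_on f S \<longleftrightarrow> (\<forall>k. Ck_on k f S)"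

definition grad :: "('b::euclidean_space \<Rightarrow> real) \<Rightarrow> 'b \<Rightarrow> 'b" where
  "grad f x = (\<Sum>b\<in>Basis. frechet_derivative f (at x) b *\<^sub>R b)"

text \<open>
  \<open>f = 0\<close> is a regular smooth equation on \<open>U\<close> of the sheet of \<open>L\<close> through \<open>p\<close>.  Only the path
  component of \<open>p\<close> in \<open>L \<inter> U\<close> is described: leaves of a foliation are injectively immersed,
  and a leaf may a priori return to \<open>U\<close> infinitely often.
\<close>

definition local_equation ::
    "('a::euclidean_space \<times> real) set \<Rightarrow> 'a \<times> real \<Rightarrow> ('a \<times> real) set
       \<Rightarrow> ('a \<times> real \<Rightarrow> real) \<Rightarrow> bool" where
  "local_equation L p U f \<longleftrightarrow>
     open U \<and> U \<subseteq> half_space \<and> p \<in> U \<and> p \<in> L \<and>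
     smooth_on f U \<and> (\<forall>q\<in>U. grad f q \<noteq> 0) \<and>
     path_component_set (L \<inter> U) p = {q \<in> U. f q = 0}"

definition hypersurface :: "('a::euclidean_space \<times> real) set \<Rightarrow> bool" where
  "hypersurface L \<longleftrightarrow> L \<subseteq> half_space \<and> (\<forall>p\<in>L. \<exists>U f. local_equation L p U f)"

definition tangent_space ::
    "('a::euclidean_space \<times> real) set \<Rightarrow> 'a \<times> real \<Rightarrow> ('a \<times> real) set" where
  "tangent_space L p = {X. \<exists>U f. local_equation L p U f \<and> frechet_derivative f (at p) X = 0}"

text \<open>
  Hyperbolic unit normal of the level sets of \<open>f\<close>; \<open>-f\<close> gives the opposite orientation.
\<close>

definition unit_normal ::
    "('a::euclidean_space \<times> real \<Rightarrow> real) \<Rightarrow> 'a \<times> real \<Rightarrow> 'a \<times> real" where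
  "unit_normal f q = (snd q / norm (grad f q)) *\<^sub>R grad f q"

text \<open>
  \<open>k\<close> is an eigenvalue at \<open>p\<close> of the shape operator \<open>X \<mapsto> \<nabla>\<^sub>X N\<close>, where \<open>L\<close> is oriented near
  \<open>p\<close> by the unit normal field \<open>N\<close> with \<open>N(p) = \<nu>\<close>.
\<close>

definition principal_curvature ::
    "('a::euclidean_space \<times> real) set \<Rightarrow> 'a \<times> real \<Rightarrow> 'a \<times> real \<Rightarrow> real \<Rightarrow> bool" where
  "principal_curvature L p \<nu> k \<longleftrightarrow>
     (\<exists>U f X. local_equation L p U f \<and> unit_normal f p = \<nu> \<and>
        X \<in> tangent_space L p \<and> X \<noteq> 0 \<and> cov_deriv (unit_normal f) p X = k *\<^sub>R X)"

definition totally_umbilical :: "('a::euclidean_space \<times> real) set \<Rightarrow> bool" where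
  "totally_umbilical L \<longleftrightarrow>
     hypersurface L \<and>
     (\<forall>p\<in>L. \<forall>\<nu> k k'. principal_curvature L p \<nu> k \<longrightarrow> principal_curvature L p \<nu> k' \<longrightarrow> k = k')"

text \<open>
  Mean curvature at \<open>p\<close>, for the orientation \<open>\<nu>\<close>, as the common eigenvalue.
\<close>

definition has_mean_curvature ::
    "('a::euclidean_space \<times> real) set \<Rightarrow> 'a \<times> real \<Rightarrow> 'a \<times> real \<Rightarrow> real \<Rightarrow> bool" where
  "has_mean_curvature L p \<nu> k \<longleftrightarrow> {c. principal_curvature L p \<nu> c} = {k}"

text \<open>
  Horospheres, complete totally geodesic hypersurfaces and hyperspheres in the half-space model.
  A Euclidean sphere has to meet or touch \<open>x\<^sub>n = 0\<close>; every hyperplane is allowed, because its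
  closure contains the ideal point at infinity.
\<close>

definition generalized_hypersphere :: "('a::euclidean_space \<times> real) set \<Rightarrow> bool" where
  "generalized_hypersphere S \<longleftrightarrow>
     S \<noteq> {} \<and>
     ((\<exists>c R. R > 0 \<and> sphere c R \<inter> {p. snd p = 0} \<noteq> {} \<and> S = sphere c R \<inter> half_space) \<or>
      (\<exists>u d. u \<noteq> 0 \<and> S = {p. u \<bullet> p = d} \<inter> half_space))"


section \<open>Foliations of codimension one\<close>

text \<open>
  Foliated chart \<open>\<phi>\<close> (with inverse \<open>\<psi>\<close>): the components of \<open>L \<inter> U\<close>, for each leaf \<open>L\<close>, are
  plaques, that is, level sets of the transverse coordinate \<open>snd \<circ> \<phi>\<close>.
\<close>

definition foliated_chart ::
    "('a::euclidean_space \<times> real) set set \<Rightarrow> ('a \<times> real) set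
       \<Rightarrow> ('a \<times> real \<Rightarrow> 'a \<times> real) \<Rightarrow> ('a \<times> real \<Rightarrow> 'a \<times> real) \<Rightarrow> bool" where
  "foliated_chart F U \<phi> \<psi> \<longleftrightarrow>
     open U \<and> U \<subseteq> half_space \<and> homeomorphism U UNIV \<phi> \<psi> \<and>
     (\<forall>L\<in>F. \<forall>C\<in>components (L \<inter> U). \<exists>c. C = {q \<in> U. snd (\<phi> q) = c})"

text \<open>
  A foliation of the half-space given by the set of its leaves.  Leaves are required to be
  path connected, not just connected: a proper leaf together with a leaf in its limit set
  is connected as a subset.
\<close>

definition foliation :: "('a::euclidean_space \<times> real) set set \<Rightarrow> bool" where
  "foliation F \<longleftrightarrow>
     partition_on half_space F \<and> (\<forall>L\<in>F. path_connected L) \<and>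
     (\<forall>p\<in>half_space. \<exists>U \<phi> \<psi>. p \<in> U \<and> foliated_chart F U \<phi> \<psi>)"

text \<open>The foliation is defined locally by \<open>C\<^sup>1\<close> submersions to the real line.\<close>

definition transversely_C1 :: "('a::euclidean_space \<times> real) set set \<Rightarrow> bool" where
  "transversely_C1 F \<longleftrightarrow>
     (\<forall>p\<in>half_space. \<exists>U \<phi> \<psi>. p \<in> U \<and> foliated_chart F U \<phi> \<psi> \<and>
        Ck_on 1 (\<lambda>q. snd (\<phi> q)) U \<and> (\<forall>q\<in>U. grad (\<lambda>q. snd (\<phi> q)) q \<noteq> 0))"

text \<open>
  In dimension 2 umbilicity is vacuous, and the leaves are instead required to be geodesics,
  horocycles or equidistant curves.
\<close>

definition totally_umbilical_foliation :: "('a::euclidean_space \<times> real) set set \<Rightarrow> bool" where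
  "totally_umbilical_foliation F \<longleftrightarrow>
     foliation F \<and>
     (if DIM('a \<times> real) = 2 then \<forall>L\<in>F. generalized_hypersphere L
      else \<forall>L\<in>F. totally_umbilical L)"

definition orthogonal_at ::
    "('a::euclidean_space \<times> real) set \<Rightarrow> (real \<Rightarrow> 'a \<times> real) \<Rightarrow> real \<Rightarrow> bool" where
  "orthogonal_at L \<gamma> t \<longleftrightarrow>
     (\<forall>X\<in>tangent_space L (\<gamma> t). hyp_inner (\<gamma> t) X (velocity \<gamma> t) = 0)"

definition foliation_orthogonal_to ::
    "('a::euclidean_space \<times> real) set set \<Rightarrow> (real \<Rightarrow> 'a \<times> real) \<Rightarrow> bool" where
  "foliation_orthogonal_to F \<gamma> \<longleftrightarrow> (\<forall>t. \<forall>L\<in>F. \<gamma> t \<in> L \<longrightarrow> orthogonal_at L \<gamma> t)"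


section \<open>Umbilical routes\<close>

text \<open>\<open>L\<close> is the generalized hypersphere \<open>L\<^sub>t\<close> determined by \<open>\<gamma>\<close> and \<open>h\<close>.\<close>

definition route_leaf ::
    "(real \<Rightarrow> 'a::euclidean_space \<times> real) \<Rightarrow> (real \<Rightarrow> real) \<Rightarrow> real \<Rightarrow> ('a \<times> real) set \<Rightarrow> bool" where
  "route_leaf \<gamma> h t L \<longleftrightarrow>
     generalized_hypersphere L \<and> \<gamma> t \<in> L \<and> orthogonal_at L \<gamma> t \<and>
     has_mean_curvature L (\<gamma> t) (- velocity \<gamma> t) (h t)"

definition umbilical_route ::
    "(real \<Rightarrow> 'a::euclidean_space \<times> real) \<Rightarrow> (real \<Rightarrow> real) \<Rightarrow> bool" where
  "umbilical_route \<gamma> h \<longleftrightarrow>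
     arc_length_curve \<gamma> \<and>
     (\<exists>L. (\<forall>t. route_leaf \<gamma> h t (L t)) \<and>
          (\<exists>F. totally_umbilical_foliation F \<and> range L \<subseteq> F))"

end

theory Submission
  imports Defs
begin

text \<open>
  Put \<open>C\<^sub>q(t) = cosh dist(\<gamma>(t), q)\<close>.  The hypersphere through \<open>\<gamma>(t)\<close> orthogonal to \<open>\<gamma>\<close> with mean
  curvature \<open>\<eta>\<close> (oriented against \<open>\<gamma>\<close>) is the set of all \<open>q\<close> with
  \<open>\<eta> (C\<^sub>q(t) - 1) + C\<^sub>q'(t) = 0\<close>, in any dimension and for any unit speed curve
  (lemmas \<open>quadric_eq_orthogonal_hypersphere\<close> and \<open>quadric_eq_if_orthogonal\<close>).  Along a geodesic
  line \<open>C\<^sub>q'' = C\<^sub>q\<close>, hence \<open>C\<^sub>q(t) = A(q) e\<^sup>t + B(q) e\<^sup>-\<^sup>t\<close> with \<open>A, B > 0\<close> and \<open>4AB \<ge> 1\<close>.  The whole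
  geometry of the family of leaves along \<open>\<gamma>\<close> is therefore contained in the functions
  \<open>G\<^sub>q(t) = h(t) (C\<^sub>q(t) - 1) + C\<^sub>q'(t)\<close>, called \<open>defect\<close> below: \<open>q\<close> lies on the leaf \<open>L\<^sub>t\<close> through
  \<open>\<gamma>(t)\<close> exactly when \<open>G\<^sub>q(t) = 0\<close>.

  Sufficiency.  Because \<open>C\<^sub>q \<ge> 1\<close>, the inequality \<open>h' \<ge> h\<^sup>2 - 1\<close> gives
  \<open>G\<^sub>q' = h' (C\<^sub>q - 1) + h C\<^sub>q' + C\<^sub>q \<ge> h G\<^sub>q + 1\<close>.  By an integrating factor \<open>G\<^sub>q\<close> changes sign at most once,
  and \<open>\<bar>h\<bar> \<le> 1\<close> forces \<open>G\<^sub>q < 0\<close> somewhere and \<open>G\<^sub>q > 0\<close> somewhere.  So every point lies on exactly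
  one \<open>L\<^sub>t\<close>, and explicit coordinates on \<open>L\<^sub>t\<close> (\<open>leaf_point\<close>) give one foliated chart that covers
  the whole space.

  Necessity.  Since \<open>C\<^sub>q\<close> is unbounded on a leaf with \<open>\<bar>h\<bar> \<le> 1\<close>, a failure of \<open>h' \<ge> h\<^sup>2 - 1\<close> at \<open>t\<close> produces
  a point \<open>q\<close> of \<open>L\<^sub>t\<close> with \<open>G\<^sub>q' < 0\<close> at \<open>t\<close>, whereas \<open>G\<^sub>q' = 1\<close> at \<open>q = \<gamma>(t)\<close>; hence \<open>L\<^sub>t\<close> meets the leaves \<open>L\<^sub>s\<close>
  with \<open>s > t\<close> close to \<open>t\<close> (\<open>curvature_derivative_ge\<close>).  If \<open>\<bar>h(t)\<bar> > 1\<close>, the leaf is a compact sphere that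
  crosses \<open>\<gamma>\<close> twice, with opposite signs of \<open>h\<close>; between the crossings \<open>h\<close> vanishes, and the unbounded
  leaf there would have to stay inside the sphere (\<open>no_compact_leaf_ordered\<close>).  Differentiability of
  \<open>h\<close> comes from a transversal away from \<open>\<gamma>\<close>: there \<open>h = - C\<^sub>q' / (C\<^sub>q - 1)\<close>, and \<open>C\<^sup>1\<close> transversality lets \<open>q\<close>
  move differentiably with \<open>t\<close> (\<open>curvature_differentiable\<close>).

  For all this the leaves have to be known as whole sets.  In dimension at least 3 this is a theorem:
  an umbilical hypersurface is locally a piece of a Euclidean sphere or hyperplane
  (\<open>umbilic_level_set_locally_quadric\<close>), and in a foliation such a piece extends until it fills
  the half-space part of its sphere, because near a missing limit point the plaques
  are closed and are themselves pieces of that sphere (\<open>quadric_subset_leaf\<close>).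
\<close>

section \<open>Gradients and level sets of differentiable functions\<close>

lemma frechet_derivative_eq_grad:
  assumes "f differentiable (at x)"
  shows "frechet_derivative f (at x) v = grad f x \<bullet> v"
proof -
  interpret linear "frechet_derivative f (at x)"
    using assms by (rule linear_frechet_derivative)
  have "frechet_derivative f (at x) v = frechet_derivative f (at x) (\<Sum>b\<in>Basis. (v \<bullet> b) *\<^sub>R b)"
    by (simp add: euclidean_representation)
  also have "\<dots> = (\<Sum>b\<in>Basis. (v \<bullet> b) * frechet_derivative f (at x) b)"
    by (simp add: sum scale)
  also have "\<dots> = grad f x \<bullet> v"
    by (simp add: grad_def inner_sum_left inner_commute[of v] mult.commute)
  finally show ?thesis .
qed

lemma has_derivative_grad:
  "f differentiable (at x) \<Longrightarrow> (f has_derivative (\<lambda>v. grad f x \<bullet> v)) (at x)"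
  by (metis (no_types, lifting) ext frechet_derivative_eq_grad frechet_derivative_works)

lemma grad_eqI:
  assumes "(f has_derivative (\<lambda>v. w \<bullet> v)) (at x)"
  shows "grad f x = w"
proof -
  have "frechet_derivative f (at x) v = w \<bullet> v" for v
    using frechet_derivative_at[OF assms] by metis
  then show ?thesis
    by (simp add: grad_def euclidean_representation)
qed

lemma Ck_on_1D:
  assumes "Ck_on 1 f U"
  shows "x \<in> U \<Longrightarrow> f differentiable (at x)" "continuous_on U f" "continuous_on U (grad f)"
proof -
  show *: "f differentiable (at x)" if "x \<in> U" for x
    using assms that by simp
  show "continuous_on U f"
    by (meson "*" continuous_at_imp_continuous_on differentiable_imp_continuous_within)
  have "continuous_on U (\<lambda>x. frechet_derivative f (at x) v)" for v
    using assms by simp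
  then show "continuous_on U (grad f)"
    unfolding grad_def[abs_def] by (intro continuous_intros)
qed

lemma Ck_on_mono: "Ck_on k f U \<Longrightarrow> V \<subseteq> U \<Longrightarrow> Ck_on k f V"
  by (induction k arbitrary: f) (auto intro: continuous_on_subset)

lemma smooth_on_Ck1: "smooth_on f U \<Longrightarrow> Ck_on 1 f U"
  by (simp add: smooth_on_def)

text \<open>
  The mean value theorem in the direction \<open>u\<close> reduces the second difference to a difference of the
  first derivative \<open>x \<mapsto> f' x u\<close>, which is linearised at \<open>p\<close>.
\<close>

lemma second_difference_limit:
  fixes f :: "'e::real_normed_vector \<Rightarrow> real"
  assumes U: "open U" "p \<in> U"
    and f: "\<And>x. x \<in> U \<Longrightarrow> (f has_derivative f' x) (at x)"
    and g: "((\<lambda>x. f' x u) has_derivative D) (at p)"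
  shows "((\<lambda>s. (f (p + s *\<^sub>R u + s *\<^sub>R v) - f (p + s *\<^sub>R u) - f (p + s *\<^sub>R v) + f p) / s\<^sup>2)
           \<longlongrightarrow> D v) (at_right 0)"
proof (rule tendstoI)
  fix e :: real assume e: "e > 0"
  \<comment> \<open>\<open>K\<close> bounds the lengths that occur in the two linearisation errors, per unit of \<open>s\<close>.\<close>
  define K where "K = 2 * norm u + norm v + 1"
  have K: "K > 0" by (simp add: K_def add_nonneg_pos)
  interpret D: bounded_linear D using g by (rule has_derivative_bounded_linear)
  obtain d1 where d1: "d1 > 0"
    "\<And>y. norm (y - p) < d1 \<Longrightarrow> \<bar>f' y u - f' p u - D (y - p)\<bar> \<le> e / (2 * K) * norm (y - p)"
    using g e K unfolding has_derivative_at_alt by (auto dest!: spec[of _ "e / (2 * K)"])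
  obtain d2 where d2: "d2 > 0" "ball p d2 \<subseteq> U"
    using U open_contains_ball by blast
  define d where "d = min d1 d2 / K"
  have d: "d > 0" using d1 d2 K by (simp add: d_def)
  have small: "norm (a *\<^sub>R u + b *\<^sub>R v) < min d1 d2"
    if "0 \<le> a" "a \<le> s" "0 \<le> b" "b \<le> s" "0 < s" "s < d" for a b s
  proof -
    have "norm (a *\<^sub>R u + b *\<^sub>R v) \<le> a * norm u + b * norm v"
      using that by (intro norm_triangle_le) simp
    also have "\<dots> \<le> s * norm u + s * norm v"
      using that by (intro add_mono mult_right_mono) auto
    also have "\<dots> = s * (norm u + norm v)"
      by (simp add: algebra_simps)
    also have "\<dots> \<le> s * K"
      using that by (intro mult_left_mono) (auto simp: K_def)
    also have "\<dots> < d * K" using that K by simp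
    also have "\<dots> = min d1 d2" using K by (simp add: d_def)
    finally show ?thesis .
  qed
  have "dist ((f (p + s *\<^sub>R u + s *\<^sub>R v) - f (p + s *\<^sub>R u) - f (p + s *\<^sub>R v) + f p) / s\<^sup>2) (D v) < e"
    if s: "0 < s" "s < d" for s
  proof -
    let ?h = "\<lambda>t. f (p + t *\<^sub>R u + s *\<^sub>R v) - f (p + t *\<^sub>R u)"
    have inU: "p + (a *\<^sub>R u + b *\<^sub>R v) \<in> U" if "0 \<le> a" "a \<le> s" "0 \<le> b" "b \<le> s" for a b
    proof -
      have "p + (a *\<^sub>R u + b *\<^sub>R v) \<in> ball p d2"
        using small[OF that s] by (simp add: mem_ball dist_commute[of p]) (simp add: dist_norm)
      with d2 show ?thesis by blast
    qed
    have der: "(?h has_real_derivative (f' (p + t *\<^sub>R u + s *\<^sub>R v) u - f' (p + t *\<^sub>R u) u)) (at t)"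
      if t: "0 \<le> t" "t \<le> s" for t
    proof -
      have 1: "(f has_derivative f' (p + t *\<^sub>R u + s *\<^sub>R v)) (at (p + t *\<^sub>R u + s *\<^sub>R v))"
        using inU[of t s] t s by (intro f) (simp add: add.assoc)
      have 2: "(f has_derivative f' (p + t *\<^sub>R u)) (at (p + t *\<^sub>R u))"
        using inU[of t 0] t s by (intro f) simp
      have lin: "linear (f' (p + t *\<^sub>R u + s *\<^sub>R v))" "linear (f' (p + t *\<^sub>R u))"
        using 1 2 has_derivative_linear by blast+
      have "((\<lambda>t. f (p + t *\<^sub>R u + s *\<^sub>R v)) has_derivative (\<lambda>x. f' (p + t *\<^sub>R u + s *\<^sub>R v) (x *\<^sub>R u))) (at t)"
        by (rule has_derivative_compose[where f = "\<lambda>t. p + t *\<^sub>R u + s *\<^sub>R v", OF _ 1]) (auto intro!: derivative_eq_intros)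
      moreover have "((\<lambda>t. f (p + t *\<^sub>R u)) has_derivative (\<lambda>x. f' (p + t *\<^sub>R u) (x *\<^sub>R u))) (at t)"
        by (rule has_derivative_compose[where f = "\<lambda>t. p + t *\<^sub>R u", OF _ 2]) (auto intro!: derivative_eq_intros)
      ultimately have "(?h has_derivative (\<lambda>x. f' (p + t *\<^sub>R u + s *\<^sub>R v) (x *\<^sub>R u) - f' (p + t *\<^sub>R u) (x *\<^sub>R u))) (at t)"
        by (rule has_derivative_diff)
      then show ?thesis
        unfolding has_field_derivative_def
        by (simp only: linear_cmul[OF lin(1)] linear_cmul[OF lin(2)] real_scaleR_def
              right_diff_distrib[symmetric] mult_commute_abs)
    qed
    obtain z where z: "0 < z" "z < s"
      "?h s - ?h 0 = (s - 0) * (f' (p + z *\<^sub>R u + s *\<^sub>R v) u - f' (p + z *\<^sub>R u) u)"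
      using MVT2[OF s(1), of ?h "\<lambda>t. f' (p + t *\<^sub>R u + s *\<^sub>R v) u - f' (p + t *\<^sub>R u) u", OF der]
      by blast
    have n1: "norm (z *\<^sub>R u + s *\<^sub>R v) < d1" "norm (z *\<^sub>R u + 0 *\<^sub>R v) < d1"
      using small[of z s s] small[of z s 0] z s by auto
    have b1: "\<bar>f' (p + z *\<^sub>R u + s *\<^sub>R v) u - f' p u - D (z *\<^sub>R u + s *\<^sub>R v)\<bar> \<le> e / (2 * K) * norm (z *\<^sub>R u + s *\<^sub>R v)"
      using d1(2)[of "p + z *\<^sub>R u + s *\<^sub>R v"] n1 by (simp add: add.assoc)
    have b2: "\<bar>f' (p + z *\<^sub>R u) u - f' p u - D (z *\<^sub>R u)\<bar> \<le> e / (2 * K) * norm (z *\<^sub>R u)"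
      using d1(2)[of "p + z *\<^sub>R u"] n1 by simp
    have Deq: "D (z *\<^sub>R u + s *\<^sub>R v) = D (z *\<^sub>R u) + s * D v"
      by (simp add: D.add D.scaleR)
    have nn: "norm (z *\<^sub>R u + s *\<^sub>R v) + norm (z *\<^sub>R u) \<le> s * K"
    proof -
      have "norm (z *\<^sub>R u + s *\<^sub>R v) \<le> z * norm u + s * norm v"
        using z s by (intro norm_triangle_le) simp
      moreover have "z * norm u \<le> s * norm u"
        using z by (intro mult_right_mono) auto
      ultimately show ?thesis using z s by (simp add: K_def algebra_simps)
    qed
    have "\<bar>(f' (p + z *\<^sub>R u + s *\<^sub>R v) u - f' (p + z *\<^sub>R u) u) - s * D v\<bar>
        \<le> e / (2 * K) * (norm (z *\<^sub>R u + s *\<^sub>R v) + norm (z *\<^sub>R u))"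
      using b1 b2 unfolding Deq distrib_left by linarith
    also have "\<dots> \<le> e / (2 * K) * (s * K)"
      using nn e K by (intro mult_left_mono) auto
    also have "\<dots> = e / 2 * s" using K by simp
    finally have bd: "\<bar>(f' (p + z *\<^sub>R u + s *\<^sub>R v) u - f' (p + z *\<^sub>R u) u) - s * D v\<bar> \<le> e / 2 * s" .
    let ?Q = "f' (p + z *\<^sub>R u + s *\<^sub>R v) u - f' (p + z *\<^sub>R u) u"
    have "f (p + s *\<^sub>R u + s *\<^sub>R v) - f (p + s *\<^sub>R u) - f (p + s *\<^sub>R v) + f p = s * ?Q"
      using z(3) by simp
    then have "dist ((f (p + s *\<^sub>R u + s *\<^sub>R v) - f (p + s *\<^sub>R u) - f (p + s *\<^sub>R v) + f p) / s\<^sup>2) (D v)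
        = \<bar>(?Q - s * D v) / s\<bar>"
    proof -
      assume eq: "f (p + s *\<^sub>R u + s *\<^sub>R v) - f (p + s *\<^sub>R u) - f (p + s *\<^sub>R v) + f p = s * ?Q"
      have "(s * x) / s\<^sup>2 - y = (x - s * y) / s" for x y
        using s by (simp add: power2_eq_square field_simps)
      then show ?thesis unfolding eq dist_real_def by simp
    qed
    also have "\<dots> \<le> e / 2"
      using bd s by (simp add: field_simps)
    also have "\<dots> < e" using e by simp
    finally show ?thesis .
  qed
  then show "\<forall>\<^sub>F s in at_right 0. dist ((f (p + s *\<^sub>R u + s *\<^sub>R v) - f (p + s *\<^sub>R u) - f (p + s *\<^sub>R v) + f p) / s\<^sup>2) (D v) < e"
    unfolding eventually_at_right_field using d by auto
qed

text \<open>
  Symmetry under the weak hypothesis that the two first derivatives in question are differentiable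
  at the single point \<open>p\<close>: the second difference is symmetric in \<open>u\<close> and \<open>v\<close> and converges to both sides.
\<close>

lemma second_derivative_symmetric:
  fixes f :: "'e::real_normed_vector \<Rightarrow> real"
  assumes U: "open U" "p \<in> U"
    and f: "\<And>x. x \<in> U \<Longrightarrow> (f has_derivative f' x) (at x)"
    and "((\<lambda>x. f' x u) has_derivative Du) (at p)"
    and "((\<lambda>x. f' x v) has_derivative Dv) (at p)"
  shows "Du v = Dv u"
proof -
  have 1: "((\<lambda>s. (f (p + s *\<^sub>R u + s *\<^sub>R v) - f (p + s *\<^sub>R u) - f (p + s *\<^sub>R v) + f p) / s\<^sup>2)
           \<longlongrightarrow> Du v) (at_right 0)"
    by (rule second_difference_limit[OF assms(1-4)])
  have 2: "((\<lambda>s. (f (p + s *\<^sub>R v + s *\<^sub>R u) - f (p + s *\<^sub>R v) - f (p + s *\<^sub>R u) + f p) / s\<^sup>2)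
           \<longlongrightarrow> Dv u) (at_right 0)"
    by (rule second_difference_limit[OF assms(1-3,5)])
  have "((\<lambda>s. (f (p + s *\<^sub>R u + s *\<^sub>R v) - f (p + s *\<^sub>R u) - f (p + s *\<^sub>R v) + f p) / s\<^sup>2)
           \<longlongrightarrow> Dv u) (at_right 0)"
    by (rule Lim_transform_eventually[OF 2]) (auto intro!: always_eventually simp: algebra_simps)
  with 1 show ?thesis
    using tendsto_unique trivial_limit_at_right_real by blast
qed

text \<open>
  Implicit function theorem in the form of a local change of coordinates \<open>\<Phi>\<close> that carries the level set
  to a hyperplane.  \<open>\<Phi>\<close> is the identity corrected in one direction \<open>m\<close> so that its
  \<open>grad f p\<close>-component becomes \<open>f\<close>; its derivative at \<open>p\<close> is the identity.
\<close>

lemma C1_level_straightening: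
  fixes f :: "'e::euclidean_space \<Rightarrow> real"
  assumes U: "open U" and f: "Ck_on 1 f U" and p: "p \<in> U" "f p = 0" "grad f p \<noteq> 0"
  obtains V r \<Phi> g where "open V" "p \<in> V" "V \<subseteq> U" "r > 0"
    "homeomorphism V (ball p r) \<Phi> g"
    "\<And>q. q \<in> V \<Longrightarrow> grad f p \<bullet> (\<Phi> q - p) = f q"
    "\<And>y. y \<in> ball p r \<Longrightarrow> g differentiable (at y)"
    "(g has_derivative (\<lambda>z. z)) (at p)" "g p = p"
proof -
  define e where "e = grad f p"
  define m where "m = e /\<^sub>R (e \<bullet> e)"
  have em: "e \<bullet> m = 1" using p by (simp add: m_def e_def)
  define \<Phi> where "\<Phi> q = q + (f q - e \<bullet> (q - p)) *\<^sub>R m" for q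
  define \<Phi>' where "\<Phi>' q = id_blinfun + (blinfun_scaleR_left m o\<^sub>L blinfun_inner_left (grad f q - e))" for q
  have \<Phi>'_app: "blinfun_apply (\<Phi>' q) z = z + ((grad f q - e) \<bullet> z) *\<^sub>R m" for q z
    by (simp add: \<Phi>'_def blinfun.add_left inner_commute)
  have der: "(\<Phi> has_derivative blinfun_apply (\<Phi>' q)) (at q)" if "q \<in> U" for q
  proof -
    have "(f has_derivative (\<lambda>v. grad f q \<bullet> v)) (at q)"
      using Ck_on_1D(1)[OF f that] by (rule has_derivative_grad)
    then show ?thesis
      unfolding \<Phi>_def[abs_def]
      by (auto intro!: derivative_eq_intros simp: \<Phi>'_app fun_eq_iff inner_diff_left inner_diff_right)
  qed
  have cont: "continuous_on U \<Phi>'"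
    unfolding \<Phi>'_def[abs_def] using Ck_on_1D(3)[OF f]
    by (intro continuous_intros bounded_linear.continuous_on[OF bounded_linear_blinfun_inner_left]
          bounded_bilinear.continuous_on[OF bounded_bilinear_blinfun_compose]) auto
  have idp: "\<Phi>' p = id_blinfun"
    by (rule blinfun_eqI) (simp add: \<Phi>'_app e_def)
  then have inv: "id_blinfun o\<^sub>L \<Phi>' p = id_blinfun"
    by (intro blinfun_eqI) simp
  obtain U' V g g' where I: "open U'" "U' \<subseteq> U" "p \<in> U'" "open V" "\<Phi> p \<in> V" "homeomorphism U' V \<Phi> g"
    "\<And>y. y \<in> V \<Longrightarrow> (g has_derivative (g' y)) (at y)"
    "\<And>y. y \<in> V \<Longrightarrow> g' y = inv (blinfun_apply (\<Phi>' (g y)))"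
    using inverse_function_theorem[OF U der cont p(1) inv] by metis
  have \<Phi>p: "\<Phi> p = p" using p by (simp add: \<Phi>_def)
  obtain r where r: "r > 0" "ball p r \<subseteq> V"
    using I \<Phi>p open_contains_ball by metis
  have gp: "g p = p" using I(3,6) \<Phi>p by (metis homeomorphism_apply1)
  show ?thesis
  proof (rule that[of "U' \<inter> \<Phi> -` ball p r" r \<Phi> g])
    show "open (U' \<inter> \<Phi> -` ball p r)"
      using I by (intro continuous_open_preimage) (auto simp: homeomorphism_def)
    show "p \<in> U' \<inter> \<Phi> -` ball p r" using I r \<Phi>p by auto
    show "U' \<inter> \<Phi> -` ball p r \<subseteq> U" using I by auto
    show "homeomorphism (U' \<inter> \<Phi> -` ball p r) (ball p r) \<Phi> g"
    proof -
      have "g ` ball p r = U' \<inter> \<Phi> -` ball p r"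
        using I(6) r(2) unfolding homeomorphism_def
        by (auto simp: image_iff subset_iff) (metis mem_ball)
      moreover have "\<Phi> ` (U' \<inter> \<Phi> -` ball p r) = ball p r"
        using homeomorphism_image1[OF I(6)] r(2) by blast
      ultimately show ?thesis
        using homeomorphism_of_subsets[OF I(6)] r by (metis inf_le1)
    qed
    show "grad f p \<bullet> (\<Phi> q - p) = f q" if "q \<in> U' \<inter> \<Phi> -` ball p r" for q
    proof -
      have "e \<bullet> (\<Phi> q - p) = e \<bullet> (q - p) + (f q - e \<bullet> (q - p)) * (e \<bullet> m)"
        by (simp add: \<Phi>_def algebra_simps inner_add_right inner_diff_right)
      then show ?thesis using em by (simp add: e_def)
    qed
    show "g differentiable (at y)" if "y \<in> ball p r" for y
      using I(7) r that differentiableI by blast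
    show "(g has_derivative (\<lambda>z. z)) (at p)"
    proof -
      have "p \<in> V" using r by auto
      then have "g' p = inv (blinfun_apply (\<Phi>' p))" using I(8)[of p] gp by simp
      also have "\<dots> = (\<lambda>z. z)" by (simp add: idp inv_id[unfolded id_def])
      finally show ?thesis using I(7)[of p] \<open>p \<in> V\<close> by simp
    qed
  qed (use r gp in auto)
qed

lemma level_set_path_connected_nbhd:
  fixes f :: "'e::euclidean_space \<Rightarrow> real"
  assumes "open U" "Ck_on 1 f U" "p \<in> U" "f p = 0" "grad f p \<noteq> 0"
  obtains V where "open V" "p \<in> V" "V \<subseteq> U" "path_connected {q \<in> V. f q = 0}"
proof -
  obtain V r \<Phi> g where I: "open V" "p \<in> V" "V \<subseteq> U" "r > 0"
    "homeomorphism V (ball p r) \<Phi> g"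
    "\<And>q. q \<in> V \<Longrightarrow> grad f p \<bullet> (\<Phi> q - p) = f q"
    using C1_level_straightening[OF assms] by metis
  have "{q \<in> V. f q = 0} = g ` (ball p r \<inter> {y. grad f p \<bullet> y = grad f p \<bullet> p})"
  proof (intro set_eqI iffI)
    fix q assume "q \<in> {q \<in> V. f q = 0}"
    then show "q \<in> g ` (ball p r \<inter> {y. grad f p \<bullet> y = grad f p \<bullet> p})"
      using I(5) I(6)[of q] unfolding homeomorphism_def
      by (intro image_eqI[of _ _ "\<Phi> q"]) (auto simp: inner_diff_right simp del: mem_ball)
  next
    fix q assume "q \<in> g ` (ball p r \<inter> {y. grad f p \<bullet> y = grad f p \<bullet> p})"
    then obtain y where y: "y \<in> ball p r" "grad f p \<bullet> y = grad f p \<bullet> p" "q = g y" by blast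
    then have "q \<in> V" "\<Phi> q = y" using I(5) unfolding homeomorphism_def by (auto simp del: mem_ball)
    then show "q \<in> {q \<in> V. f q = 0}"
      using I(6)[of q] y by (auto simp: inner_diff_right)
  qed
  moreover have "path_connected (g ` (ball p r \<inter> {y. grad f p \<bullet> y = grad f p \<bullet> p}))"
  proof (rule path_connected_continuous_image)
    show "continuous_on (ball p r \<inter> {y. grad f p \<bullet> y = grad f p \<bullet> p}) g"
      using I(5) unfolding homeomorphism_def by (auto intro: continuous_on_subset)
    show "path_connected (ball p r \<inter> {y. grad f p \<bullet> y = grad f p \<bullet> p})"
      by (intro convex_imp_path_connected convex_Int convex_hyperplane) auto
  qed
  ultimately show ?thesis using that[of V] I by simp
qed

lemma level_set_curve:
  fixes f :: "'e::euclidean_space \<Rightarrow> real"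
  assumes "open U" "Ck_on 1 f U" "p \<in> U" "f p = 0" "grad f p \<noteq> 0" and X: "grad f p \<bullet> X = 0"
  obtains c where "c 0 = p" "(c has_vector_derivative X) (at 0)"
    "\<forall>\<^sub>F t in nhds 0. c t \<in> U \<and> f (c t) = 0"
proof -
  obtain V r \<Phi> g where I: "open V" "p \<in> V" "V \<subseteq> U" "r > 0"
    "homeomorphism V (ball p r) \<Phi> g"
    "\<And>q. q \<in> V \<Longrightarrow> grad f p \<bullet> (\<Phi> q - p) = f q"
    "(g has_derivative (\<lambda>z. z)) (at p)" "g p = p"
    using C1_level_straightening[OF assms(1-5)] by metis
  define c where "c t = g (p + t *\<^sub>R X)" for t
  have "c 0 = p" by (simp add: c_def I)
  moreover have "(c has_vector_derivative X) (at 0)"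
  proof -
    have "(g has_derivative (\<lambda>z. z)) (at (p + 0 *\<^sub>R X))" using I(7) by simp
    then have "((\<lambda>t. g (p + t *\<^sub>R X)) has_derivative (\<lambda>x. x *\<^sub>R X)) (at 0)"
      by (rule has_derivative_compose[rotated]) (auto intro!: derivative_eq_intros)
    then show ?thesis by (simp add: c_def[abs_def] has_vector_derivative_def)
  qed
  moreover have "\<forall>\<^sub>F t in nhds 0. c t \<in> U \<and> f (c t) = 0"
  proof -
    have "continuous_on UNIV (\<lambda>t. p + t *\<^sub>R X)" by (intro continuous_intros)
    then have "open ((\<lambda>t. p + t *\<^sub>R X) -` ball p r)"
      using open_vimage open_ball by blast
    then have "\<forall>\<^sub>F t in nhds 0. t \<in> (\<lambda>t. p + t *\<^sub>R X) -` ball p r"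
      using I(4) by (intro eventually_nhds_in_open) auto
    then show ?thesis
    proof eventually_elim
      case (elim t)
      then have "p + t *\<^sub>R X \<in> ball p r" by simp
      then have "c t \<in> V" "\<Phi> (c t) = p + t *\<^sub>R X"
        using I(5) unfolding homeomorphism_def c_def by (auto simp del: mem_ball)
      then show ?case using I(3) I(6)[of "c t"] X by auto
    qed
  qed
  ultimately show ?thesis by (rule that)
qed

text \<open>
  A tangent vector of the level set is the velocity of a curve inside it, along which \<open>k\<close> is constant.
\<close>

lemma level_set_derivative_zero:
  fixes f :: "'e::euclidean_space \<Rightarrow> real" and k :: "'e \<Rightarrow> 'c::real_normed_vector"
  assumes "open U" "Ck_on 1 f U" "p \<in> U" "f p = 0" "grad f p \<noteq> 0" and X: "grad f p \<bullet> X = 0"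
    and k: "(k has_derivative k') (at p)"
    and z: "\<And>q. q \<in> U \<Longrightarrow> f q = 0 \<Longrightarrow> k q = k0"
  shows "k' X = 0"
proof -
  obtain c where c: "c 0 = p" "(c has_vector_derivative X) (at 0)"
    "\<forall>\<^sub>F t in nhds 0. c t \<in> U \<and> f (c t) = 0"
    using level_set_curve[OF assms(1-6)] by metis
  have "(k has_derivative k') (at (c 0))" using k c by simp
  then have 1: "((\<lambda>t. k (c t)) has_vector_derivative k' X) (at 0)"
    using vector_derivative_diff_chain_within[of c X 0 UNIV k k'] c(2)
    by (auto simp: o_def intro: has_derivative_at_withinI)
  have 2: "\<forall>\<^sub>F t in nhds 0. k (c t) = k0" using c(3) by eventually_elim (use z in auto)
  have "((\<lambda>t. k (c t)) has_vector_derivative 0) (at 0)"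
    unfolding has_vector_derivative_def
    by (rule has_derivative_transform_eventually[of "\<lambda>t. k0"])
       (use eventually_nhds_x_imp_x[OF 2] 2 in \<open>auto simp: eventually_at_filter elim: eventually_mono\<close>)
  with 1 show ?thesis using vector_derivative_unique_at by blast
qed

text \<open>
  The conclusion is uniform in \<open>k\<close>: one neighbourhood works for all functions whose derivative
  vanishes along the level set, since each of its points is joined to \<open>p\<close> by a differentiable curve
  in the level set.
\<close>

lemma level_set_locally_constant:
  fixes f :: "'e::euclidean_space \<Rightarrow> real"
  assumes "open U" "Ck_on 1 f U" "p \<in> U" "f p = 0" "grad f p \<noteq> 0"
  obtains V where "open V" "p \<in> V" "V \<subseteq> U"
    "\<And>(k :: 'e \<Rightarrow> 'c::real_normed_vector) k' q.
       (\<And>q. q \<in> V \<Longrightarrow> f q = 0 \<Longrightarrow> (k has_derivative k' q) (at q)) \<Longrightarrow>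
       (\<And>q X. q \<in> V \<Longrightarrow> f q = 0 \<Longrightarrow> grad f q \<bullet> X = 0 \<Longrightarrow> k' q X = 0) \<Longrightarrow>
       q \<in> V \<Longrightarrow> f q = 0 \<Longrightarrow> k q = k p"
proof -
  obtain V r \<Phi> g where I: "open V" "p \<in> V" "V \<subseteq> U" "r > 0"
    "homeomorphism V (ball p r) \<Phi> g"
    "\<And>q. q \<in> V \<Longrightarrow> grad f p \<bullet> (\<Phi> q - p) = f q"
    "\<And>y. y \<in> ball p r \<Longrightarrow> g differentiable (at y)" "g p = p"
    using C1_level_straightening[OF assms(1-5)] by metis
  show ?thesis
  proof (rule that[OF I(1-3)])
    fix k :: "'e \<Rightarrow> 'c" and k' q
    assume k: "\<And>q. q \<in> V \<Longrightarrow> f q = 0 \<Longrightarrow> (k has_derivative k' q) (at q)"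
      and z: "\<And>q X. q \<in> V \<Longrightarrow> f q = 0 \<Longrightarrow> grad f q \<bullet> X = 0 \<Longrightarrow> k' q X = 0"
      and q: "q \<in> V" "f q = 0"
    define z where "z t = p + t *\<^sub>R (\<Phi> q - p)" for t :: real
    define c where "c t = g (z t)" for t
    have \<Phi>q: "\<Phi> q \<in> ball p r" "g (\<Phi> q) = q"
      using I(5) q unfolding homeomorphism_def by blast+
    have zt: "z t \<in> ball p r" if "t \<in> {0..1}" for t
    proof -
      have "norm (t *\<^sub>R (\<Phi> q - p)) \<le> norm (\<Phi> q - p)"
        using that by (simp add: mult_left_le_one_le)
      also have "\<dots> < r" using \<Phi>q(1) by (simp add: dist_norm norm_minus_commute)
      finally show ?thesis by (simp add: z_def dist_norm)
    qed
    have ct: "c t \<in> V" "f (c t) = 0" if "t \<in> {0..1}" for t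
    proof -
      have *: "c t \<in> V" "\<Phi> (c t) = z t"
        using I(5) zt[OF that] unfolding homeomorphism_def c_def by (auto simp del: mem_ball)
      then show "c t \<in> V" by blast
      show "f (c t) = 0"
        using I(6)[OF *(1)] I(6)[OF q(1)] q *(2) by (simp add: z_def)
    qed
    have dk: "((\<lambda>t. k (c t)) has_derivative (\<lambda>h. 0)) (at t within {0..1})" if t: "t \<in> {0..1}" for t
    proof -
      have "c differentiable (at t)"
        unfolding c_def[abs_def]
        by (rule differentiable_compose[where f = g, unfolded o_def])
           (use I(7) zt[OF t] in \<open>auto simp: z_def[abs_def] simp del: mem_ball\<close>)
      then obtain X where X: "(c has_vector_derivative X) (at t)"
        using vector_derivative_works by blast
      have cU: "c t \<in> U" using ct t I by blast
      have df: "(f has_derivative (\<lambda>v. grad f (c t) \<bullet> v)) (at (c t))"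
        using Ck_on_1D(1)[OF assms(2) cU] by (rule has_derivative_grad)
      have "((\<lambda>t. f (c t)) has_vector_derivative grad f (c t) \<bullet> X) (at t within {0..1})"
        using vector_derivative_diff_chain_within[of c X t "{0..1}" f] X df
        by (auto simp: o_def intro: has_derivative_at_withinI has_vector_derivative_at_within)
      moreover have "((\<lambda>t. f (c t)) has_vector_derivative 0) (at t within {0..1})"
        by (rule has_vector_derivative_transform[of t "{0..1}" _ "\<lambda>t. 0"])
           (use ct t in auto)
      ultimately have "grad f (c t) \<bullet> X = 0"
        using vector_derivative_unique_within[of t "{0..1}"] t
        by (metis atLeastAtMost_singleton_iff box_real(2) islimpt_Icc trivial_limit_within zero_less_one)
      then have "k' (c t) X = 0" using ct[OF t] z by blast
      moreover have "((\<lambda>t. k (c t)) has_vector_derivative k' (c t) X) (at t within {0..1})"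
        using vector_derivative_diff_chain_within[of c X t "{0..1}" k "k' (c t)"] X k[OF ct[OF t]]
        by (auto simp: o_def intro: has_derivative_at_withinI has_vector_derivative_at_within)
      ultimately show ?thesis by (simp add: has_vector_derivative_def)
    qed
    then obtain d where "\<And>t. t \<in> {0..1} \<Longrightarrow> k (c t) = d"
      using has_derivative_zero_constant[of "{0..1::real}" "\<lambda>t. k (c t)"] by auto
    then have "k (c 0) = k (c 1)" by simp
    then show "k q = k p" using \<Phi>q I(8) by (simp add: c_def z_def)
  qed
qed


section \<open>Euclidean spheres and hyperplanes\<close>

definition quad :: "real \<Rightarrow> 'e::euclidean_space \<Rightarrow> real \<Rightarrow> 'e \<Rightarrow> real" where
  "quad a v d q = a * (q \<bullet> q) + v \<bullet> q + d"

abbreviation quad_grad :: "real \<Rightarrow> 'e::euclidean_space \<Rightarrow> 'e \<Rightarrow> 'e" where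
  "quad_grad a v q \<equiv> (2 * a) *\<^sub>R q + v"

text \<open>
  The normalisation makes the gradient a Euclidean unit vector along the zero set.  In the half-space,
  where \<open>snd q *\<^sub>R quad_grad a v q\<close> is then the hyperbolic unit normal, it makes the mean curvature of the
  zero set equal to \<open>- snd v\<close>.
\<close>

definition unit_quad :: "real \<Rightarrow> 'e::euclidean_space \<Rightarrow> real \<Rightarrow> bool" where
  "unit_quad a v d \<longleftrightarrow> v \<bullet> v - 4 * a * d = 1"

definition quadric :: "real \<Rightarrow> 'a::euclidean_space \<times> real \<Rightarrow> real \<Rightarrow> ('a \<times> real) set" where
  "quadric a v d = {q \<in> half_space. quad a v d q = 0}"

lemma quad_has_derivative:
  "(quad a v d has_derivative (\<lambda>X. quad_grad a v q \<bullet> X)) (at q)"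
  unfolding quad_def[abs_def]
  by (auto intro!: derivative_eq_intros simp: fun_eq_iff inner_add_left inner_commute algebra_simps)

lemma quad_differentiable: "quad a v d differentiable (at q)"
  using quad_has_derivative differentiableI by blast

lemma frechet_quad: "frechet_derivative (quad a v d) (at q) X = quad_grad a v q \<bullet> X"
  using frechet_derivative_at[OF quad_has_derivative] by metis

lemma grad_quad: "grad (quad a v d) q = quad_grad a v q"
  by (rule grad_eqI[OF quad_has_derivative])

lemma Ck_on_const: "Ck_on k (\<lambda>x. c) S"
  by (induction k arbitrary: c) auto

lemma Ck_on_affine: "Ck_on k (\<lambda>x. w \<bullet> x + c) S"
proof (cases k)
  case (Suc j)
  have d: "((\<lambda>x. w \<bullet> x + c) has_derivative (\<lambda>X. w \<bullet> X)) (at x)" for x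
    by (auto intro!: derivative_eq_intros)
  have "frechet_derivative (\<lambda>x. w \<bullet> x + c) (at x) X = w \<bullet> X" for x X
    using frechet_derivative_at[OF d] by metis
  with d show ?thesis unfolding Suc by (auto simp: Ck_on_const intro: differentiableI)
qed (auto intro!: continuous_intros)

lemma smooth_on_quad: "smooth_on (quad a v d) S"
proof -
  have "Ck_on k (quad a v d) S" for k
  proof (cases k)
    case 0
    then show ?thesis
      unfolding quad_def[abs_def] by (auto intro!: continuous_intros)
  next
    case (Suc j)
    have "frechet_derivative (quad a v d) (at x) X = ((2 * a) *\<^sub>R X) \<bullet> x + v \<bullet> X" for x X
      by (simp add: frechet_quad inner_add_left inner_add_right inner_commute)
    then have "Ck_on j (\<lambda>x. frechet_derivative (quad a v d) (at x) X) S" for X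
      by (simp only: Ck_on_affine)
    then show ?thesis unfolding Suc by (simp add: quad_differentiable)
  qed
  then show ?thesis by (simp add: smooth_on_def)
qed

lemma Ck1_quad: "Ck_on 1 (quad a v d) S"
  using smooth_on_quad smooth_on_Ck1 by blast

lemma quad_add: "quad a v d (q + z) = quad a v d q + quad_grad a v q \<bullet> z + a * (z \<bullet> z)"
  by (simp add: quad_def inner_add_left inner_add_right inner_commute algebra_simps)

lemma quad_uminus: "quad (- a) (- v) (- d) q = - quad a v d q"
  by (simp add: quad_def)

lemma unit_quad_uminus: "unit_quad (- a) (- v) (- d) \<longleftrightarrow> unit_quad a v d"
  by (simp add: unit_quad_def)

lemma quadric_uminus: "quadric (- a) (- v) (- d) = quadric a v d"
  by (simp add: quadric_def quad_uminus)

lemma norm_grad_quad: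
  assumes "unit_quad a v d" "quad a v d q = 0"
  shows "norm (quad_grad a v q) = 1"
proof -
  have "quad_grad a v q \<bullet> (quad_grad a v q) = 4 * a * (a * (q \<bullet> q) + v \<bullet> q) + v \<bullet> v"
    by (simp add: inner_add_left inner_add_right inner_commute algebra_simps)
  also have "a * (q \<bullet> q) + v \<bullet> q = - d" using assms(2) by (simp add: quad_def)
  finally have "quad_grad a v q \<bullet> (quad_grad a v q) = 1"
    using assms(1) by (simp add: unit_quad_def)
  then show ?thesis by (simp add: norm_eq_sqrt_inner)
qed

lemma parallel_if_orthogonal_imp_orthogonal:
  fixes m m' :: "'e::real_inner"
  assumes "norm m = 1" and "\<And>X. m \<bullet> X = 0 \<Longrightarrow> m' \<bullet> X = 0"
  shows "m' = (m \<bullet> m') *\<^sub>R m"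
proof -
  let ?X = "m' - (m \<bullet> m') *\<^sub>R m"
  have mm: "m \<bullet> m = 1" using assms(1) by (simp add: norm_eq_1)
  have 0: "m \<bullet> ?X = 0" using mm by (simp add: inner_diff_right)
  have "?X \<bullet> ?X = m' \<bullet> ?X - (m \<bullet> m') * (m \<bullet> ?X)"
    by (simp add: inner_diff_left)
  also have "\<dots> = 0" using 0 assms(2)[OF 0] by simp
  finally show ?thesis by simp
qed

text \<open>
  The common tangent hyperplane at \<open>q\<close> gives \<open>grad = \<plusminus> grad'\<close> there.  At a second common zero \<open>q + z\<close> both
  equations read \<open>grad \<bullet> z + a (z \<bullet> z) = 0\<close>, which fixes \<open>a\<close>; then \<open>v\<close> and \<open>d\<close> follow.
\<close>

lemma quad_rigid:
  fixes v v' :: "'e::euclidean_space"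
  assumes dim: "DIM('e) \<ge> 2"
    and u: "unit_quad a v d" "unit_quad a' v' d'"
    and q: "quad a v d q = 0" "open V" "q \<in> V"
    and sub: "\<And>x. x \<in> V \<Longrightarrow> quad a v d x = 0 \<Longrightarrow> quad a' v' d' x = 0"
  obtains "a' = a" "v' = v" "d' = d" | "a' = - a" "v' = - v" "d' = - d"
proof -
  define m where "m = quad_grad a v q"
  define m' where "m' = (2 * a') *\<^sub>R q + v'"
  have q': "quad a' v' d' q = 0" using q sub by blast
  have n: "norm m = 1" "norm m' = 1"
    using norm_grad_quad u q q' by (auto simp: m_def m'_def)
  have nz: "grad (quad a v d) q \<noteq> 0" using n by (auto simp: grad_quad m_def)
  have orth: "m' \<bullet> X = 0" if "m \<bullet> X = 0" for X
  proof -
    have g: "grad (quad a v d) q \<bullet> X = 0" using that by (simp add: grad_quad m_def)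
    show ?thesis
      using level_set_derivative_zero[OF q(2) Ck1_quad q(3) q(1) nz g quad_has_derivative[of a' v' d'], of 0] sub
      by (simp add: m'_def)
  qed
  define s where "s = m \<bullet> m'"
  have m's: "m' = s *\<^sub>R m"
    unfolding s_def by (rule parallel_if_orthogonal_imp_orthogonal[OF n(1) orth])
  with n have s1: "s = 1 \<or> s = - 1" by auto
  obtain X where X: "X \<noteq> 0" "m \<bullet> X = 0"
    using orthogonal_to_vector_exists[OF dim, of m] by (auto simp: orthogonal_def)
  have gX: "grad (quad a v d) q \<bullet> X = 0" using X by (simp add: grad_quad m_def)
  obtain c where c: "c 0 = q" "(c has_vector_derivative X) (at 0)"
    "\<forall>\<^sub>F t in nhds 0. c t \<in> V \<and> quad a v d (c t) = 0"
    using level_set_curve[OF q(2) Ck1_quad q(3) q(1) nz gX] by metis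
  \<comment> \<open>A curve with nonzero velocity leaves its starting point, so there is a second common zero.\<close>
  have "\<not> (\<forall>\<^sub>F t in nhds 0. c t = q)"
  proof
    assume ev: "\<forall>\<^sub>F t in nhds 0. c t = q"
    have "(c has_vector_derivative 0) (at 0)"
      unfolding has_vector_derivative_def
      by (rule has_derivative_transform_eventually[of "\<lambda>t. q"])
         (use c(1) ev in \<open>auto simp: eventually_at_filter elim: eventually_mono\<close>)
    with c(2) X(1) show False using vector_derivative_unique_at by blast
  qed
  then have "\<exists>t. c t \<noteq> q \<and> c t \<in> V \<and> quad a v d (c t) = 0"
    using eventually_mono[OF c(3), of "\<lambda>t. c t = q"] by blast
  then obtain t where t: "c t \<noteq> q" "c t \<in> V" "quad a v d (c t) = 0" by blast
  define z where "z = c t - q"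
  have cz: "c t = q + z" by (simp add: z_def)
  have zz: "z \<bullet> z \<noteq> 0" using t by (simp add: z_def)
  have 1: "m \<bullet> z + a * (z \<bullet> z) = 0"
    using t(3) q(1) unfolding cz quad_add m_def by simp
  have 2: "m' \<bullet> z + a' * (z \<bullet> z) = 0"
    using sub[OF t(2,3)] q' unfolding cz quad_add m'_def by simp
  have "(a' - s * a) * (z \<bullet> z) = (m' \<bullet> z + a' * (z \<bullet> z)) - s * (m \<bullet> z + a * (z \<bullet> z))"
    by (simp add: m's algebra_simps)
  then have a': "a' = s * a" using 1 2 zz by simp
  have v': "v' = s *\<^sub>R v"
    using m's by (simp add: m_def m'_def a' algebra_simps)
  have d': "d' = s * d"
  proof -
    have "d' - s * d = quad a' v' d' q - s * quad a v d q"
      by (simp add: quad_def a' v' algebra_simps)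
    then show ?thesis using q q' by simp
  qed
  from s1 show ?thesis
    using a' v' d' that by auto
qed

lemma half_space_eq_halfspace: "half_space = {p. (0, 1) \<bullet> p > 0}"
  by (auto simp: half_space_def inner_prod_def)

lemma open_half_space: "open (half_space :: ('a::euclidean_space \<times> real) set)"
  unfolding half_space_eq_halfspace by (rule open_halfspace_gt)

lemma convex_half_space: "convex (half_space :: ('a::euclidean_space \<times> real) set)"
  unfolding half_space_eq_halfspace by (rule convex_halfspace_gt)

lemma inner_prod_real: "(p :: 'a::euclidean_space \<times> real) \<bullet> q = fst p \<bullet> fst q + snd p * snd q"
  by (simp add: inner_prod_def)

text \<open>
  Every point is joined to the top of the sphere along a meridian, on which the height increases.
\<close>

lemma path_connected_sphere_half_space:
  fixes c :: "'a::euclidean_space \<times> real"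
  assumes R: "R > 0"
  shows "path_connected (sphere c R \<inter> half_space)"
proof -
  let ?S = "sphere c R \<inter> half_space"
  let ?T = "c + R *\<^sub>R (0, 1)"
  have "path_component ?S q ?T" if q: "q \<in> ?S" for q
  proof -
    define w where "w = (q - c) /\<^sub>R R"
    have qw: "q = c + R *\<^sub>R w" using R by (simp add: w_def)
    have nw: "norm w = 1" using q R by (simp add: w_def dist_norm norm_minus_commute)
    then have nw2: "fst w \<bullet> fst w + (snd w)\<^sup>2 = 1"
      by (simp add: norm_eq_1 inner_prod_real power2_eq_square)
    have sw: "- 1 \<le> snd w" "snd w \<le> 1"
      using norm_snd_le[of "snd w" "fst w"] nw by (auto simp: abs_le_iff)
    \<comment> \<open>\<open>u\<close> is the horizontal direction of the meridian; at the two poles it is arbitrary.\<close>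
    obtain u :: 'a where u: "norm u = 1" "fst w = sqrt (1 - (snd w)\<^sup>2) *\<^sub>R u"
    proof (cases "fst w = 0")
      case True
      obtain b :: 'a where "b \<in> Basis" using nonempty_Basis by blast
      then show ?thesis using that[of b] True nw2 by simp
    next
      case False
      have "sqrt (1 - (snd w)\<^sup>2) = norm (fst w)"
        using nw2 by (simp add: norm_eq_sqrt_inner)
      then show ?thesis using that[of "fst w /\<^sub>R norm (fst w)"] False by simp
    qed
    define e where "e s = snd w + s * (1 - snd w)" for s
    define g where "g s = c + R *\<^sub>R (sqrt (1 - (e s)\<^sup>2) *\<^sub>R u, e s)" for s
    have "path g"
      unfolding path_def g_def e_def by (intro continuous_intros)
    moreover have "path_image g \<subseteq> ?S"
    proof -
      have "g s \<in> ?S" if s: "s \<in> {0..1}" for s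
      proof -
        have e1: "snd w \<le> e s" "e s \<le> 1"
        proof -
          show "snd w \<le> e s" using s sw by (simp add: e_def)
          have "s * (1 - snd w) \<le> 1 * (1 - snd w)" using s sw by (intro mult_right_mono) auto
          then show "e s \<le> 1" by (simp add: e_def)
        qed
        then have "(e s)\<^sup>2 \<le> 1" using sw by (simp add: abs_square_le_1)
        then have "norm (sqrt (1 - (e s)\<^sup>2) *\<^sub>R u, e s) = 1"
          using u(1) by (simp add: norm_Pair)
        then have "norm (R *\<^sub>R (sqrt (1 - (e s)\<^sup>2) *\<^sub>R u, e s)) = R"
          using R by (simp only: norm_scaleR)
        then have "dist (g s) c = R"
          by (simp only: g_def dist_norm add_diff_cancel_left')
        then have "g s \<in> sphere c R" by (simp add: dist_commute)
        moreover have "snd (g s) > 0"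
        proof -
          have "snd c + R * snd w > 0" using q unfolding qw by (simp add: half_space_def)
          moreover have "R * snd w \<le> R * e s" using e1 R by simp
          ultimately show ?thesis by (simp add: g_def)
        qed
        ultimately show ?thesis by (simp add: half_space_def)
      qed
      then show ?thesis by (auto simp: path_image_def)
    qed
    moreover have "pathstart g = q"
      using u(2) by (simp add: pathstart_def g_def e_def qw prod_eq_iff)
    moreover have "pathfinish g = ?T"
      by (simp add: pathfinish_def g_def e_def)
    ultimately show ?thesis unfolding path_component_def by blast
  qed
  then show ?thesis
    unfolding path_connected_component by (meson path_component_sym path_component_trans)
qed

lemma quad_zero_sphere:
  fixes v :: "'e::euclidean_space"
  assumes "unit_quad a v d" "a \<noteq> 0"
  shows "{q. quad a v d q = 0} = sphere (- v /\<^sub>R (2 * a)) (1 / (2 * \<bar>a\<bar>))"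
proof -
  have "quad a v d q = 0 \<longleftrightarrow> q \<in> sphere (- v /\<^sub>R (2 * a)) (1 / (2 * \<bar>a\<bar>))" for q
  proof -
    have 4: "4 * a * quad a v d q = quad_grad a v q \<bullet> (quad_grad a v q) - 1"
      using assms(1) by (simp add: unit_quad_def quad_def inner_add_left inner_add_right inner_commute algebra_simps)
    have "quad_grad a v q = (2 * a) *\<^sub>R (q - (- v /\<^sub>R (2 * a)))"
      using assms(2) by (simp add: algebra_simps)
    then have "norm (quad_grad a v q) = 2 * \<bar>a\<bar> * dist (- v /\<^sub>R (2 * a)) q"
      by (simp only: norm_scaleR dist_norm norm_minus_commute[of q] abs_mult abs_numeral)
    then have "dist (- v /\<^sub>R (2 * a)) q = 1 / (2 * \<bar>a\<bar>) \<longleftrightarrow> norm (quad_grad a v q) = 1"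
      using assms(2) by (simp add: field_simps)
    also have "\<dots> \<longleftrightarrow> quad a v d q = 0"
      using 4 assms(2) by (auto simp: norm_eq_1)
    finally show ?thesis by simp
  qed
  then show ?thesis by blast
qed

lemma path_connected_quadric:
  assumes "unit_quad a v d"
  shows "path_connected (quadric a v d)"
proof (cases "a = 0")
  case True
  then have "quadric a v d = {q. v \<bullet> q = - d} \<inter> half_space"
    by (auto simp: quadric_def quad_def)
  then show ?thesis
    using convex_imp_path_connected convex_Int convex_hyperplane convex_half_space by metis
next
  case False
  then have "quadric a v d = sphere (- v /\<^sub>R (2 * a)) (1 / (2 * \<bar>a\<bar>)) \<inter> half_space"
    using quad_zero_sphere[OF assms False] by (auto simp: quadric_def)
  then show ?thesis using path_connected_sphere_half_space[of "1 / (2 * \<bar>a\<bar>)"] False by simp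
qed

lemma generalized_hypersphere_imp_quadric:
  assumes "generalized_hypersphere L"
  obtains a v d where "unit_quad a v d" "L = quadric a v d"
proof -
  consider c R where "R > 0" "L = sphere c R \<inter> half_space"
    | u d where "u \<noteq> 0" "L = {p. u \<bullet> p = d} \<inter> half_space"
    using assms unfolding generalized_hypersphere_def by blast
  then show ?thesis
  proof cases
    case 1
    define a where "a = 1 / (2 * R)"
    define v where "v = - c /\<^sub>R R"
    define d where "d = (c \<bullet> c - R\<^sup>2) / (2 * R)"
    have a: "a \<noteq> 0" using 1 by (simp add: a_def)
    have uq: "unit_quad a v d"
      using 1 by (simp add: unit_quad_def a_def v_def d_def field_simps power2_eq_square)
    have "- v /\<^sub>R (2 * a) = c" "1 / (2 * \<bar>a\<bar>) = R" using 1 by (auto simp: a_def v_def)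
    then show ?thesis
      using that[OF uq] quad_zero_sphere[OF uq a] 1 by (auto simp: quadric_def)
  next
    case 2
    have "L = quadric 0 (u /\<^sub>R norm u) (- d / norm u)"
      using 2 by (auto simp: quadric_def quad_def field_simps)
    moreover have "unit_quad 0 (u /\<^sub>R norm u) (- d / norm u)"
      using 2 by (simp add: unit_quad_def dot_square_norm power2_eq_square field_simps)
    ultimately show ?thesis using that by blast
  qed
qed

text \<open>
  The condition \<open>\<bar>snd v\<bar> \<le> 1\<close> says exactly that the Euclidean sphere meets or touches the ideal boundary: its
  centre has height \<open>- snd v / (2 * a)\<close> and its radius is \<open>1 / (2 * \<bar>a\<bar>)\<close>.
\<close>

lemma quadric_generalized_hypersphere:
  fixes v :: "'a::euclidean_space \<times> real"
  assumes u: "unit_quad a v d" and ne: "quadric a v d \<noteq> {}" and e: "\<bar>snd v\<bar> \<le> 1"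
  shows "generalized_hypersphere (quadric a v d)"
proof (cases "a = 0")
  case True
  then have "quadric a v d = {q. v \<bullet> q = - d} \<inter> half_space"
    by (auto simp: quadric_def quad_def)
  moreover have "v \<noteq> 0" using u True by (auto simp: unit_quad_def)
  ultimately show ?thesis using ne unfolding generalized_hypersphere_def by blast
next
  case False
  define c where "c = - v /\<^sub>R (2 * a)"
  define R where "R = 1 / (2 * \<bar>a\<bar>)"
  have eq: "quadric a v d = sphere c R \<inter> half_space"
    using quad_zero_sphere[OF u False] by (auto simp: quadric_def c_def R_def)
  have R: "R > 0" using False by (simp add: R_def)
  have cR: "\<bar>snd c\<bar> \<le> R"
    using e False by (simp add: c_def R_def abs_mult divide_simps)
  then have cR2: "(snd c)\<^sup>2 \<le> R\<^sup>2" using R by (simp add: abs_le_square_iff[symmetric])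
  obtain b :: 'a where "b \<in> Basis" using nonempty_Basis by blast
  then have b: "norm b = 1" by simp
  let ?q = "c + (sqrt (R\<^sup>2 - (snd c)\<^sup>2) *\<^sub>R b, - snd c)"
  have "norm (sqrt (R\<^sup>2 - (snd c)\<^sup>2) *\<^sub>R b, - snd c) = R"
    using b cR2 R by (simp add: norm_Pair)
  then have "dist ?q c = R" by (simp add: dist_norm)
  then have "?q \<in> sphere c R \<inter> {p. snd p = 0}"
    by (simp add: dist_commute)
  then show ?thesis using ne R eq unfolding generalized_hypersphere_def by blast
qed


section \<open>Curvature of quadrics in the half-space model\<close>

lemma DIM_prod_real_ge_2: "DIM('a::euclidean_space \<times> real) \<ge> 2"
  using DIM_positive[where 'a = 'a] by simp

lemma sgn_has_derivative:
  fixes x :: "'e::real_inner"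
  assumes "x \<noteq> 0"
  shows "(sgn has_derivative (\<lambda>h. h /\<^sub>R norm x - ((x \<bullet> h) / norm x ^ 3) *\<^sub>R x)) (at x)"
proof -
  have nx: "norm x \<noteq> 0" using assms by simp
  have "((\<lambda>x. inverse (norm x)) has_derivative
      (\<lambda>h. - (inverse (norm x) * (h \<bullet> sgn x) * inverse (norm x)))) (at x)"
    by (rule Deriv.has_derivative_inverse[OF nx has_derivative_norm[OF assms]])
  from has_derivative_scaleR[OF this has_derivative_ident]
  have "((\<lambda>x. x /\<^sub>R norm x) has_derivative
      (\<lambda>h. inverse (norm x) *\<^sub>R h + (- (inverse (norm x) * (h \<bullet> sgn x) * inverse (norm x))) *\<^sub>R x)) (at x)" .
  moreover have "inverse (norm x) *\<^sub>R h + (- (inverse (norm x) * (h \<bullet> sgn x) * inverse (norm x))) *\<^sub>R x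
      = h /\<^sub>R norm x - ((x \<bullet> h) / norm x ^ 3) *\<^sub>R x" for h
    by (simp add: sgn_div_norm power3_eq_cube divide_inverse inner_commute[of h] mult_ac)
  ultimately have "((\<lambda>x. x /\<^sub>R norm x) has_derivative
      (\<lambda>h. h /\<^sub>R norm x - ((x \<bullet> h) / norm x ^ 3) *\<^sub>R x)) (at x)"
    by (simp only:)
  then show ?thesis by (simp only: sgn_div_norm[abs_def])
qed

lemma smooth_on_frechet:
  "smooth_on f U \<Longrightarrow> smooth_on (\<lambda>x. frechet_derivative f (at x) v) U"
  unfolding smooth_on_def by (metis Ck_on.simps(2))

lemma smooth_on_differentiable: "smooth_on f U \<Longrightarrow> x \<in> U \<Longrightarrow> f differentiable (at x)"
  using Ck_on_1D(1) smooth_on_Ck1 by blast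

lemma smooth_on_grad_differentiable:
  assumes "smooth_on f U" "x \<in> U"
  shows "grad f differentiable (at x)"
proof -
  have "(\<lambda>x. frechet_derivative f (at x) b *\<^sub>R b) differentiable (at x)" for b
    using smooth_on_differentiable[OF smooth_on_frechet[OF assms(1)] assms(2), of b]
    unfolding differentiable_def by (elim exE) (rule exI, erule has_derivative_scaleR_left)
  then show ?thesis
    unfolding grad_def[abs_def] by (intro differentiable_sum) auto
qed

lemma sgn_grad_differentiable:
  assumes "smooth_on f U" "x \<in> U" "grad f x \<noteq> 0"
  shows "(\<lambda>q. sgn (grad f q)) differentiable (at x)"
  using has_derivative_compose[where f = "grad f", OF _ sgn_has_derivative[OF assms(3)]]
    smooth_on_grad_differentiable[OF assms(1,2)]
  unfolding differentiable_def by blast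

lemma unit_normal_eq: "unit_normal f q = snd q *\<^sub>R sgn (grad f q)"
  by (simp add: unit_normal_def sgn_div_norm divide_inverse)

text \<open>
  The Christoffel terms cancel the derivative of the conformal factor, up to a multiple of \<open>X\<close>.
  So the hyperbolic shape operator is an affine function of the Euclidean one, and umbilicity means
  the same in both geometries.
\<close>

lemma cov_deriv_unit_normal:
  fixes f :: "'a::euclidean_space \<times> real \<Rightarrow> real"
  assumes D: "((\<lambda>q. sgn (grad f q)) has_derivative D) (at p)"
    and p: "p \<in> half_space" and X: "grad f p \<bullet> X = 0"
  shows "cov_deriv (unit_normal f) p X = snd p *\<^sub>R D X - snd (sgn (grad f p)) *\<^sub>R X"
proof -
  have y: "snd p > 0" using p by (simp add: half_space_def)
  let ?n = "sgn (grad f p)"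
  have nX: "X \<bullet> ?n = 0" using X by (simp add: sgn_div_norm inner_commute)
  have uD: "(unit_normal f has_derivative (\<lambda>X. snd p *\<^sub>R D X + snd X *\<^sub>R ?n)) (at p)"
    unfolding unit_normal_eq[abs_def] by (auto intro!: derivative_eq_intros D)
  then have 1: "frechet_derivative (unit_normal f) (at p) X = snd p *\<^sub>R D X + snd X *\<^sub>R ?n"
    by (simp add: frechet_derivative_at[OF uD, symmetric])
  have 2: "christoffel p X (unit_normal f p) = - (snd X *\<^sub>R ?n) - snd ?n *\<^sub>R X"
    using y nX by (simp add: christoffel_def unit_normal_eq scaleR_diff_right zero_prod_def[symmetric])
  show ?thesis unfolding cov_deriv_def 1 2 by simp
qed

lemma local_equation_quadric:
  assumes "unit_quad a v d" "p \<in> quadric a v d"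
  shows "local_equation (quadric a v d) p {q \<in> half_space. quad_grad a v q \<noteq> 0} (quad a v d)"
proof -
  let ?U = "{q \<in> half_space. quad_grad a v q \<noteq> 0}"
  have LU: "quadric a v d \<subseteq> ?U"
    using norm_grad_quad[OF assms(1)] by (force simp: quadric_def)
  then have "quadric a v d \<inter> ?U = quadric a v d" by blast
  moreover have "path_component_set (quadric a v d) p = quadric a v d"
    using path_connected_quadric[OF assms(1)] assms(2) path_connected_component_set by blast
  moreover have "quadric a v d = {q \<in> ?U. quad a v d q = 0}"
    using LU by (auto simp: quadric_def)
  moreover have "open ?U"
  proof -
    have "?U = half_space \<inter> {q. quad_grad a v q \<noteq> 0}" by blast
    moreover have "open {q. quad_grad a v q \<noteq> 0}"
      by (intro open_Collect_neq continuous_intros)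
    ultimately show ?thesis using open_half_space by auto
  qed
  moreover have "p \<in> ?U" using LU assms by blast
  ultimately show ?thesis
    using assms(2) unfolding local_equation_def
    by (auto simp: smooth_on_quad grad_quad simp del: mem_Collect_eq)
qed

lemma local_equation_subset:
  assumes "local_equation L p U f" "q \<in> U" "f q = 0"
  shows "q \<in> L"
proof -
  have "path_component_set (L \<inter> U) p = {q \<in> U. f q = 0}"
    using assms unfolding local_equation_def by blast
  then have "q \<in> path_component_set (L \<inter> U) p" using assms by simp
  then show ?thesis using path_component_subset[of "L \<inter> U" p] by blast
qed

lemma local_equation_zero:
  assumes "local_equation L p U f"
  shows "f p = 0"
proof -
  have p: "p \<in> L \<inter> U" and eq: "path_component_set (L \<inter> U) p = {q \<in> U. f q = 0}"
    using assms unfolding local_equation_def by blast+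
  from p have "p \<in> path_component_set (L \<inter> U) p"
    unfolding mem_Collect_eq by (rule path_component_refl)
  then show ?thesis unfolding eq by blast
qed

lemma local_equation_move:
  assumes f: "local_equation L p U f" and q: "q \<in> U" "f q = 0"
  shows "local_equation L q U f"
proof -
  have eq: "path_component_set (L \<inter> U) p = {q \<in> U. f q = 0}"
    using f unfolding local_equation_def by blast
  then have "path_component (L \<inter> U) p q" using q by blast
  then have "path_component_set (L \<inter> U) q = path_component_set (L \<inter> U) p"
    using path_component_eq by blast
  then show ?thesis
    using f q local_equation_subset[OF f q] unfolding local_equation_def by simp
qed

text \<open>
  The mean curvature is defined through arbitrary local equations.  This compares such an equation
  \<open>f\<close> with the quadratic one: their gradients are parallel along the hypersurface.
\<close>

lemma local_equation_grad_quadric: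
  assumes u: "unit_quad a v d" and f: "local_equation (quadric a v d) p U f"
    and q: "q \<in> U" "f q = 0"
  shows "grad f q \<bullet> X = 0 \<Longrightarrow> quad_grad a v q \<bullet> X = 0"
    and "(quad_grad a v q) = (sgn (grad f q) \<bullet> (quad_grad a v q)) *\<^sub>R sgn (grad f q)"
    and "sgn (grad f q) \<bullet> (quad_grad a v q) = 1 \<or> sgn (grad f q) \<bullet> (quad_grad a v q) = - 1"
proof -
  let ?m = "quad_grad a v q" and ?n = "sgn (grad f q)"
  have U: "open U" "smooth_on f U" and nz: "grad f q \<noteq> 0"
    using f q by (auto simp: local_equation_def)
  show *: "?m \<bullet> X = 0" if X: "grad f q \<bullet> X = 0" for X
    by (rule level_set_derivative_zero[OF U(1) smooth_on_Ck1[OF U(2)] q nz X quad_has_derivative, where ?k0.0 = 0])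
       (use local_equation_subset[OF f] in \<open>auto simp: quadric_def\<close>)
  have n1: "norm ?n = 1" using nz by (simp add: norm_sgn)
  show m: "?m = (?n \<bullet> ?m) *\<^sub>R ?n"
    by (rule parallel_if_orthogonal_imp_orthogonal[OF n1])
       (use * nz in \<open>simp add: sgn_div_norm\<close>)
  have "norm ?m = 1"
    using norm_grad_quad[OF u] local_equation_subset[OF f q] by (simp add: quadric_def)
  moreover have "norm ?m = \<bar>?n \<bullet> ?m\<bar>"
    using arg_cong[OF m, of norm] by (simp only: norm_scaleR n1 mult_1_right)
  ultimately have "\<bar>?n \<bullet> ?m\<bar> = 1" by (simp only:)
  then show "?n \<bullet> ?m = 1 \<or> ?n \<bullet> ?m = - 1" by (simp only: abs_eq_iff')
qed

lemma tangent_space_quadric: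
  assumes u: "unit_quad a v d" and p: "p \<in> quadric a v d"
  shows "tangent_space (quadric a v d) p = {X. quad_grad a v p \<bullet> X = 0}"
proof (intro set_eqI iffI)
  fix X assume "X \<in> tangent_space (quadric a v d) p"
  then obtain U f where f: "local_equation (quadric a v d) p U f" "frechet_derivative f (at p) X = 0"
    by (auto simp: tangent_space_def)
  have pU: "p \<in> U" "smooth_on f U" using f by (auto simp: local_equation_def)
  then have "grad f p \<bullet> X = 0"
    using f(2) frechet_derivative_eq_grad[OF smooth_on_differentiable[OF pU(2,1)]] by metis
  then show "X \<in> {X. quad_grad a v p \<bullet> X = 0}"
    using local_equation_grad_quadric(1)[OF u f(1) pU(1) local_equation_zero[OF f(1)]] by blast
next
  fix X assume "X \<in> {X. quad_grad a v p \<bullet> X = 0}"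
  then have "frechet_derivative (quad a v d) (at p) X = 0" by (simp add: frechet_quad)
  then show "X \<in> tangent_space (quadric a v d) p"
    using local_equation_quadric[OF u p] unfolding tangent_space_def by blast
qed

lemma sgn_grad_quad_has_derivative:
  assumes u: "unit_quad a v d" and p: "quad a v d p = 0" and X: "quad_grad a v p \<bullet> X = 0"
  shows "\<exists>D. ((\<lambda>q. sgn (grad (quad a v d) q)) has_derivative D) (at p) \<and> D X = (2 * a) *\<^sub>R X"
proof -
  have n1: "norm (quad_grad a v p) = 1" by (rule norm_grad_quad[OF u p])
  then have nz: "quad_grad a v p \<noteq> 0" by auto
  have "((\<lambda>q. quad_grad a v q) has_derivative (\<lambda>X. (2 * a) *\<^sub>R X)) (at p)"
    by (auto intro!: derivative_eq_intros)
  note D = has_derivative_compose[OF this sgn_has_derivative[OF nz]]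
  show ?thesis
    unfolding grad_quad by (rule exI, rule conjI, rule D) (use n1 X in simp)
qed

lemma principal_curvature_quadric_sign:
  assumes u: "unit_quad a v d"
    and k: "principal_curvature (quadric a v d) p \<nu> k"
  shows "\<nu> = snd p *\<^sub>R (quad_grad a v p) \<or> \<nu> = snd p *\<^sub>R ((2 * (- a)) *\<^sub>R p + (- v))"
proof -
  obtain U f where f: "local_equation (quadric a v d) p U f" "unit_normal f p = \<nu>"
    using k unfolding principal_curvature_def by blast
  have pU: "p \<in> U" using f by (auto simp: local_equation_def)
  note g = local_equation_grad_quadric[OF u f(1) pU local_equation_zero[OF f(1)]]
  from g(3) show ?thesis
  proof
    assume "sgn (grad f p) \<bullet> (quad_grad a v p) = 1"
    with g(2) have "sgn (grad f p) = quad_grad a v p" by simp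
    then show ?thesis using f(2) by (simp add: unit_normal_eq)
  next
    assume "sgn (grad f p) \<bullet> (quad_grad a v p) = - 1"
    with g(2) have "sgn (grad f p) = - (quad_grad a v p)" by (metis minus_equation_iff scaleR_minus1_left)
    then show ?thesis using f(2) by (simp add: unit_normal_eq)
  qed
qed

text \<open>
  With the quadratic equation every tangent vector is an eigenvector, for \<open>- snd v\<close>.  For any other
  local equation \<open>f\<close> with the same normal at \<open>p\<close>, the unit normal fields agree along the hypersurface near
  \<open>p\<close>, so their derivatives in tangent directions agree.
\<close>

lemma principal_curvature_quadric:
  fixes v :: "'a::euclidean_space \<times> real"
  assumes u: "unit_quad a v d" and p: "p \<in> quadric a v d"
  shows "principal_curvature (quadric a v d) p (snd p *\<^sub>R (quad_grad a v p)) k \<longleftrightarrow> k = - snd v"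
proof
  let ?m = "quad_grad a v p"
  have pH: "p \<in> half_space" "quad a v d p = 0" using p by (auto simp: quadric_def)
  have y: "snd p > 0" using pH by (simp add: half_space_def)
  have n1: "norm ?m = 1" using norm_grad_quad[OF u pH(2)] .
  have sm: "sgn ?m = ?m" using n1 by (simp add: sgn_div_norm)
  {
    assume k: "k = - snd v"
    obtain X where X: "X \<noteq> 0" "?m \<bullet> X = 0"
      using orthogonal_to_vector_exists[OF DIM_prod_real_ge_2, of ?m] by (auto simp: orthogonal_def)
    have X': "X \<in> tangent_space (quadric a v d) p"
      using X by (simp add: tangent_space_quadric[OF u p])
    obtain D where D: "((\<lambda>q. sgn (grad (quad a v d) q)) has_derivative D) (at p)" "D X = (2 * a) *\<^sub>R X"
      using sgn_grad_quad_has_derivative[OF u pH(2) X(2)] by blast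
    have "cov_deriv (unit_normal (quad a v d)) p X = snd p *\<^sub>R D X - snd ?m *\<^sub>R X"
      using cov_deriv_unit_normal[OF D(1) pH(1)] X by (simp add: grad_quad sm)
    also have "\<dots> = k *\<^sub>R X" by (simp add: D(2) k algebra_simps)
    finally have "cov_deriv (unit_normal (quad a v d)) p X = k *\<^sub>R X" .
    moreover have "unit_normal (quad a v d) p = snd p *\<^sub>R ?m"
      by (simp add: unit_normal_eq grad_quad sm)
    ultimately show "principal_curvature (quadric a v d) p (snd p *\<^sub>R ?m) k"
      using local_equation_quadric[OF u p] X X' unfolding principal_curvature_def by blast
  }
  assume "principal_curvature (quadric a v d) p (snd p *\<^sub>R ?m) k"
  then obtain U f X where f: "local_equation (quadric a v d) p U f" "unit_normal f p = snd p *\<^sub>R ?m"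
    and X: "X \<in> tangent_space (quadric a v d) p" "X \<noteq> 0"
    and c: "cov_deriv (unit_normal f) p X = k *\<^sub>R X"
    unfolding principal_curvature_def by blast
  have U: "open U" "p \<in> U" "smooth_on f U" and nz: "\<And>q. q \<in> U \<Longrightarrow> grad f q \<noteq> 0"
    using f by (auto simp: local_equation_def)
  have sf: "sgn (grad f p) = ?m"
    using f(2) y by (simp add: unit_normal_eq)
  have mX: "?m \<bullet> X = 0" using X by (simp add: tangent_space_quadric[OF u p])
  then have "sgn (grad f p) \<bullet> X = 0" by (simp add: sf)
  then have fX: "grad f p \<bullet> X = 0" using nz[OF U(2)] by (simp add: sgn_div_norm)
  define g where "g q = sgn (grad f q) \<bullet> (quad_grad a v q)" for q
  \<comment> \<open>On \<open>U'\<close> the sign of the unit normal of \<open>f\<close> is the one prescribed at \<open>p\<close>.\<close>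
  define U' where "U' = U \<inter> g -` {0<..}"
  have contg: "continuous_on U g"
    unfolding g_def[abs_def]
    by (intro continuous_intros Ck_on_1D(3)[OF smooth_on_Ck1[OF U(3)]]) (use nz in auto)
  have U': "open U'" "p \<in> U'" "U' \<subseteq> U"
    using continuous_open_preimage[OF contg U(1)] U(2) n1
    by (auto simp: U'_def g_def sf norm_eq_1)
  have f1: "Ck_on 1 f U'" using Ck_on_mono[OF smooth_on_Ck1[OF U(3)] U'(3)] .
  obtain D where D: "((\<lambda>q. sgn (grad f q)) has_derivative D) (at p)"
    using sgn_grad_differentiable[OF U(3,2) nz[OF U(2)]] unfolding differentiable_def by blast
  have "((\<lambda>q. sgn (grad f q) - (quad_grad a v q)) has_derivative (\<lambda>X. D X - (2 * a) *\<^sub>R X)) (at p)"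
    by (auto intro!: derivative_eq_intros D)
  then have "D X - (2 * a) *\<^sub>R X = 0"
  proof (rule level_set_derivative_zero[OF U'(1) f1 U'(2) local_equation_zero[OF f(1)] nz[OF U(2)] fX, where ?k0.0 = 0])
    fix q assume q: "q \<in> U'" "f q = 0"
    have qU: "q \<in> U" "g q > 0" using q U' by (auto simp: U'_def)
    note gq = local_equation_grad_quadric(2,3)[OF u f(1) qU(1) q(2)]
    have "g q = 1" using gq(2) qU(2) by (auto simp: g_def)
    then show "sgn (grad f q) - (quad_grad a v q) = 0"
      using gq(1) by (simp add: g_def)
  qed
  then have "k *\<^sub>R X = snd p *\<^sub>R ((2 * a) *\<^sub>R X) - snd ?m *\<^sub>R X"
    using cov_deriv_unit_normal[OF D pH(1) fX] c by (simp add: sf)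
  then have "(k + snd v) *\<^sub>R X = 0" by (simp add: algebra_simps)
  then show "k = - snd v" using X(2) by simp
qed

lemma has_mean_curvature_quadric:
  assumes "unit_quad a v d" and "p \<in> quadric a v d"
  shows "has_mean_curvature (quadric a v d) p (snd p *\<^sub>R (quad_grad a v p)) k \<longleftrightarrow> k = - snd v"
  unfolding has_mean_curvature_def principal_curvature_quadric[OF assms] singleton_conv
proof
  assume "{- snd v} = {k}"
  then have "- snd v = k" by (rule singleton_inject)
  then show "k = - snd v" by (rule sym)
next
  assume "k = - snd v"
  then show "{- snd v} = {k}" by (simp only:)
qed

lemma totally_umbilical_quadric:
  assumes u: "unit_quad a v d"
  shows "totally_umbilical (quadric a v d)"
  unfolding totally_umbilical_def
proof (intro conjI ballI allI impI)
  show "hypersurface (quadric a v d)"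
    unfolding hypersurface_def
  proof (intro conjI ballI)
    show "quadric a v d \<subseteq> half_space" by (auto simp: quadric_def)
    show "\<exists>U f. local_equation (quadric a v d) p U f" if "p \<in> quadric a v d" for p
      using local_equation_quadric[OF u that] by blast
  qed
next
  fix p \<nu> k k'
  assume p: "p \<in> quadric a v d"
    and k: "principal_curvature (quadric a v d) p \<nu> k" "principal_curvature (quadric a v d) p \<nu> k'"
  have u': "unit_quad (- a) (- v) (- d)" using u by (simp add: unit_quad_uminus)
  have p': "p \<in> quadric (- a) (- v) (- d)" using p by (simp only: quadric_uminus)
  from principal_curvature_quadric_sign[OF u k(1)] show "k = k'"
  proof
    assume \<nu>: "\<nu> = snd p *\<^sub>R (quad_grad a v p)"
    show ?thesis using k unfolding \<nu> principal_curvature_quadric[OF u p] by (simp only:)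
  next
    assume \<nu>: "\<nu> = snd p *\<^sub>R ((2 * (- a)) *\<^sub>R p + (- v))"
    show ?thesis
      using k unfolding \<nu> principal_curvature_quadric[OF u' p', unfolded quadric_uminus] by (simp only:)
  qed
qed


section \<open>Umbilical hypersurfaces are locally spherical\<close>

text \<open>
  The form \<open>Y \<mapsto> l (Y \<bullet> Y) - A Y \<bullet> Y\<close> is nonnegative and vanishes at \<open>X\<close>; moving from \<open>X\<close> in the direction
  \<open>A X - l X\<close> would make it negative unless that vector is zero.
\<close>

lemma nonneg_form_eigenvector:
  fixes A :: "'e::real_inner \<Rightarrow> 'e"
  assumes T: "subspace T" and A: "linear A" "\<And>X. X \<in> T \<Longrightarrow> A X \<in> T"
    and sym: "\<And>X Y. X \<in> T \<Longrightarrow> Y \<in> T \<Longrightarrow> A X \<bullet> Y = X \<bullet> A Y"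
    and le: "\<And>Y. Y \<in> T \<Longrightarrow> A Y \<bullet> Y \<le> l * (Y \<bullet> Y)"
    and X: "X \<in> T" "A X \<bullet> X = l * (X \<bullet> X)"
  shows "A X = l *\<^sub>R X"
proof -
  define Z where "Z = l *\<^sub>R X - A X"
  have Z: "Z \<in> T" unfolding Z_def using T A(2) X(1) by (intro subspace_diff subspace_scale)
  define B where "B Y = l * (Y \<bullet> Y) - A Y \<bullet> Y" for Y
  have B: "B Y \<ge> 0" if "Y \<in> T" for Y using le[OF that] by (simp add: B_def)
  have exp: "B (X - s *\<^sub>R Z) = s\<^sup>2 * B Z - 2 * s * (Z \<bullet> Z)" for s
  proof -
    have AZ: "A X \<bullet> Z = X \<bullet> A Z" using sym X Z by blast
    have "B (X - s *\<^sub>R Z) = B X - 2 * s * (l * (X \<bullet> Z) - A X \<bullet> Z) + s\<^sup>2 * B Z"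
      using AZ by (simp add: B_def linear_diff[OF A(1)] linear_cmul[OF A(1)] inner_diff_left inner_diff_right
          inner_commute[of Z X] inner_commute[of "A Z" X] power2_eq_square algebra_simps)
    also have "B X = 0" using X by (simp add: B_def)
    also have "l * (X \<bullet> Z) - A X \<bullet> Z = Z \<bullet> Z" by (simp add: Z_def inner_diff_left)
    finally show ?thesis by simp
  qed
  have "Z \<bullet> Z = 0"
  proof (rule ccontr)
    assume "Z \<bullet> Z \<noteq> 0"
    then have zz: "Z \<bullet> Z > 0" by (metis inner_ge_zero order_le_less)
    define s where "s = (Z \<bullet> Z) / (B Z + 1)"
    have s: "s > 0" using zz B[OF Z] by (simp add: s_def)
    have "X - s *\<^sub>R Z \<in> T" using T X Z by (intro subspace_diff subspace_scale)
    then have "0 \<le> s * (s * B Z - 2 * (Z \<bullet> Z))"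
      using B exp[of s] by (metis (no_types, lifting) mult.assoc mult.commute power2_eq_square right_diff_distrib)
    then have "2 * (Z \<bullet> Z) \<le> s * B Z" using s by (simp add: zero_le_mult_iff)
    also have "s * B Z \<le> Z \<bullet> Z"
      using B[OF Z] zz by (simp add: s_def divide_simps mult_left_mono)
    finally show False using zz by simp
  qed
  then show ?thesis by (simp add: Z_def)
qed

lemma self_adjoint_max_eigenvector:
  fixes A :: "'e::euclidean_space \<Rightarrow> 'e"
  assumes T: "subspace T" and A: "linear A" "\<And>X. X \<in> T \<Longrightarrow> A X \<in> T"
    and sym: "\<And>X Y. X \<in> T \<Longrightarrow> Y \<in> T \<Longrightarrow> A X \<bullet> Y = X \<bullet> A Y"
    and nz: "\<not> T \<subseteq> {0}"
  obtains X l where "X \<in> T" "X \<noteq> 0" "A X = l *\<^sub>R X" "\<And>Y. Y \<in> T \<Longrightarrow> A Y \<bullet> Y \<le> l * (Y \<bullet> Y)"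
proof -
  obtain X0 where X0: "X0 \<in> T" "X0 \<noteq> 0" using nz by blast
  let ?K = "sphere 0 1 \<inter> T"
  have "compact ?K" by (intro compact_Int_closed closed_subspace T) simp
  moreover have "X0 /\<^sub>R norm X0 \<in> ?K" using X0 T by (simp add: subspace_scale)
  moreover have "continuous_on ?K (\<lambda>X. A X \<bullet> X)"
    by (intro continuous_intros linear_continuous_on A(1)[unfolded linear_conv_bounded_linear])
  ultimately obtain X where X: "X \<in> ?K" and max: "\<And>Y. Y \<in> ?K \<Longrightarrow> A Y \<bullet> Y \<le> A X \<bullet> X"
    using continuous_attains_sup[of ?K "\<lambda>X. A X \<bullet> X"] by blast
  define l where "l = A X \<bullet> X"
  have le: "A Y \<bullet> Y \<le> l * (Y \<bullet> Y)" if Y: "Y \<in> T" for Y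
  proof (cases "Y = 0")
    case False
    have "Y /\<^sub>R norm Y \<in> ?K" using Y T False by (simp add: subspace_scale)
    from max[OF this] have "(A Y \<bullet> Y) / (norm Y)\<^sup>2 \<le> l"
      by (simp add: l_def linear_cmul[OF A(1)] power2_eq_square divide_inverse mult_ac)
    then show ?thesis using False by (simp add: field_simps dot_square_norm)
  qed (simp add: linear_0[OF A(1)])
  have "A X \<bullet> X = l * (X \<bullet> X)" using X by (simp add: l_def dot_square_norm)
  then have "A X = l *\<^sub>R X"
    using nonneg_form_eigenvector[OF T A sym le] X by blast
  moreover have "X \<noteq> 0" using X by auto
  ultimately show ?thesis using that[of X l] X le by blast
qed

text \<open>
  The largest and the smallest value of the quadratic form on the unit sphere are eigenvalues.  Since
  they coincide, the operator is scalar.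
\<close>

lemma self_adjoint_single_eigenvalue:
  fixes A :: "'e::euclidean_space \<Rightarrow> 'e"
  assumes T: "subspace T" and A: "linear A" "\<And>X. X \<in> T \<Longrightarrow> A X \<in> T"
    and sym: "\<And>X Y. X \<in> T \<Longrightarrow> Y \<in> T \<Longrightarrow> A X \<bullet> Y = X \<bullet> A Y"
    and single: "\<And>X Y k l. X \<in> T \<Longrightarrow> X \<noteq> 0 \<Longrightarrow> A X = k *\<^sub>R X \<Longrightarrow> Y \<in> T \<Longrightarrow> Y \<noteq> 0 \<Longrightarrow> A Y = l *\<^sub>R Y \<Longrightarrow> k = l"
  shows "\<exists>l. \<forall>X\<in>T. A X = l *\<^sub>R X"
proof (cases "T \<subseteq> {0}")
  case True
  then have "A X = 0 *\<^sub>R X" if "X \<in> T" for X using linear_0[OF A(1)] that by auto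
  then show ?thesis by blast
next
  case False
  obtain X l where X: "X \<in> T" "X \<noteq> 0" "A X = l *\<^sub>R X" and le: "\<And>Y. Y \<in> T \<Longrightarrow> A Y \<bullet> Y \<le> l * (Y \<bullet> Y)"
    using self_adjoint_max_eigenvector[OF T A sym False] by blast
  have mA: "linear (\<lambda>X. - A X)" "\<And>X. X \<in> T \<Longrightarrow> - A X \<in> T"
    using A T by (auto intro: linear_compose_neg subspace_neg)
  have "- A X \<bullet> Y = X \<bullet> - A Y" if "X \<in> T" "Y \<in> T" for X Y using sym[OF that] by simp
  from self_adjoint_max_eigenvector[OF T mA this False]
  obtain X' l' where X': "X' \<in> T" "X' \<noteq> 0" "- A X' = l' *\<^sub>R X'" and ge: "\<And>Y. Y \<in> T \<Longrightarrow> - A Y \<bullet> Y \<le> l' * (Y \<bullet> Y)"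
    by blast
  have "A X' = (- l') *\<^sub>R X'" using X'(3) by (metis minus_equation_iff scaleR_minus_left)
  then have l: "l = - l'" using single[OF X X'(1,2)] by blast
  have "A Y = l *\<^sub>R Y" if Y: "Y \<in> T" for Y
  proof -
    have "A Y \<bullet> Y = l * (Y \<bullet> Y)" using le[OF Y] ge[OF Y] by (simp add: l)
    then show ?thesis using nonneg_form_eigenvector[OF T A sym le Y] by blast
  qed
  then show ?thesis by blast
qed

lemma orthogonal_to_two_vectors_exists:
  fixes x y :: "'e::euclidean_space"
  assumes "DIM('e) \<ge> 3"
  obtains z where "z \<noteq> 0" "x \<bullet> z = 0" "y \<bullet> z = 0"
proof -
  have "dim {x, y} \<le> card {x, y}" by (rule dim_le_card') simp
  also have "\<dots> \<le> 2" by (simp add: card_insert_if)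
  finally have "dim {x, y} < DIM('e)" using assms by simp
  then obtain z where "z \<noteq> 0" "\<And>w. w \<in> span {x, y} \<Longrightarrow> orthogonal z w"
    using orthogonal_to_subspace_exists by blast
  then show ?thesis using that[of z] by (simp add: orthogonal_def span_base inner_commute)
qed

text \<open>
  Near \<open>p\<close>, both functions are strictly monotone along the direction \<open>grad f p\<close>.  On each such line \<open>f\<close> has a
  zero, which is a zero of \<open>F\<close>, and \<open>F\<close> has no other.
\<close>

lemma level_set_subset_imp_eq:
  fixes f F :: "'e::euclidean_space \<Rightarrow> real"
  assumes U: "open U" "p \<in> U" and f: "Ck_on 1 f U" "f p = 0" "grad f p \<noteq> 0"
    and F: "Ck_on 1 F U" "F p = 0" "grad F p \<noteq> 0"
    and sub: "\<And>q. q \<in> U \<Longrightarrow> f q = 0 \<Longrightarrow> F q = 0"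
  obtains V where "open V" "p \<in> V" "V \<subseteq> U" "\<And>q. q \<in> V \<Longrightarrow> F q = 0 \<Longrightarrow> f q = 0"
proof -
  define e where "e = grad f p"
  define E where "E = grad F p"
  have Ee: "E \<bullet> e \<noteq> 0"
  proof
    assume 0: "E \<bullet> e = 0"
    have "grad F p \<bullet> E = 0"
      by (rule level_set_derivative_zero[OF U(1) f(1) U(2) f(2,3) _ has_derivative_grad[OF Ck_on_1D(1)[OF F(1) U(2)]],
            where ?k0.0 = 0])
         (use 0 sub in \<open>auto simp: e_def inner_commute\<close>)
    then show False using F(3) by (simp add: E_def)
  qed
  define W where "W = {q \<in> U. grad f q \<bullet> e > 0} \<inter> {q \<in> U. (grad F q \<bullet> e) * (E \<bullet> e) > 0}"
  have "open W"
  proof -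
    have 1: "continuous_on U (\<lambda>q. grad f q \<bullet> e)" "continuous_on U (\<lambda>q. (grad F q \<bullet> e) * (E \<bullet> e))"
      by (intro continuous_intros Ck_on_1D(3) f F)+
    have "W = (U \<inter> (\<lambda>q. grad f q \<bullet> e) -` {0<..}) \<inter> (U \<inter> (\<lambda>q. (grad F q \<bullet> e) * (E \<bullet> e)) -` {0<..})"
      by (auto simp: W_def)
    then show ?thesis
      using continuous_open_preimage[OF 1(1) U(1), of "{0<..}"] continuous_open_preimage[OF 1(2) U(1), of "{0<..}"]
      by (simp only: open_Int open_greaterThan)
  qed
  moreover have "p \<in> W"
    using U(2) f(3) Ee by (simp add: W_def e_def E_def) (metis not_real_square_gt_zero)
  ultimately obtain r where r: "r > 0" "ball p r \<subseteq> W" using open_contains_ball by blast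
  have rU: "ball p r \<subseteq> U" using r by (auto simp: W_def)
  have ne: "norm e > 0" using f(3) by (simp add: e_def)
  define s where "s = r / (2 * norm e)"
  have s: "s > 0" using r ne by (simp add: s_def)
  have near: "q + t *\<^sub>R e \<in> ball p r" if "q \<in> ball p (r / 2)" "\<bar>t\<bar> < s" for q t
  proof -
    have "dist p (q + t *\<^sub>R e) \<le> dist p q + norm (t *\<^sub>R e)"
      by (metis add_diff_cancel_left' dist_norm dist_triangle norm_minus_commute dist_commute)
    also have "norm (t *\<^sub>R e) < r / 2" using that(2) ne by (simp add: s_def field_simps)
    finally show ?thesis using that(1) by simp
  qed
  have der: "((\<lambda>t. g (q + t *\<^sub>R e)) has_real_derivative grad g (q + t *\<^sub>R e) \<bullet> e) (at t)"
    if g: "Ck_on 1 g U" and q: "q \<in> ball p (r / 2)" "\<bar>t\<bar> < s" for g q t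
  proof -
    have "q + t *\<^sub>R e \<in> U" using near[OF q] rU by blast
    from has_derivative_grad[OF Ck_on_1D(1)[OF g this]]
    have "((\<lambda>t. g (q + t *\<^sub>R e)) has_derivative (\<lambda>x. grad g (q + t *\<^sub>R e) \<bullet> (x *\<^sub>R e))) (at t)"
      by (rule has_derivative_compose[where f = "\<lambda>t. q + t *\<^sub>R e", rotated]) (auto intro!: derivative_eq_intros)
    then show ?thesis by (simp add: has_field_derivative_def mult_commute_abs)
  qed
  define t0 where "t0 = s / 2"
  have t0: "t0 > 0" "t0 < s" using s by (auto simp: t0_def)
  have pr: "p \<in> ball p (r / 2)" using r by simp
  have incr: "f (p + a *\<^sub>R e) < f (p + b *\<^sub>R e)" if "a < b" "\<bar>a\<bar> < s" "\<bar>b\<bar> < s" for a b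
  proof (rule DERIV_pos_imp_increasing[OF that(1)])
    fix x assume "a \<le> x" "x \<le> b"
    then have x: "\<bar>x\<bar> < s" using that by auto
    show "\<exists>y. ((\<lambda>t. f (p + t *\<^sub>R e)) has_real_derivative y) (at x) \<and> 0 < y"
      using der[OF f(1) pr x] near[OF pr x] r(2) by (auto simp: W_def)
  qed
  have f0: "f (p + t0 *\<^sub>R e) > 0" "f (p + (- t0) *\<^sub>R e) < 0"
    using incr[of 0 t0] incr[of "- t0" 0] t0 s f(2) by auto
  define V where "V = ball p (r / 2) \<inter> {q. q + t0 *\<^sub>R e \<in> U \<inter> f -` {0<..}} \<inter> {q. q + (- t0) *\<^sub>R e \<in> U \<inter> f -` {..<0}}"
  have "open V"
  proof -
    have c: "continuous_on U f" by (rule Ck_on_1D(2)[OF f(1)])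
    have o: "open (U \<inter> f -` {0<..})" "open (U \<inter> f -` {..<0})"
      using continuous_open_preimage[OF c U(1)] by auto
    have "open ((\<lambda>q. q + t0 *\<^sub>R e) -` (U \<inter> f -` {0<..}))"
      by (rule open_vimage[OF o(1)]) (intro continuous_intros)
    moreover have "open ((\<lambda>q. q + (- t0) *\<^sub>R e) -` (U \<inter> f -` {..<0}))"
      by (rule open_vimage[OF o(2)]) (intro continuous_intros)
    ultimately show ?thesis unfolding V_def vimage_def by (intro open_Int open_ball)
  qed
  moreover have "p \<in> V"
    unfolding V_def using f0 near[OF pr, of t0] near[OF pr, of "- t0"] t0 rU r by auto
  moreover have "V \<subseteq> U" using rU r by (auto simp: V_def dest!: subsetD)
  moreover have "f q = 0" if q: "q \<in> V" "F q = 0" for q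
  proof -
    have qb: "q \<in> ball p (r / 2)" using q by (simp add: V_def)
    have "continuous_on {- t0..t0} (\<lambda>t. f (q + t *\<^sub>R e))"
      by (rule DERIV_continuous_on, rule has_field_derivative_at_within, rule der[OF f(1) qb]) (use t0 in auto)
    then obtain t where t: "- t0 \<le> t" "t \<le> t0" "f (q + t *\<^sub>R e) = 0"
      using IVT'[of "\<lambda>t. f (q + t *\<^sub>R e)" "- t0" 0 t0] q t0 by (auto simp: V_def)
    have ts: "\<bar>t\<bar> < s" using t t0 by auto
    have Ft: "F (q + t *\<^sub>R e) = 0" using sub near[OF qb ts] rU t(3) by blast
    have "t = 0"
    proof (rule ccontr)
      assume t_ne: "t \<noteq> 0"
      define a b where "a = min 0 t" and "b = max 0 t"
      have ab: "a < b" "F (q + a *\<^sub>R e) = F (q + b *\<^sub>R e)" "\<bar>a\<bar> < s" "\<bar>b\<bar> < s"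
        using t_ne Ft q(2) ts s by (auto simp: a_def b_def min_def max_def)
      have "\<exists>z>a. z < b \<and> F (q + b *\<^sub>R e) - F (q + a *\<^sub>R e) = (b - a) * (grad F (q + z *\<^sub>R e) \<bullet> e)"
        by (rule MVT2[OF ab(1)]) (rule der[OF F(1) qb], use ab in auto)
      then obtain z where z: "a < z" "z < b" "grad F (q + z *\<^sub>R e) \<bullet> e = 0"
        using ab by auto
      have "\<bar>z\<bar> < s" using z ab by auto
      then have "q + z *\<^sub>R e \<in> W" using near[OF qb] r(2) by blast
      then have "(grad F (q + z *\<^sub>R e) \<bullet> e) * (E \<bullet> e) > 0" by (simp only: W_def Int_iff mem_Collect_eq)
      then show False by (simp only: z(3) mult_zero_left less_irrefl)
    qed
    then show ?thesis using t by simp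
  qed
  ultimately show ?thesis by (rule that)
qed

text \<open>
  The unit normal is twice differentiable wherever \<open>f\<close> has three derivatives.
\<close>

lemma sgn_grad_second_differentiable:
  fixes f :: "'e::euclidean_space \<Rightarrow> real"
  assumes U: "open U" "smooth_on f U" "\<And>q. q \<in> U \<Longrightarrow> grad f q \<noteq> 0" and q: "q \<in> U"
  shows "(\<lambda>x. frechet_derivative (\<lambda>y. sgn (grad f y)) (at x) v) differentiable (at q)"
proof -
  define G where "G x = (\<Sum>b\<in>Basis. frechet_derivative (\<lambda>y. frechet_derivative f (at y) b) (at x) v *\<^sub>R b)" for x
  have Wder: "(grad f has_derivative
      (\<lambda>v. \<Sum>b\<in>Basis. frechet_derivative (\<lambda>y. frechet_derivative f (at y) b) (at x) v *\<^sub>R b)) (at x)"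
    if "x \<in> U" for x
    unfolding grad_def[abs_def]
    by (intro has_derivative_sum has_derivative_scaleR_left)
       (use smooth_on_differentiable[OF smooth_on_frechet[OF U(2)] that] in \<open>simp add: frechet_derivative_works\<close>)
  have Gdiff: "G differentiable (at q)"
  proof -
    have "(\<lambda>x. frechet_derivative (\<lambda>y. frechet_derivative f (at y) b) (at x) v) differentiable (at q)" for b
      by (rule smooth_on_differentiable[OF smooth_on_frechet[OF smooth_on_frechet[OF U(2)]] q])
    then have "(\<lambda>x. frechet_derivative (\<lambda>y. frechet_derivative f (at y) b) (at x) v *\<^sub>R b) differentiable (at q)" for b
      by (rule differentiable_scaleR) simp
    then show ?thesis unfolding G_def[abs_def] by (intro differentiable_sum) auto
  qed
  have eq: "frechet_derivative (\<lambda>y. sgn (grad f y)) (at x) v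
      = inverse (norm (grad f x)) *\<^sub>R G x - ((grad f x \<bullet> G x) * inverse (norm (grad f x)) ^ 3) *\<^sub>R grad f x"
    if x: "x \<in> U" for x
    unfolding frechet_derivative_at[OF has_derivative_compose[OF Wder[OF x] sgn_has_derivative[OF U(3)[OF x]]], symmetric]
    by (simp add: G_def power_inverse divide_inverse)
  have Wd: "grad f differentiable (at q)" by (rule smooth_on_grad_differentiable[OF U(2) q])
  have "(\<lambda>x. norm (grad f x)) differentiable (at q)"
    by (rule differentiable_compose[where g = "grad f"]) (use U(3)[OF q] Wd in auto)
  then have Nd: "(\<lambda>x. inverse (norm (grad f x))) differentiable (at q)"
    by (rule differentiable_inverse) (use U(3)[OF q] in simp)
  have "(\<lambda>x. inverse (norm (grad f x)) *\<^sub>R G x - ((grad f x \<bullet> G x) * inverse (norm (grad f x)) ^ 3) *\<^sub>R grad f x)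
      differentiable (at q)"
    by (intro differentiable_diff differentiable_scaleR differentiable_mult differentiable_inner
          differentiable_power Nd Wd Gdiff)
  then obtain D where D: "((\<lambda>x. inverse (norm (grad f x)) *\<^sub>R G x
      - ((grad f x \<bullet> G x) * inverse (norm (grad f x)) ^ 3) *\<^sub>R grad f x) has_derivative D) (at q)"
    unfolding differentiable_def by blast
  show ?thesis
    by (rule differentiableI, rule has_derivative_transform_within_open[OF D U(1) q]) (simp add: eq)
qed

text \<open>
  Let \<open>n\<close> be the unit normal, with \<open>D\<^sub>X n = \<mu> X\<close> for tangent \<open>X\<close>.  Differentiating this relation along the
  hypersurface and using the symmetry of \<open>D\<^sup>2 n\<close> gives \<open>d\<mu>(Z) v = d\<mu>(v) Z\<close> for tangent vectors; as the
  tangent space has dimension at least 2, \<open>\<mu>\<close> is locally constant.  Then \<open>n - \<mu> q\<close> is locally constant as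
  well, so \<open>n = \<mu> q + w\<close>, which is the gradient of a quadratic function that is constant along the
  hypersurface.
\<close>

lemma umbilic_level_set_locally_quadric:
  fixes f :: "'e::euclidean_space \<Rightarrow> real"
  assumes dim: "DIM('e) \<ge> 3"
    and U: "open U" "smooth_on f U" "\<And>q. q \<in> U \<Longrightarrow> grad f q \<noteq> 0"
    and p: "p \<in> U" "f p = 0"
    and umb: "\<And>q. q \<in> U \<Longrightarrow> f q = 0 \<Longrightarrow>
      \<exists>l. \<forall>X. grad f q \<bullet> X = 0 \<longrightarrow> frechet_derivative (\<lambda>y. sgn (grad f y)) (at q) X = l *\<^sub>R X"
  obtains a v d V where "unit_quad a v d" "open V" "p \<in> V" "V \<subseteq> U"
    "\<And>q. q \<in> V \<Longrightarrow> f q = 0 \<Longrightarrow> quad a v d q = 0"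
proof -
  define n where "n q = sgn (grad f q)" for q
  define Dn where "Dn q = frechet_derivative n (at q)" for q
  have n_eq: "n = (\<lambda>y. sgn (grad f y))" by (simp add: n_def[abs_def])
  have n1: "n q \<bullet> n q = 1" if "q \<in> U" for q
    using U(3)[OF that] by (simp add: n_def dot_square_norm norm_sgn)
  have tan: "n q \<bullet> X = 0 \<longleftrightarrow> grad f q \<bullet> X = 0" if "q \<in> U" for q X
    using U(3)[OF that] by (simp add: n_def sgn_div_norm)
  have Dn: "(n has_derivative Dn q) (at q)" if "q \<in> U" for q
    using sgn_grad_differentiable[OF U(2) that U(3)[OF that]]
    unfolding Dn_def n_eq frechet_derivative_works .
  have linDn: "linear (Dn q)" if "q \<in> U" for q using Dn[OF that] has_derivative_linear by blast
  have Dn2: "(\<lambda>x. Dn x v) differentiable (at q)" if "q \<in> U" for q v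
    using sgn_grad_second_differentiable[OF U that] unfolding Dn_def n_eq .
  have nDn: "n q \<bullet> Dn q X = 0" if "q \<in> U" for q X
  proof -
    have "((\<lambda>x. n x \<bullet> n x) has_derivative (\<lambda>X. n q \<bullet> Dn q X + Dn q X \<bullet> n q)) (at q)"
      by (intro has_derivative_inner Dn that)
    moreover have "((\<lambda>x. n x \<bullet> n x) has_derivative (\<lambda>X. 0)) (at q)"
      by (rule has_derivative_transform_within_open[OF has_derivative_const U(1) that]) (simp add: n1)
    ultimately have "n q \<bullet> Dn q X + Dn q X \<bullet> n q = 0"
      using has_derivative_unique by metis
    then show ?thesis by (simp add: inner_commute)
  qed
  \<comment> \<open>The trace formula defines \<open>\<mu>\<close> on the whole of \<open>U\<close>, as a differentiable function; it is the
    principal curvature only along the level set.  The normal direction adds nothing to the trace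
    because \<open>n \<bullet> Dn n = 0\<close>.\<close>
  define mu where "mu q = (\<Sum>b\<in>Basis. Dn q b \<bullet> b) / (real DIM('e) - 1)" for q
  have mu: "Dn q X = mu q *\<^sub>R X" if q: "q \<in> U" "f q = 0" and X: "n q \<bullet> X = 0" for q X
  proof -
    obtain l where "\<forall>X. grad f q \<bullet> X = 0 \<longrightarrow> frechet_derivative (\<lambda>y. sgn (grad f y)) (at q) X = l *\<^sub>R X"
      using umb[OF q] by blast
    then have l: "Dn q X = l *\<^sub>R X" if "n q \<bullet> X = 0" for X
      using tan[OF q(1)] that unfolding Dn_def n_eq by blast
    have gen: "Dn q b = l *\<^sub>R b - (l * (b \<bullet> n q)) *\<^sub>R n q + (b \<bullet> n q) *\<^sub>R Dn q (n q)" for b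
    proof -
      have "n q \<bullet> (b - (b \<bullet> n q) *\<^sub>R n q) = 0"
        using n1[OF q(1)] by (simp add: inner_diff_right inner_commute)
      from l[OF this] show ?thesis
        by (simp add: linear_diff[OF linDn[OF q(1)]] linear_cmul[OF linDn[OF q(1)]] algebra_simps)
    qed
    have "(\<Sum>b\<in>Basis. Dn q b \<bullet> b) = (\<Sum>b\<in>Basis. l - l * ((n q \<bullet> b) * (n q \<bullet> b)) + (n q \<bullet> b) * (Dn q (n q) \<bullet> b))"
      by (rule sum.cong[OF refl], subst gen)
         (simp add: inner_add_left inner_diff_left inner_add_right inner_diff_right inner_commute)
    also have "\<dots> = l * DIM('e) - l * (n q \<bullet> n q) + n q \<bullet> Dn q (n q)"
      unfolding euclidean_inner[of "n q" "n q"] euclidean_inner[of "n q" "Dn q (n q)"]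
      by (simp add: sum.distrib sum_subtractf sum_distrib_left)
    also have "\<dots> = l * (real DIM('e) - 1)"
      using n1[OF q(1)] nDn[OF q(1)] by (simp add: algebra_simps)
    finally have "mu q = l" using dim by (simp add: mu_def)
    then show ?thesis using l[OF X] by simp
  qed
  have mu_diff: "mu differentiable (at q)" if "q \<in> U" for q
  proof -
    have "(\<lambda>x. Dn x b \<bullet> b) differentiable (at q)" for b
      using Dn2[OF that] by (rule differentiable_inner) simp
    then have "(\<lambda>x. (\<Sum>b\<in>Basis. Dn x b \<bullet> b) * (1 / (real DIM('e) - 1))) differentiable (at q)"
      by (intro differentiable_mult differentiable_sum) auto
    then show ?thesis by (simp add: mu_def[abs_def])
  qed
  define dmu where "dmu q = frechet_derivative mu (at q)" for q
  have dmu: "(mu has_derivative dmu q) (at q)" if "q \<in> U" for q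
    using mu_diff[OF that] unfolding dmu_def frechet_derivative_works .
  have dmu0: "dmu q Z = 0" if q: "q \<in> U" "f q = 0" and Z: "grad f q \<bullet> Z = 0" for q Z
  proof -
    have E: "\<exists>E'. ((\<lambda>x. Dn x (n x)) has_derivative E') (at q)"
    proof -
      have "(\<lambda>x. \<Sum>b\<in>Basis. (n x \<bullet> b) *\<^sub>R Dn x b) differentiable (at q)"
        using Dn2[OF q(1)] differentiableI[OF Dn[OF q(1)]]
        by (intro differentiable_sum differentiable_scaleR differentiable_inner) auto
      then obtain E' where E': "((\<lambda>x. \<Sum>b\<in>Basis. (n x \<bullet> b) *\<^sub>R Dn x b) has_derivative E') (at q)"
        unfolding differentiable_def by blast
      have "Dn x (n x) = (\<Sum>b\<in>Basis. (n x \<bullet> b) *\<^sub>R Dn x b)" if "x \<in> U" for x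
        by (subst (2) euclidean_representation[symmetric])
           (simp add: linear_sum[OF linDn[OF that]] linear_cmul[OF linDn[OF that]])
      then show ?thesis
        by (intro exI) (rule has_derivative_transform_within_open[OF E' U(1) q(1)], simp)
    qed
    then obtain E' where E': "((\<lambda>x. Dn x (n x)) has_derivative E') (at q)" by blast
    define D2 where "D2 v = frechet_derivative (\<lambda>x. Dn x v) (at q)" for v
    have D2: "((\<lambda>x. Dn x v) has_derivative D2 v) (at q)" for v
      using Dn2[OF q(1)] unfolding D2_def frechet_derivative_works .
    have sym: "D2 v w = D2 w v" for v w
    proof (rule euclidean_eqI)
      fix b :: 'e
      show "D2 v w \<bullet> b = D2 w v \<bullet> b"
      proof (rule second_derivative_symmetric[OF U(1) q(1), of "\<lambda>x. n x \<bullet> b" "\<lambda>x v. Dn x v \<bullet> b"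
            v "\<lambda>w. D2 v w \<bullet> b" w "\<lambda>v. D2 w v \<bullet> b"])
        show "((\<lambda>x. n x \<bullet> b) has_derivative (\<lambda>v. Dn x v \<bullet> b)) (at x)" if "x \<in> U" for x
          by (intro has_derivative_inner_left Dn that)
      qed (intro has_derivative_inner_left D2)+
    qed
    \<comment> \<open>For constant \<open>v\<close> the projection of \<open>v\<close> to the tangent space satisfies the umbilicity relation at all
      points of the level set; this is its derivative in the direction \<open>Z\<close>.\<close>
    have main: "D2 v Z - mu q *\<^sub>R ((v \<bullet> Z) *\<^sub>R Dn q (n q)) - dmu q Z *\<^sub>R v + (mu q * mu q * (v \<bullet> Z)) *\<^sub>R n q = 0"
      if v: "grad f q \<bullet> v = 0" and Z: "grad f q \<bullet> Z = 0" for v Z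
    proof -
      have nv: "v \<bullet> n q = 0" and nZ: "n q \<bullet> Z = 0"
        using v Z tan[OF q(1)] by (auto simp: inner_commute)
      have "((\<lambda>x. Dn x v - (v \<bullet> n x) *\<^sub>R Dn x (n x) - mu x *\<^sub>R v + (mu x * (v \<bullet> n x)) *\<^sub>R n x) has_derivative
          (\<lambda>Z. D2 v Z - ((v \<bullet> n q) *\<^sub>R E' Z + (v \<bullet> Dn q Z) *\<^sub>R Dn q (n q)) - dmu q Z *\<^sub>R v
             + ((mu q * (v \<bullet> n q)) *\<^sub>R Dn q Z + (mu q * (v \<bullet> Dn q Z) + dmu q Z * (v \<bullet> n q)) *\<^sub>R n q))) (at q)"
        by (intro has_derivative_add has_derivative_diff has_derivative_scaleR has_derivative_mult
              has_derivative_scaleR_left has_derivative_inner_right D2 E' Dn dmu q)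
      then have "D2 v Z - ((v \<bullet> n q) *\<^sub>R E' Z + (v \<bullet> Dn q Z) *\<^sub>R Dn q (n q)) - dmu q Z *\<^sub>R v
             + ((mu q * (v \<bullet> n q)) *\<^sub>R Dn q Z + (mu q * (v \<bullet> Dn q Z) + dmu q Z * (v \<bullet> n q)) *\<^sub>R n q) = 0"
      proof (rule level_set_derivative_zero[OF U(1) smooth_on_Ck1[OF U(2)] q U(3)[OF q(1)] Z, where ?k0.0 = 0])
        fix x assume x: "x \<in> U" "f x = 0"
        have "n x \<bullet> (v - (v \<bullet> n x) *\<^sub>R n x) = 0"
          using n1[OF x(1)] by (simp add: inner_diff_right inner_commute)
        from mu[OF x this]
        show "Dn x v - (v \<bullet> n x) *\<^sub>R Dn x (n x) - mu x *\<^sub>R v + (mu x * (v \<bullet> n x)) *\<^sub>R n x = 0"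
          by (simp add: linear_diff[OF linDn[OF x(1)]] linear_cmul[OF linDn[OF x(1)]] algebra_simps)
      qed
      then show ?thesis using nv mu[OF q nZ] by (simp add: mult.assoc)
    qed
    obtain v where v: "v \<noteq> 0" "grad f q \<bullet> v = 0" "Z \<bullet> v = 0"
      using orthogonal_to_two_vectors_exists[OF dim, of "grad f q" Z] by blast
    have "D2 v Z = dmu q Z *\<^sub>R v" "D2 Z v = dmu q v *\<^sub>R Z"
      using main[OF v(2) Z] main[OF Z v(2)] v(3) by (auto simp: inner_commute)
    then have "dmu q Z *\<^sub>R v = dmu q v *\<^sub>R Z" using sym by metis
    then have "(dmu q Z *\<^sub>R v) \<bullet> v = (dmu q v *\<^sub>R Z) \<bullet> v" by (rule arg_cong)
    then show ?thesis using v by simp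
  qed
  have f1: "Ck_on 1 f V" if "V \<subseteq> U" for V using Ck_on_mono[OF smooth_on_Ck1[OF U(2)] that] .
  obtain V1 where V1: "open V1" "p \<in> V1" "V1 \<subseteq> U"
    and V1c: "\<And>(k :: 'e \<Rightarrow> real) k' q. (\<And>q. q \<in> V1 \<Longrightarrow> f q = 0 \<Longrightarrow> (k has_derivative k' q) (at q)) \<Longrightarrow>
       (\<And>q X. q \<in> V1 \<Longrightarrow> f q = 0 \<Longrightarrow> grad f q \<bullet> X = 0 \<Longrightarrow> k' q X = 0) \<Longrightarrow>
       q \<in> V1 \<Longrightarrow> f q = 0 \<Longrightarrow> k q = k p"
    using level_set_locally_constant[OF U(1) f1[OF subset_refl] p U(3)[OF p(1)], where ?'c = real] by blast
  define m where "m = mu p"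
  have mu_m: "mu q = m" if "q \<in> V1" "f q = 0" for q
    unfolding m_def by (rule V1c[of mu dmu, OF dmu dmu0 that]) (use V1 in auto)
  obtain V2 where V2: "open V2" "p \<in> V2" "V2 \<subseteq> V1"
    and V2c: "\<And>(k :: 'e \<Rightarrow> 'e) k' q. (\<And>q. q \<in> V2 \<Longrightarrow> f q = 0 \<Longrightarrow> (k has_derivative k' q) (at q)) \<Longrightarrow>
       (\<And>q X. q \<in> V2 \<Longrightarrow> f q = 0 \<Longrightarrow> grad f q \<bullet> X = 0 \<Longrightarrow> k' q X = 0) \<Longrightarrow>
       q \<in> V2 \<Longrightarrow> f q = 0 \<Longrightarrow> k q = k p"
    using level_set_locally_constant[OF V1(1) f1[OF V1(3)] V1(2) p(2) U(3)[OF p(1)], where ?'c = 'e] by blast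
  define w where "w = n p - m *\<^sub>R p"
  have n_lin: "n q = m *\<^sub>R q + w" if q: "q \<in> V2" "f q = 0" for q
  proof -
    have "n q - m *\<^sub>R q = n p - m *\<^sub>R p"
    proof (rule V2c[of "\<lambda>q. n q - m *\<^sub>R q" "\<lambda>q X. Dn q X - m *\<^sub>R X", OF _ _ q])
      fix x assume x: "x \<in> V2" "f x = 0"
      have xU: "x \<in> U" "x \<in> V1" using x V1 V2 by auto
      show "((\<lambda>q. n q - m *\<^sub>R q) has_derivative (\<lambda>X. Dn x X - m *\<^sub>R X)) (at x)"
        by (intro has_derivative_diff has_derivative_scaleR_right has_derivative_ident Dn xU)
      show "Dn x X - m *\<^sub>R X = 0" if "grad f x \<bullet> X = 0" for X
        using mu[OF xU(1) x(2)] tan[OF xU(1)] that mu_m[OF xU(2) x(2)] by simp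
    qed
    then show ?thesis by (simp add: w_def algebra_simps)
  qed
  obtain V3 where V3: "open V3" "p \<in> V3" "V3 \<subseteq> V2"
    and V3c: "\<And>(k :: 'e \<Rightarrow> real) k' q. (\<And>q. q \<in> V3 \<Longrightarrow> f q = 0 \<Longrightarrow> (k has_derivative k' q) (at q)) \<Longrightarrow>
       (\<And>q X. q \<in> V3 \<Longrightarrow> f q = 0 \<Longrightarrow> grad f q \<bullet> X = 0 \<Longrightarrow> k' q X = 0) \<Longrightarrow>
       q \<in> V3 \<Longrightarrow> f q = 0 \<Longrightarrow> k q = k p"
    using level_set_locally_constant[OF V2(1) f1[OF subset_trans[OF V2(3) V1(3)]] V2(2) p(2) U(3)[OF p(1)], where ?'c = real]
    by blast
  define d where "d = - quad (m / 2) w 0 p"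
  show ?thesis
  proof (rule that[of "m / 2" w d V3])
    have "quad (m / 2) w d p = 0" by (simp add: d_def quad_def)
    then have "(m / 2) * (p \<bullet> p) + w \<bullet> p = - d" by (simp add: quad_def)
    moreover have "n p \<bullet> n p = 4 * (m / 2) * ((m / 2) * (p \<bullet> p) + w \<bullet> p) + w \<bullet> w"
      unfolding n_lin[OF V2(2) p(2)]
      by (simp add: inner_add_left inner_add_right inner_commute algebra_simps)
    ultimately show "unit_quad (m / 2) w d"
      using n1[OF p(1)] by (simp add: unit_quad_def)
    show "quad (m / 2) w d q = 0" if q: "q \<in> V3" "f q = 0" for q
    proof -
      have "quad (m / 2) w d q = quad (m / 2) w d p"
      proof (rule V3c[of _ "\<lambda>q X. ((2 * (m / 2)) *\<^sub>R q + w) \<bullet> X", OF quad_has_derivative _ q])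
        fix x X assume x: "x \<in> V3" "f x = 0" "grad f x \<bullet> X = 0"
        then have "x \<in> V2" "x \<in> U" using V1 V2 V3 by auto
        then show "((2 * (m / 2)) *\<^sub>R x + w) \<bullet> X = 0" using n_lin[of x] tan[of x X] x by simp
      qed
      then show ?thesis by (simp add: d_def quad_def)
    qed
    show "V3 \<subseteq> U" using V1 V2 V3 by blast
  qed (use V3 in auto)
qed

text \<open>
  Equality of all eigenvalues is turned into \<open>D\<^sub>X n = \<mu> X\<close> by diagonalising the shape operator, which is
  symmetric because the second derivative of \<open>f\<close> is.
\<close>

lemma totally_umbilical_locally_quadric:
  fixes L :: "('a::euclidean_space \<times> real) set"
  assumes dim: "DIM('a) \<ge> 2" and L: "totally_umbilical L" and f: "local_equation L p U f"
  obtains a v d V where "unit_quad a v d" "open V" "p \<in> V" "V \<subseteq> U"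
    "\<And>q. q \<in> V \<Longrightarrow> f q = 0 \<longleftrightarrow> quad a v d q = 0"
proof -
  have U: "open U" "smooth_on f U" "\<And>q. q \<in> U \<Longrightarrow> grad f q \<noteq> 0" "p \<in> U" "U \<subseteq> half_space"
    using f by (auto simp: local_equation_def)
  have fp: "f p = 0" by (rule local_equation_zero[OF f])
  have dim3: "DIM('a \<times> real) \<ge> 3" using dim by simp
  have umb: "\<exists>l. \<forall>X. grad f q \<bullet> X = 0 \<longrightarrow> frechet_derivative (\<lambda>y. sgn (grad f y)) (at q) X = l *\<^sub>R X"
    if q: "q \<in> U" "f q = 0" for q
  proof -
    have fq: "local_equation L q U f" by (rule local_equation_move[OF f q])
    have y: "snd q > 0" "q \<in> half_space" using q U(5) by (auto simp: half_space_def)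
    let ?A = "frechet_derivative (\<lambda>y. sgn (grad f y)) (at q)"
    let ?T = "{X. grad f q \<bullet> X = 0}"
    have A: "((\<lambda>y. sgn (grad f y)) has_derivative ?A) (at q)"
      using sgn_grad_differentiable[OF U(2) q(1) U(3)[OF q(1)]] unfolding frechet_derivative_works .
    define W' where "W' = frechet_derivative (grad f) (at q)"
    have W': "(grad f has_derivative W') (at q)"
      using smooth_on_grad_differentiable[OF U(2) q(1)] unfolding W'_def frechet_derivative_works .
    have Aeq: "?A X = W' X /\<^sub>R norm (grad f q) - ((grad f q \<bullet> W' X) / norm (grad f q) ^ 3) *\<^sub>R grad f q" for X
      unfolding frechet_derivative_at[OF has_derivative_compose[OF W' sgn_has_derivative[OF U(3)[OF q(1)]]], symmetric]
      by simp
    have W'sym: "W' v \<bullet> w = W' w \<bullet> v" for v w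
      by (rule second_derivative_symmetric[OF U(1) q(1), of f "\<lambda>x v. grad f x \<bullet> v" w "\<lambda>v. W' v \<bullet> w" v "\<lambda>w. W' w \<bullet> v"])
         (auto intro!: has_derivative_inner_left W' has_derivative_grad smooth_on_differentiable[OF U(2)])
    have "\<exists>l. \<forall>X\<in>?T. ?A X = l *\<^sub>R X"
    proof (rule self_adjoint_single_eigenvalue)
      show "subspace ?T" by (rule subspace_hyperplane)
      show "linear ?A" using A by (rule has_derivative_linear)
      show "?A X \<in> ?T" for X
        using U(3)[OF q(1)]
        by (simp add: Aeq inner_diff_right dot_square_norm power2_eq_square power3_eq_cube)
           (simp add: divide_inverse mult.commute)
      show "?A X \<bullet> Y = X \<bullet> ?A Y" if "X \<in> ?T" "Y \<in> ?T" for X Y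
        using that W'sym[of X Y] by (simp add: Aeq inner_diff_right inner_diff_left inner_commute)
      fix X Y k l
      assume "X \<in> ?T" "X \<noteq> 0" "?A X = k *\<^sub>R X" "Y \<in> ?T" "Y \<noteq> 0" "?A Y = l *\<^sub>R Y"
      moreover have pc: "principal_curvature L q (unit_normal f q) (snd q * k - snd (sgn (grad f q)))"
        if X: "X \<in> ?T" "X \<noteq> 0" "?A X = k *\<^sub>R X" for X k
      proof -
        have "frechet_derivative f (at q) X = 0"
          using X(1) frechet_derivative_eq_grad[OF smooth_on_differentiable[OF U(2) q(1)], of X] by simp
        then have "X \<in> tangent_space L q" using fq unfolding tangent_space_def by blast
        moreover have "cov_deriv (unit_normal f) q X = (snd q * k - snd (sgn (grad f q))) *\<^sub>R X"
          using cov_deriv_unit_normal[OF A y(2)] X by (simp add: algebra_simps)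
        ultimately show ?thesis using fq X(2) unfolding principal_curvature_def by blast
      qed
      moreover have "k' = l'" if "principal_curvature L q (unit_normal f q) k'"
        "principal_curvature L q (unit_normal f q) l'" for k' l'
        using L that local_equation_subset[OF f q] unfolding totally_umbilical_def by blast
      ultimately have "snd q * k - snd (sgn (grad f q)) = snd q * l - snd (sgn (grad f q))" by blast
      then show "k = l" using y by simp
    qed
    then show ?thesis by blast
  qed
  obtain a v d V where V: "unit_quad a v d" "open V" "p \<in> V" "V \<subseteq> U"
    "\<And>q. q \<in> V \<Longrightarrow> f q = 0 \<Longrightarrow> quad a v d q = 0"
    using umbilic_level_set_locally_quadric[OF dim3 U(1-4) fp umb] by blast
  have qp: "quad a v d p = 0" using V fp by blast
  have nz: "grad (quad a v d) p \<noteq> 0" using norm_grad_quad[OF V(1) qp] by (auto simp: grad_quad)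
  obtain V' where "open V'" "p \<in> V'" "V' \<subseteq> V" "\<And>q. q \<in> V' \<Longrightarrow> quad a v d q = 0 \<Longrightarrow> f q = 0"
    using level_set_subset_imp_eq[OF V(2,3) Ck_on_mono[OF smooth_on_Ck1[OF U(2)] V(4)] fp U(3)[OF U(4)] Ck1_quad qp nz V(5)]
    by blast
  then show ?thesis using that[OF V(1), of V'] V by blast
qed


section \<open>Leaves of umbilical foliations are whole quadrics\<close>

text \<open>
  A local equation describes only one path component of \<open>L \<inter> U\<close>; a path connected piece of the leaf
  inside \<open>U\<close> that touches this sheet belongs to it.
\<close>

lemma path_connected_subset_local_equation:
  assumes f: "local_equation L p U f" and A: "path_connected A" "A \<subseteq> L \<inter> U"
    and x: "x \<in> A" "f x = 0" and y: "y \<in> A"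
  shows "f y = 0"
proof -
  have eq: "path_component_set (L \<inter> U) p = {q \<in> U. f q = 0}"
    using f unfolding local_equation_def by blast
  have "path_component (L \<inter> U) p x" using x A(2) eq by blast
  moreover have "path_component (L \<inter> U) x y"
    using A x(1) y path_component_of_subset path_connected_component by metis
  ultimately have "path_component (L \<inter> U) p y" by (rule path_component_trans)
  then show ?thesis using eq by blast
qed

text \<open>
  The property that is propagated along the quadric in order to show that the leaf contains all of it.
  A point of the quadric that belongs to \<open>L\<close> need not have it a priori: \<open>L\<close> could cross the quadric there.
\<close>

definition sheet_at :: "('a::euclidean_space \<times> real) set \<Rightarrow> real \<Rightarrow> 'a \<times> real \<Rightarrow> real \<Rightarrow> 'a \<times> real \<Rightarrow> bool" where
  "sheet_at L a v d x \<longleftrightarrow> quad a v d x = 0 \<and> (\<exists>V. open V \<and> x \<in> V \<and> {y \<in> V. quad a v d y = 0} \<subseteq> L)"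

lemma sheet_at_determines_quad:
  fixes v v' :: "'a::euclidean_space \<times> real"
  assumes f: "local_equation L x U f"
    and u: "unit_quad a v d" "unit_quad a' v' d'"
    and s: "sheet_at L a v d x"
    and V': "open V'" "x \<in> V'" "V' \<subseteq> U" "\<And>y. y \<in> V' \<Longrightarrow> f y = 0 \<longleftrightarrow> quad a' v' d' y = 0"
  shows "quad a v d y = 0 \<longleftrightarrow> quad a' v' d' y = 0"
proof -
  obtain V where V: "open V" "x \<in> V" "{y \<in> V. quad a v d y = 0} \<subseteq> L" and q0: "quad a v d x = 0"
    using s unfolding sheet_at_def by blast
  have nz: "grad (quad a v d) x \<noteq> 0" using norm_grad_quad[OF u(1) q0] by (auto simp: grad_quad)
  have VV: "open (V \<inter> V')" "x \<in> V \<inter> V'" using V V' by auto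
  obtain W where W: "open W" "x \<in> W" "W \<subseteq> V \<inter> V'" "path_connected {y \<in> W. quad a v d y = 0}"
    using level_set_path_connected_nbhd[OF VV(1) Ck1_quad VV(2) q0 nz] by blast
  have fx: "f x = 0" by (rule local_equation_zero[OF f])
  have sub: "quad a' v' d' y = 0" if y: "y \<in> W" "quad a v d y = 0" for y
  proof -
    have sub: "{y \<in> W. quad a v d y = 0} \<subseteq> L \<inter> U" using V(3) W(3) V'(3) by blast
    have "f y = 0"
      by (rule path_connected_subset_local_equation[OF f W(4) sub, of x]) (use W q0 fx y in auto)
    then show ?thesis using V'(4)[of y] W(3) y by blast
  qed
  show ?thesis
  proof (rule quad_rigid[OF DIM_prod_real_ge_2 u q0 W(1,2) sub])
    assume "a' = - a" "v' = - v" "d' = - d"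
    then show ?thesis by (simp add: quad_uminus)
  qed simp_all
qed

text \<open>
  By connectedness of the quadric it suffices that each of its points \<open>x\<close> has a neighbourhood \<open>N\<close> in the quadric on
  which the property holds everywhere or nowhere.  Let \<open>N\<close> be a connected piece inside a chart
  \<open>U\<close> at \<open>x\<close>; consider a point \<open>y\<close> of \<open>N\<close> with the property and the plaque \<open>C\<close> of \<open>L\<close> through \<open>y\<close>.  The points of \<open>N\<close> that lie in \<open>C\<close> and have the property
  form a subset of \<open>N\<close> that is open, and closed because \<open>C\<close> is closed in \<open>U\<close> and because near each point of \<open>C\<close> the
  leaf is itself a piece of some quadric.
\<close>

lemma quadric_subset_leaf:
  fixes v :: "'a::euclidean_space \<times> real"
  assumes dim: "DIM('a) \<ge> 2" and fol: "foliation F" and L: "L \<in> F" and umb: "totally_umbilical L"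
    and u: "unit_quad a v d" and p: "p \<in> quadric a v d" "sheet_at L a v d p" and q: "q \<in> quadric a v d"
  shows "sheet_at L a v d q"
proof (rule connected_induction_simple[of "quadric a v d" p q "sheet_at L a v d"])
  show "connected (quadric a v d)" using path_connected_quadric[OF u] path_connected_imp_connected by blast
  fix x assume x: "x \<in> quadric a v d"
  then have xH: "x \<in> half_space" "quad a v d x = 0" by (auto simp: quadric_def)
  have nz: "grad (quad a v d) z \<noteq> 0" if "quad a v d z = 0" for z
    using norm_grad_quad[OF u that] by (auto simp: grad_quad)
  obtain U \<phi> \<psi> where U: "x \<in> U" "foliated_chart F U \<phi> \<psi>"
    using fol xH unfolding foliation_def by blast
  have ch: "open U" "U \<subseteq> half_space" "homeomorphism U UNIV \<phi> \<psi>"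
    "\<And>C. C \<in> components (L \<inter> U) \<Longrightarrow> \<exists>c. C = {q \<in> U. snd (\<phi> q) = c}"
    using U(2) L unfolding foliated_chart_def by auto
  have cont: "continuous_on U \<phi>" "continuous_on UNIV \<psi>" using ch(3) by (auto simp: homeomorphism_def)
  obtain V where V: "open V" "x \<in> V" "V \<subseteq> U" "path_connected {y \<in> V. quad a v d y = 0}"
    using level_set_path_connected_nbhd[OF ch(1) Ck1_quad U(1) xH(2) nz[OF xH(2)]] by blast
  define N where "N = {y \<in> V. quad a v d y = 0}"
  have NS: "N = quadric a v d \<inter> V" using V(3) ch(2) by (auto simp: N_def quadric_def)
  have "sheet_at L a v d z" if y: "y \<in> N" "sheet_at L a v d y" and z: "z \<in> N" for y z
  proof -
    have yL: "y \<in> L" "y \<in> U" using y V(3) unfolding sheet_at_def N_def by blast+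
    define C where "C = connected_component_set (L \<inter> U) y"
    have "C \<in> components (L \<inter> U)" unfolding C_def using yL by (intro componentsI) blast
    then obtain c where c: "C = {q \<in> U. snd (\<phi> q) = c}" using ch(4) by blast
    have yC: "y \<in> C" unfolding C_def using yL by (simp add: connected_component_refl)
    have CL: "C \<subseteq> L \<inter> U" unfolding C_def by (rule connected_component_subset)
    have "z \<in> C \<and> sheet_at L a v d z"
    proof (rule connected_induction_simple[of N y z "\<lambda>z. z \<in> C \<and> sheet_at L a v d z"])
      show "connected N" using V(4) path_connected_imp_connected by (simp add: N_def)
      show "y \<in> N" "z \<in> N" by fact+
      show "y \<in> C \<and> sheet_at L a v d y" using yC y by blast
      fix w assume w: "w \<in> N"
      then have wU: "w \<in> U" "quad a v d w = 0" using V by (auto simp: N_def)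
      show "\<exists>T. openin (top_of_set N) T \<and> w \<in> T \<and>
          (\<forall>x\<in>T. \<forall>y\<in>T. x \<in> C \<and> sheet_at L a v d x \<longrightarrow> y \<in> C \<and> sheet_at L a v d y)"
      proof (cases "w \<in> C")
        case False
        have "open (U \<inter> (\<lambda>q. snd (\<phi> q)) -` (- {c}))"
          by (intro continuous_open_preimage ch(1) continuous_intros cont)
        moreover have "w \<in> U \<inter> (\<lambda>q. snd (\<phi> q)) -` (- {c})" using False wU c by auto
        moreover have "(U \<inter> (\<lambda>q. snd (\<phi> q)) -` (- {c})) \<inter> C = {}" using c by auto
        ultimately show ?thesis
          using w by (intro exI[of _ "N \<inter> (U \<inter> (\<lambda>q. snd (\<phi> q)) -` (- {c}))"]) (auto simp: openin_open_Int)
      next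
        case True
        then have wL: "w \<in> L" using CL by blast
        obtain Uw f where f: "local_equation L w Uw f"
          using umb wL unfolding totally_umbilical_def hypersurface_def by blast
        obtain a' v' d' V' where V': "unit_quad a' v' d'" "open V'" "w \<in> V'" "V' \<subseteq> Uw"
          "\<And>q. q \<in> V' \<Longrightarrow> f q = 0 \<longleftrightarrow> quad a' v' d' q = 0"
          using totally_umbilical_locally_quadric[OF dim umb f] by blast
        have fw: "f w = 0" by (rule local_equation_zero[OF f])
        have "open (\<psi> -` V')" using cont(2) V'(2) open_vimage by blast
        moreover have \<psi>w: "\<psi> (\<phi> w) = w" using ch(3) wU unfolding homeomorphism_def by blast
        ultimately obtain r where r: "r > 0" "ball (\<phi> w) r \<subseteq> \<psi> -` V'"
          using V'(3) open_contains_ball by (metis vimageI2)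
        define W where "W = U \<inter> \<phi> -` ball (\<phi> w) r"
        have W: "open W" "w \<in> W" "W \<subseteq> V'"
        proof -
          show "open W" unfolding W_def by (intro continuous_open_preimage ch(1) cont) auto
          show "w \<in> W" using wU r by (simp add: W_def)
          show "W \<subseteq> V'"
          proof
            fix t assume t: "t \<in> W"
            then have "\<psi> (\<phi> t) = t" using ch(3) unfolding homeomorphism_def W_def by blast
            then show "t \<in> V'" using t r(2) unfolding W_def by fastforce
          qed
        qed
        \<comment> \<open>In the chart the plaque is a piece of a hyperplane, so its small pieces are path connected.\<close>
        have plaque: "C \<inter> W = \<psi> ` (ball (\<phi> w) r \<inter> {t. (0, 1) \<bullet> t = c})"
        proof (intro set_eqI iffI)
          fix t assume t: "t \<in> C \<inter> W"
          then have "\<psi> (\<phi> t) = t" using ch(3) unfolding homeomorphism_def W_def by blast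
          then show "t \<in> \<psi> ` (ball (\<phi> w) r \<inter> {t. (0, 1) \<bullet> t = c})"
            using t by (intro image_eqI[of _ _ "\<phi> t"]) (auto simp: c W_def inner_prod_real)
        next
          fix t assume "t \<in> \<psi> ` (ball (\<phi> w) r \<inter> {t. (0, 1) \<bullet> t = c})"
          then obtain s where s: "t = \<psi> s" "s \<in> ball (\<phi> w) r" "snd s = c" by (auto simp: inner_prod_real)
          then have "t \<in> U" "\<phi> t = s" using ch(3) unfolding homeomorphism_def by blast+
          then show "t \<in> C \<inter> W" using s by (auto simp: c W_def)
        qed
        have pcC: "path_connected (C \<inter> W)"
          unfolding plaque
          by (intro path_connected_continuous_image convex_imp_path_connected convex_Int convex_hyperplane
                continuous_on_subset[OF cont(2)]) auto
        have Cf: "f t = 0" if "t \<in> C \<inter> W" for t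
          by (rule path_connected_subset_local_equation[OF f pcC _ _ fw that])
             (use CL W V'(4) True in auto)
        have VW: "open (V \<inter> W)" "w \<in> V \<inter> W" using V W w by (auto simp: N_def)
        obtain T where T: "open T" "w \<in> T" "T \<subseteq> V \<inter> W" "path_connected {y \<in> T. quad a v d y = 0}"
          using level_set_path_connected_nbhd[OF VW(1) Ck1_quad VW(2) wU(2) nz[OF wU(2)]] by blast
        have "t2 \<in> C \<and> sheet_at L a v d t2"
          if t1: "t1 \<in> N \<inter> T" "t1 \<in> C" "sheet_at L a v d t1" and t2: "t2 \<in> N \<inter> T" for t1 t2
        proof -
          have t1': "t1 \<in> C \<inter> W" "t1 \<in> V'" "t1 \<in> Uw" using t1 T(3) W(3) V'(4) by auto
          have f1: "local_equation L t1 Uw f" by (rule local_equation_move[OF f t1'(3) Cf[OF t1'(1)]])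
          have eq: "quad a v d y = 0 \<longleftrightarrow> quad a' v' d' y = 0" for y
            using sheet_at_determines_quad[OF f1 u V'(1) t1(3) V'(2) t1'(2) V'(4,5)] .
          have inL: "y \<in> L" if "y \<in> V'" "quad a v d y = 0" for y
            using that eq V'(5) local_equation_subset[OF f, of y] V'(4) by blast
          have TV: "{y \<in> T. quad a v d y = 0} \<subseteq> L \<inter> U" using inL T(3) W(3) V(3) by blast
          have t2T: "t2 \<in> {y \<in> T. quad a v d y = 0}" "t1 \<in> {y \<in> T. quad a v d y = 0}"
            using t1 t2 by (auto simp: N_def)
          have "connected_component (L \<inter> U) t1 t2"
            using path_connected_imp_connected[OF T(4)] TV t2T unfolding connected_component_def by blast
          moreover have "connected_component (L \<inter> U) y t1" using t1(2) unfolding C_def by blast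
          ultimately have "t2 \<in> C" unfolding C_def using connected_component_trans by blast
          moreover have "sheet_at L a v d t2"
            unfolding sheet_at_def using t2T inL V'(2) T(3) W(3) by blast
          ultimately show ?thesis ..
        qed
        moreover have "openin (top_of_set N) (N \<inter> T)" "w \<in> N \<inter> T"
          using w T(1,2) by (auto simp: openin_open_Int)
        ultimately show ?thesis by blast
      qed
    qed
    then show ?thesis ..
  qed
  moreover have "openin (top_of_set (quadric a v d)) N" "x \<in> N"
    using V(1,2) x by (auto simp: NS openin_open_Int)
  ultimately show "\<exists>T. openin (top_of_set (quadric a v d)) T \<and> x \<in> T \<and>
      (\<forall>x\<in>T. \<forall>y\<in>T. sheet_at L a v d x \<longrightarrow> sheet_at L a v d y)"
    by blast
qed (use p q in auto)

text \<open>
  Once the quadric is contained in the leaf, a path in the leaf that starts on the quadric cannot leave it.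
\<close>

lemma umbilical_leaf_is_quadric:
  fixes F :: "('a::euclidean_space \<times> real) set set"
  assumes dim: "DIM('a) \<ge> 2" and fol: "foliation F" and L: "L \<in> F" and umb: "totally_umbilical L"
  obtains a v d where "unit_quad a v d" "L = quadric a v d"
proof -
  have LH: "L \<subseteq> half_space" and pc: "path_connected L" and "L \<noteq> {}"
    using fol L unfolding foliation_def partition_on_def by auto
  then obtain p where p: "p \<in> L" by blast
  obtain U f where f: "local_equation L p U f"
    using umb p unfolding totally_umbilical_def hypersurface_def by blast
  obtain a v d V where V: "unit_quad a v d" "open V" "p \<in> V" "V \<subseteq> U"
    "\<And>q. q \<in> V \<Longrightarrow> f q = 0 \<longleftrightarrow> quad a v d q = 0"
    using totally_umbilical_locally_quadric[OF dim umb f] by blast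
  have fp: "f p = 0" by (rule local_equation_zero[OF f])
  have pS: "p \<in> quadric a v d" using p LH V(5)[OF V(3)] fp by (auto simp: quadric_def)
  have sp: "sheet_at L a v d p"
    unfolding sheet_at_def using V local_equation_subset[OF f] fp by blast
  note sheet = quadric_subset_leaf[OF dim fol L umb V(1) pS sp]
  then have SL: "quadric a v d \<subseteq> L" unfolding sheet_at_def quadric_def by blast
  have "quad a v d y = 0" if y: "y \<in> L" for y
  proof -
    obtain g where g: "path g" "path_image g \<subseteq> L" "pathstart g = p" "pathfinish g = y"
      using pc p y unfolding path_connected_def by blast
    have gL: "g t \<in> L" if "t \<in> {0..1}" for t using g(2) that by (auto simp: path_image_def)
    have gc: "continuous_on {0..1} g" using g(1) by (simp add: path_def)
    have "quad a v d (g 1) = 0"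
    proof (rule connected_induction_simple[of "{0..1::real}" 0 1 "\<lambda>t. quad a v d (g t) = 0"])
      show "quad a v d (g 0) = 0" using g(3) pS by (simp add: pathstart_def quadric_def)
      fix t :: real assume t: "t \<in> {0..1}"
      show "\<exists>T. openin (top_of_set {0..1}) T \<and> t \<in> T \<and>
          (\<forall>x\<in>T. \<forall>y\<in>T. quad a v d (g x) = 0 \<longrightarrow> quad a v d (g y) = 0)"
      proof (cases "quad a v d (g t) = 0")
        case False
        have "continuous_on {0..1} (\<lambda>t. quad a v d (g t))"
          unfolding quad_def by (intro continuous_intros gc)
        then have "openin (top_of_set {0..1}) ({0..1} \<inter> (\<lambda>t. quad a v d (g t)) -` (- {0}))"
          by (rule continuous_openin_preimage_gen) auto
        then show ?thesis using False t by (intro exI conjI) auto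
      next
        case True
        then have gS: "g t \<in> quadric a v d" using gL[OF t] LH by (auto simp: quadric_def)
        obtain U' f' where f': "local_equation L (g t) U' f'"
          using umb gL[OF t] unfolding totally_umbilical_def hypersurface_def by blast
        obtain a' v' d' V' where V': "unit_quad a' v' d'" "open V'" "g t \<in> V'" "V' \<subseteq> U'"
          "\<And>q. q \<in> V' \<Longrightarrow> f' q = 0 \<longleftrightarrow> quad a' v' d' q = 0"
          using totally_umbilical_locally_quadric[OF dim umb f'] by blast
        have eq: "quad a v d y = 0 \<longleftrightarrow> quad a' v' d' y = 0" for y
          using sheet_at_determines_quad[OF f' V(1) V'(1) sheet[OF gS] V'(2,3,4,5)] .
        have "openin (top_of_set {0..1}) ({0..1} \<inter> g -` V')"
          using gc V'(2) by (rule continuous_openin_preimage_gen)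
        then obtain e where e: "e > 0" "ball t e \<inter> {0..1} \<subseteq> g -` V'"
          unfolding openin_contains_ball using t V'(3) by blast
        let ?T = "ball t e \<inter> {0..1}"
        have "quad a v d (g s) = 0" if s: "s \<in> ?T" for s
        proof -
          have 1: "path_connected (g ` ?T)"
            by (intro path_connected_continuous_image convex_imp_path_connected convex_Int continuous_on_subset[OF gc]) auto
          have 2: "g ` ?T \<subseteq> L \<inter> U'" using e gL V'(4) by blast
          have 3: "g t \<in> g ` ?T" using t e by auto
          have "f' (g s) = 0"
            by (rule path_connected_subset_local_equation[OF f' 1 2 3 local_equation_zero[OF f']]) (use s in blast)
          then show ?thesis using eq V'(5) e s by blast
        qed
        then show ?thesis
          using t e(1) by (intro exI[of _ "{0..1} \<inter> ball t e"]) (auto simp: openin_open_Int)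
      qed
    qed auto
    then show ?thesis using g(4) by (simp add: pathfinish_def)
  qed
  then have "L = quadric a v d" using SL LH by (auto simp: quadric_def)
  then show ?thesis using that V(1) by blast
qed

lemma totally_umbilical_foliation_leaf_is_quadric:
  fixes F :: "('a::euclidean_space \<times> real) set set"
  assumes "totally_umbilical_foliation F" "L \<in> F"
  obtains a v d where "unit_quad a v d" "L = quadric a v d"
proof (cases "DIM('a \<times> real) = 2")
  case True
  then have "generalized_hypersphere L" using assms by (simp add: totally_umbilical_foliation_def)
  then show ?thesis using generalized_hypersphere_imp_quadric that by metis
next
  case False
  then have "DIM('a) \<noteq> 1" by simp
  then have "DIM('a) \<ge> 2" using DIM_positive[where 'a = 'a] by linarith
  moreover have "foliation F" "totally_umbilical L"
    using False assms by (auto simp: totally_umbilical_foliation_def)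
  ultimately show ?thesis using umbilical_leaf_is_quadric[of F L] assms(2) that by metis
qed


section \<open>Geodesic lines and their orthogonal hyperspheres\<close>

definition cosh_dist :: "'a::euclidean_space \<times> real \<Rightarrow> 'a \<times> real \<Rightarrow> real" where
  "cosh_dist p q = 1 + ((p - q) \<bullet> (p - q)) / (2 * snd p * snd q)"

lemma cosh_dist_ge_1: "p \<in> half_space \<Longrightarrow> q \<in> half_space \<Longrightarrow> cosh_dist p q \<ge> 1"
  by (simp add: cosh_dist_def half_space_def)

lemma cosh_dist_eq_1_iff: "p \<in> half_space \<Longrightarrow> q \<in> half_space \<Longrightarrow> cosh_dist p q = 1 \<longleftrightarrow> p = q"
  by (simp add: cosh_dist_def half_space_def)

lemma cosh_dist_has_derivative:
  assumes \<gamma>: "(\<gamma> has_vector_derivative w) (at t)" and H: "\<gamma> t \<in> half_space" "q \<in> half_space"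
  shows "((\<lambda>s. cosh_dist (\<gamma> s) q) has_real_derivative
     ((\<gamma> t - q) \<bullet> w) / (snd (\<gamma> t) * snd q)
       - ((\<gamma> t - q) \<bullet> (\<gamma> t - q)) * snd w / (2 * (snd (\<gamma> t))\<^sup>2 * snd q)) (at t)"
proof -
  have y: "snd (\<gamma> t) > 0" "snd q > 0" using H by (auto simp: half_space_def)
  have g: "(\<gamma> has_derivative (\<lambda>h. h *\<^sub>R w)) (at t)" using \<gamma> by (simp add: has_vector_derivative_def)
  have "((\<lambda>s. (\<gamma> s - q) \<bullet> (\<gamma> s - q)) has_derivative (\<lambda>h. h * (2 * ((\<gamma> t - q) \<bullet> w)))) (at t)"
    by (auto intro!: derivative_eq_intros g simp: inner_commute algebra_simps)
  then have 1: "((\<lambda>s. (\<gamma> s - q) \<bullet> (\<gamma> s - q)) has_real_derivative 2 * ((\<gamma> t - q) \<bullet> w)) (at t)"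
    by (simp add: has_field_derivative_def mult_commute_abs)
  have "((\<lambda>s. snd (\<gamma> s)) has_derivative (\<lambda>h. h * snd w)) (at t)"
    using has_derivative_snd[OF g] by simp
  then have 2: "((\<lambda>s. snd (\<gamma> s)) has_real_derivative snd w) (at t)"
    by (simp add: has_field_derivative_def mult_commute_abs)
  have "((\<lambda>s. 1 + ((\<gamma> s - q) \<bullet> (\<gamma> s - q)) / snd (\<gamma> s) / (2 * snd q)) has_real_derivative
      0 + (2 * ((\<gamma> t - q) \<bullet> w) * snd (\<gamma> t) - ((\<gamma> t - q) \<bullet> (\<gamma> t - q)) * snd w)
        / (snd (\<gamma> t) * snd (\<gamma> t)) / (2 * snd q)) (at t)"
    using y by (intro DERIV_add DERIV_const DERIV_cdivide DERIV_divide 1 2) auto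
  moreover have "1 + ((\<gamma> s - q) \<bullet> (\<gamma> s - q)) / snd (\<gamma> s) / (2 * snd q) = cosh_dist (\<gamma> s) q" for s
    by (simp add: cosh_dist_def mult_ac)
  moreover have "0 + (2 * i * y1 - n * w') / (y1 * y1) / (2 * y2)
      = i / (y1 * y2) - n * w' / (2 * y1\<^sup>2 * y2)" if "y1 > 0" "y2 > 0" for i n w' y1 y2 :: real
    using that by (simp add: field_simps power2_eq_square)
  ultimately show ?thesis using y by (simp only:)
qed

text \<open>
  The generalized hypersphere through \<open>\<gamma> t\<close> that is orthogonal to \<open>\<gamma>\<close> and has mean curvature \<open>\<eta>\<close> for the
  orientation opposite to \<open>\<gamma>\<close>, if \<open>\<bar>\<eta>\<bar> \<le> 1\<close>; for \<open>\<bar>\<eta>\<bar> > 1\<close> it is a geodesic sphere.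
\<close>

definition orthogonal_hypersphere :: "(real \<Rightarrow> 'a::euclidean_space \<times> real) \<Rightarrow> real \<Rightarrow> real \<Rightarrow> ('a \<times> real) set" where
  "orthogonal_hypersphere \<gamma> \<eta> t =
     {q \<in> half_space. \<eta> * (cosh_dist (\<gamma> t) q - 1) + deriv (\<lambda>s. cosh_dist (\<gamma> s) q) t = 0}"

lemma arc_length_curveD:
  assumes "arc_length_curve \<gamma>"
  shows "\<gamma> t \<in> half_space" "(\<gamma> has_vector_derivative velocity \<gamma> t) (at t)"
    "velocity \<gamma> t \<bullet> velocity \<gamma> t = (snd (\<gamma> t))\<^sup>2"
proof -
  show H: "\<gamma> t \<in> half_space" using assms by (auto simp: arc_length_curve_def)
  have "\<gamma> differentiable (at t)"
    using assms unfolding arc_length_curve_def C1_differentiable_on_eq by simp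
  then show "(\<gamma> has_vector_derivative velocity \<gamma> t) (at t)"
    by (simp add: velocity_def vector_derivative_works)
  have "hyp_norm (\<gamma> t) (velocity \<gamma> t) = 1" using assms by (simp add: arc_length_curve_def)
  then have "hyp_inner (\<gamma> t) (velocity \<gamma> t) (velocity \<gamma> t) = 1" by (simp add: hyp_norm_def)
  then show "velocity \<gamma> t \<bullet> velocity \<gamma> t = (snd (\<gamma> t))\<^sup>2"
    using H by (simp add: hyp_inner_def half_space_def field_simps split: if_splits)
qed

text \<open>
  Expanding the quadratic function at \<open>\<gamma> t\<close> and dividing by the height of \<open>q\<close> gives exactly the first
  variation of \<open>cosh_dist\<close> plus a multiple of \<open>cosh_dist - 1\<close>.
\<close>

lemma quadric_eq_orthogonal_hypersphere:
  assumes \<gamma>: "arc_length_curve \<gamma>" and q0: "quad a v d (\<gamma> t) = 0"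
    and m: "quad_grad a v (\<gamma> t) = - (velocity \<gamma> t /\<^sub>R snd (\<gamma> t))"
  shows "quadric a v d = orthogonal_hypersphere \<gamma> (- snd v) t"
proof -
  note A = arc_length_curveD[OF \<gamma>, of t]
  define p w where "p = \<gamma> t" and "w = velocity \<gamma> t"
  have y: "snd p > 0" using A(1) by (simp add: half_space_def p_def)
  have "snd (quad_grad a v p) = - (snd w / snd p)"
    unfolding p_def m by (simp add: w_def divide_inverse mult.commute)
  then have a: "a = (- snd v - snd w / snd p) / (2 * snd p)" using y by (simp add: field_simps)
  have "quad a v d q = snd q * (- snd v * (cosh_dist p q - 1) + deriv (\<lambda>s. cosh_dist (\<gamma> s) q) t)"
    if q: "q \<in> half_space" for q
  proof -
    have yq: "snd q > 0" using q by (simp add: half_space_def)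
    have D: "deriv (\<lambda>s. cosh_dist (\<gamma> s) q) t
        = ((p - q) \<bullet> w) / (snd p * snd q) - ((p - q) \<bullet> (p - q)) * snd w / (2 * (snd p)\<^sup>2 * snd q)"
      using DERIV_imp_deriv[OF cosh_dist_has_derivative[OF A(2) A(1) q]] by (simp add: p_def w_def)
    have "quad a v d q = quad a v d (p + (q - p))" by simp
    also have "\<dots> = - (w /\<^sub>R snd p) \<bullet> (q - p) + a * ((q - p) \<bullet> (q - p))"
      unfolding quad_add using q0 m by (simp add: p_def w_def)
    also have "(q - p) \<bullet> (q - p) = (p - q) \<bullet> (p - q)" by (simp add: inner_diff_left inner_diff_right)
    also have "- (w /\<^sub>R snd p) \<bullet> (q - p) = ((p - q) \<bullet> w) / snd p"
      by (simp add: inner_diff_left inner_diff_right inner_commute divide_inverse algebra_simps)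
    finally have fin: "quad a v d q = ((p - q) \<bullet> w) / snd p + a * ((p - q) \<bullet> (p - q))" .
    have key: "i / y1 + (e - w' / y1) / (2 * y1) * n
        = y2 * (e * (1 + n / (2 * y1 * y2) - 1) + (i / (y1 * y2) - n * w' / (2 * y1\<^sup>2 * y2)))"
      if "y1 > 0" "y2 > 0" for i n w' e y1 y2 :: real
      using that by (simp add: field_simps power2_eq_square)
    show ?thesis
      unfolding D fin unfolding cosh_dist_def
      using key[OF y yq, where i = "(p - q) \<bullet> w" and e = "- snd v" and w' = "snd w"
          and n = "(p - q) \<bullet> (p - q)", folded a] .
  qed
  then show ?thesis by (auto simp: quadric_def orthogonal_hypersphere_def half_space_def p_def)
qed

lemma quadric_through_curve_point:
  fixes \<gamma> :: "real \<Rightarrow> 'a::euclidean_space \<times> real"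
  assumes \<gamma>: "arc_length_curve \<gamma>"
  obtains a v d where "unit_quad a v d" "quad a v d (\<gamma> t) = 0" "snd v = - \<eta>"
    "quad_grad a v (\<gamma> t) = - (velocity \<gamma> t /\<^sub>R snd (\<gamma> t))"
proof -
  note A = arc_length_curveD[OF \<gamma>, of t]
  define p w where "p = \<gamma> t" and "w = velocity \<gamma> t"
  have y: "snd p > 0" using A(1) by (simp add: half_space_def p_def)
  define a where "a = (\<eta> - snd w / snd p) / (2 * snd p)"
  define v where "v = - (w /\<^sub>R snd p) - (2 * a) *\<^sub>R p"
  define d where "d = - (a * (p \<bullet> p) + v \<bullet> p)"
  have q0: "quad a v d p = 0" by (simp add: quad_def d_def)
  have m: "quad_grad a v p = - (w /\<^sub>R snd p)" by (simp add: v_def)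
  have "quad_grad a v p \<bullet> (quad_grad a v p) = v \<bullet> v - 4 * a * d"
    by (simp add: d_def inner_add_left inner_add_right inner_commute algebra_simps)
  moreover have "quad_grad a v p \<bullet> (quad_grad a v p) = 1"
    unfolding m using A(3) y by (simp add: w_def p_def power2_eq_square field_simps)
  ultimately have "unit_quad a v d" by (simp add: unit_quad_def)
  moreover have "snd v = - \<eta>" using y by (simp add: v_def a_def field_simps)
  ultimately show ?thesis using that q0 m by (simp add: p_def w_def)
qed

text \<open>
  Orthogonality makes the unit normal parallel to the velocity.  If it points along \<open>\<gamma>\<close>, the sign of the
  equation is reversed.
\<close>

lemma quadric_eq_if_orthogonal:
  fixes \<gamma> :: "real \<Rightarrow> 'a::euclidean_space \<times> real"
  assumes \<gamma>: "arc_length_curve \<gamma>" and u: "unit_quad a v d" and p: "\<gamma> t \<in> quadric a v d"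
    and orth: "orthogonal_at (quadric a v d) \<gamma> t"
    and mc: "has_mean_curvature (quadric a v d) (\<gamma> t) (- velocity \<gamma> t) \<eta>"
  shows "quadric a v d = orthogonal_hypersphere \<gamma> \<eta> t"
proof -
  note A = arc_length_curveD[OF \<gamma>, of t]
  define w where "w = velocity \<gamma> t"
  have y: "snd (\<gamma> t) > 0" using A(1) by (simp add: half_space_def)
  have q0: "quad a v d (\<gamma> t) = 0" using p by (simp add: quadric_def)
  define m where "m = quad_grad a v (\<gamma> t)"
  have m1: "norm m = 1" using norm_grad_quad[OF u q0] by (simp add: m_def)
  have "w \<bullet> X = 0" if "m \<bullet> X = 0" for X
  proof -
    have "X \<in> tangent_space (quadric a v d) (\<gamma> t)"
      using that by (simp add: tangent_space_quadric[OF u p] m_def)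
    then show ?thesis
      using orth y unfolding orthogonal_at_def by (auto simp: hyp_inner_def w_def inner_commute)
  qed
  from parallel_if_orthogonal_imp_orthogonal[OF m1 this]
  have wm: "w = (m \<bullet> w) *\<^sub>R m" .
  define s where "s = m \<bullet> w"
  have w: "w = s *\<^sub>R m" using wm by (simp add: s_def)
  have "norm w = snd (\<gamma> t)" using A(3) y by (simp add: w_def norm_eq_sqrt_inner)
  then have "\<bar>s\<bar> = snd (\<gamma> t)" using m1 by (simp add: w)
  then have "s = snd (\<gamma> t) \<or> s = - snd (\<gamma> t)" by linarith
  then show ?thesis
  proof
    assume s: "s = - snd (\<gamma> t)"
    have "- velocity \<gamma> t = snd (\<gamma> t) *\<^sub>R m" using w by (simp add: w_def s)
    then have \<eta>: "\<eta> = - snd v"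
      using mc has_mean_curvature_quadric[OF u p] by (simp add: m_def)
    have "quad_grad a v (\<gamma> t) = - (velocity \<gamma> t /\<^sub>R snd (\<gamma> t))"
      using w y by (simp add: w_def[symmetric] m_def[symmetric] s)
    from quadric_eq_orthogonal_hypersphere[OF \<gamma> q0 this] show ?thesis by (simp add: \<eta>)
  next
    assume s: "s = snd (\<gamma> t)"
    have u': "unit_quad (- a) (- v) (- d)" using u by (simp add: unit_quad_uminus)
    have p': "\<gamma> t \<in> quadric (- a) (- v) (- d)" using p by (simp only: quadric_uminus)
    have q0': "quad (- a) (- v) (- d) (\<gamma> t) = 0" using q0 by (simp add: quad_uminus)
    have m': "(2 * - a) *\<^sub>R \<gamma> t + - v = - m" by (simp add: m_def)
    have "- velocity \<gamma> t = snd (\<gamma> t) *\<^sub>R (- m)" using w by (simp add: w_def s)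
    then have \<eta>: "\<eta> = - snd (- v)"
      using mc has_mean_curvature_quadric[OF u' p', unfolded quadric_uminus m'] by simp
    have "(2 * - a) *\<^sub>R \<gamma> t + - v = - (velocity \<gamma> t /\<^sub>R snd (\<gamma> t))"
      unfolding m' using w y by (simp add: w_def[symmetric] s)
    from quadric_eq_orthogonal_hypersphere[OF \<gamma> q0' this] show ?thesis
      unfolding quadric_uminus by (simp add: \<eta>)
  qed
qed

lemma route_leaf_orthogonal_hypersphere:
  fixes \<gamma> :: "real \<Rightarrow> 'a::euclidean_space \<times> real"
  assumes \<gamma>: "arc_length_curve \<gamma>" and h: "\<bar>h t\<bar> \<le> 1"
  shows "route_leaf \<gamma> h t (orthogonal_hypersphere \<gamma> (h t) t)" (is ?route)
    and "totally_umbilical (orthogonal_hypersphere \<gamma> (h t) t)" (is ?umb)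
    and "path_connected (orthogonal_hypersphere \<gamma> (h t) t)" (is ?pc)
proof -
  note A = arc_length_curveD[OF \<gamma>, of t]
  have y: "snd (\<gamma> t) > 0" using A(1) by (simp add: half_space_def)
  obtain a v d where q: "unit_quad a v d" "quad a v d (\<gamma> t) = 0" "snd v = - h t"
    "quad_grad a v (\<gamma> t) = - (velocity \<gamma> t /\<^sub>R snd (\<gamma> t))"
    using quadric_through_curve_point[OF \<gamma>] by blast
  have eq: "orthogonal_hypersphere \<gamma> (h t) t = quadric a v d"
    using quadric_eq_orthogonal_hypersphere[OF \<gamma> q(2,4)] q(3) by simp
  have p: "\<gamma> t \<in> quadric a v d" using q(2) A(1) by (simp add: quadric_def)
  have "hyp_inner (\<gamma> t) X (velocity \<gamma> t) = 0" if "X \<in> tangent_space (quadric a v d) (\<gamma> t)" for X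
    using that y unfolding tangent_space_quadric[OF q(1) p] q(4) by (simp add: hyp_inner_def inner_commute)
  moreover have "snd (\<gamma> t) *\<^sub>R (quad_grad a v (\<gamma> t)) = - velocity \<gamma> t"
    unfolding q(4) using y by simp
  then have "has_mean_curvature (quadric a v d) (\<gamma> t) (- velocity \<gamma> t) (h t)"
    using has_mean_curvature_quadric[OF q(1) p, of "h t"] q(3) by simp
  moreover have "generalized_hypersphere (quadric a v d)"
    using quadric_generalized_hypersphere[OF q(1)] p q(3) h by auto
  ultimately show ?route unfolding eq route_leaf_def orthogonal_at_def using p by blast
  show ?umb unfolding eq by (rule totally_umbilical_quadric[OF q(1)])
  show ?pc unfolding eq by (rule path_connected_quadric[OF q(1)])
qed

definition hyp_isometry ::
    "('a::euclidean_space \<times> real \<Rightarrow> 'a \<times> real) \<Rightarrow> ('a \<times> real \<Rightarrow> 'a \<times> real) \<Rightarrow> bool" where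
  "hyp_isometry T T' \<longleftrightarrow> homeomorphism half_space half_space T T' \<and>
     (\<forall>p\<in>half_space. \<forall>q\<in>half_space. cosh_dist (T p) (T q) = cosh_dist p q)"

lemma hyp_isometry_compose:
  assumes "hyp_isometry T T'" "hyp_isometry S S'"
  shows "hyp_isometry (S \<circ> T) (T' \<circ> S')"
proof -
  have "homeomorphism half_space half_space (S \<circ> T) (T' \<circ> S')"
    using assms homeomorphism_compose unfolding hyp_isometry_def by blast
  moreover have "T p \<in> half_space" if "p \<in> half_space" for p
    using assms(1) that unfolding hyp_isometry_def homeomorphism_def by blast
  ultimately show ?thesis using assms unfolding hyp_isometry_def by simp
qed

lemma hyp_isometry_translation:
  fixes c :: "'a::euclidean_space"
  shows "hyp_isometry (\<lambda>q. q + (c, 0)) (\<lambda>q. q - (c, 0))"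
proof -
  have "homeomorphism half_space half_space (\<lambda>q :: 'a \<times> real. q + (c, 0)) (\<lambda>q. q - (c, 0))"
    by (rule homeomorphismI) (auto simp: half_space_def intro!: continuous_intros)
  then show ?thesis by (simp add: hyp_isometry_def cosh_dist_def)
qed

lemma hyp_isometry_scaling:
  assumes k: "k > 0"
  shows "hyp_isometry (\<lambda>q. k *\<^sub>R q) (\<lambda>q. inverse k *\<^sub>R q)"
proof -
  have "cosh_dist (k *\<^sub>R p) (k *\<^sub>R q) = cosh_dist p q" for p q :: "'a \<times> real"
  proof -
    have "k *\<^sub>R p - k *\<^sub>R q = k *\<^sub>R (p - q)" by (simp add: scaleR_diff_right)
    then have "(k *\<^sub>R p - k *\<^sub>R q) \<bullet> (k *\<^sub>R p - k *\<^sub>R q) = k * k * ((p - q) \<bullet> (p - q))"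
      by simp
    then show ?thesis using k by (simp add: cosh_dist_def field_simps)
  qed
  moreover have "homeomorphism half_space half_space (\<lambda>q :: 'a \<times> real. k *\<^sub>R q) (\<lambda>q. inverse k *\<^sub>R q)"
    by (rule homeomorphismI) (use k in \<open>auto simp: half_space_def intro!: continuous_intros\<close>)
  ultimately show ?thesis unfolding hyp_isometry_def by blast
qed

definition inversion :: "'e::real_inner \<Rightarrow> 'e" where
  "inversion z = z /\<^sub>R (z \<bullet> z)"

lemma inversion_inversion: "z \<noteq> 0 \<Longrightarrow> inversion (inversion z) = z"
  by (simp add: inversion_def)

lemma inversion_dist:
  assumes "p \<noteq> 0" "q \<noteq> 0"
  shows "(inversion p - inversion q) \<bullet> (inversion p - inversion q) = ((p - q) \<bullet> (p - q)) / ((p \<bullet> p) * (q \<bullet> q))"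
  using assms
  by (simp add: inversion_def inner_diff_left inner_diff_right inner_commute field_simps)

lemma hyp_isometry_inversion:
  "hyp_isometry (inversion :: 'a::euclidean_space \<times> real \<Rightarrow> 'a \<times> real) inversion"
proof -
  have nz: "q \<noteq> 0" if "q \<in> half_space" for q :: "'a \<times> real" using that by (auto simp: half_space_def)
  have H: "inversion q \<in> half_space" if "q \<in> half_space" for q :: "'a \<times> real"
  proof -
    have "q \<bullet> q > 0" using nz[OF that] by simp
    then show ?thesis using that by (simp add: half_space_def inversion_def)
  qed
  have c: "continuous_on half_space (inversion :: 'a \<times> real \<Rightarrow> 'a \<times> real)"
    unfolding inversion_def by (intro continuous_intros) (use nz in auto)
  have "homeomorphism half_space half_space (inversion :: 'a \<times> real \<Rightarrow> 'a \<times> real) inversion"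
    by (rule homeomorphismI) (use H c nz in \<open>auto simp: inversion_inversion\<close>)
  moreover have "cosh_dist (inversion p) (inversion q) = cosh_dist p q"
    if pq: "p \<in> half_space" "q \<in> half_space" for p q :: "'a \<times> real"
  proof -
    have "snd p > 0" "snd q > 0" using pq by (auto simp: half_space_def)
    moreover have "p \<bullet> p > 0" "q \<bullet> q > 0" using nz pq by auto
    moreover have "snd (inversion p) = snd p / (p \<bullet> p)" "snd (inversion q) = snd q / (q \<bullet> q)"
      by (auto simp: inversion_def divide_inverse)
    ultimately show ?thesis
      unfolding cosh_dist_def inversion_dist[OF nz[OF pq(1)] nz[OF pq(2)]] by (simp add: field_simps)
  qed
  ultimately show ?thesis unfolding hyp_isometry_def by blast
qed

lemma real_constant_if_derivative_zero:
  fixes f :: "real \<Rightarrow> 'c::real_normed_vector"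
  assumes "\<And>t. (f has_vector_derivative 0) (at t)"
  shows "f t = f 0"
proof -
  obtain c where "\<forall>x\<in>UNIV. f x = c"
    using has_derivative_zero_constant[of UNIV f] assms by (auto simp: has_vector_derivative_def)
  then show ?thesis by simp
qed

text \<open>
  For the height \<open>y\<close> and the horizontal part \<open>x\<close> of a geodesic, the geodesic equation says that \<open>1 / y\<close> solves
  \<open>g'' = g\<close> and that \<open>x' / y\<^sup>2\<close> is a constant \<open>w\<close>; the unit speed condition becomes \<open>w \<bullet> w = 4 \<alpha> \<beta>\<close>.
\<close>

lemma geodesic_ode:
  fixes \<gamma> :: "real \<Rightarrow> 'a::euclidean_space \<times> real"
  assumes \<gamma>: "geodesic_line \<gamma>"
  obtains \<alpha> \<beta> w where "\<And>t. inverse (snd (\<gamma> t)) = \<alpha> * exp t + \<beta> * exp (- t)"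
    "\<And>t. ((\<lambda>s. fst (\<gamma> s)) has_vector_derivative (snd (\<gamma> t))\<^sup>2 *\<^sub>R w) (at t)"
    "w \<bullet> w = 4 * \<alpha> * \<beta>" "\<alpha> \<ge> 0" "\<beta> \<ge> 0"
proof -
  have al: "arc_length_curve \<gamma>" using \<gamma> by (simp add: geodesic_line_def)
  note A = arc_length_curveD[OF al]
  define x y x' y' where "x t = fst (\<gamma> t)" and "y t = snd (\<gamma> t)"
    and "x' t = fst (velocity \<gamma> t)" and "y' t = snd (velocity \<gamma> t)" for t
  have ypos: "y t > 0" for t using A(1)[of t] by (simp add: half_space_def y_def)
  have dx: "(x has_vector_derivative x' t) (at t)" for t
    using A(2)[of t] has_derivative_fst[of \<gamma> "\<lambda>h. h *\<^sub>R velocity \<gamma> t"]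
    unfolding x_def[abs_def] x'_def has_vector_derivative_def by simp
  have dy: "(y has_real_derivative y' t) (at t)" for t
    using A(2)[of t] has_derivative_snd[of \<gamma> "\<lambda>h. h *\<^sub>R velocity \<gamma> t"]
    unfolding y_def[abs_def] y'_def has_vector_derivative_def has_field_derivative_def
    by (simp add: mult_commute_abs)
  have speed: "x' t \<bullet> x' t + (y' t)\<^sup>2 = (y t)\<^sup>2" for t
    using A(3)[of t] by (simp add: x'_def y'_def y_def inner_prod_real power2_eq_square)
  define ac where "ac t = velocity (velocity \<gamma>) t" for t
  have ac: "ac t = (1 / y t) *\<^sub>R ((2 * y' t) *\<^sub>R velocity \<gamma> t - (y t)\<^sup>2 *\<^sub>R (0, 1))" for t
  proof -
    have "ac t = - christoffel (\<gamma> t) (velocity \<gamma> t) (velocity \<gamma> t)"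
      using \<gamma> unfolding geodesic_line_def ac_def by (metis eq_neg_iff_add_eq_0)
    then show ?thesis
      unfolding christoffel_def A(3) by (simp add: y_def y'_def scaleR_diff_right scaleR_2[symmetric] algebra_simps)
  qed
  have dv: "(velocity \<gamma> has_vector_derivative ac t) (at t)" for t
  proof -
    have "velocity \<gamma> differentiable (at t)" using \<gamma> by (simp add: geodesic_line_def)
    then show ?thesis
      unfolding ac_def velocity_def[of "velocity \<gamma>" t] by (simp only: vector_derivative_works)
  qed
  have dx': "(x' has_vector_derivative (2 * y' t / y t) *\<^sub>R x' t) (at t)" for t
  proof -
    have "fst (ac t) = (2 * y' t / y t) *\<^sub>R x' t" unfolding ac by (simp add: x'_def)
    then show ?thesis
      using dv[of t] has_derivative_fst[of "velocity \<gamma>" "\<lambda>h. h *\<^sub>R ac t"]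
      unfolding x'_def[abs_def] has_vector_derivative_def by simp
  qed
  have dy': "(y' has_real_derivative 2 * (y' t)\<^sup>2 / y t - y t) (at t)" for t
  proof -
    have "snd (ac t) = 2 * (y' t)\<^sup>2 / y t - y t"
      unfolding ac using ypos[of t] by (simp add: y'_def power2_eq_square field_simps)
    then show ?thesis
      using dv[of t] has_derivative_snd[of "velocity \<gamma>" "\<lambda>h. h *\<^sub>R ac t"]
      unfolding y'_def[abs_def] has_vector_derivative_def has_field_derivative_def
      by (simp add: mult_commute_abs)
  qed
  define g g' where "g t = inverse (y t)" and "g' t = - y' t / (y t)\<^sup>2" for t
  have dg: "(g has_real_derivative g' t) (at t)" for t
    unfolding g_def[abs_def] g'_def using ypos[of t]
    by (auto intro!: derivative_eq_intros dy simp: power2_eq_square field_simps)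
  have dg': "(g' has_real_derivative g t) (at t)" for t
    unfolding g'_def[abs_def] g_def
    using ypos[of t] by (auto intro!: derivative_eq_intros dy dy' simp: field_simps power2_eq_square)
  define \<alpha> \<beta> where "\<alpha> = (g 0 + g' 0) / 2" and "\<beta> = (g 0 - g' 0) / 2"
  have 1: "(g t + g' t) * exp (- t) = 2 * \<alpha>" for t
  proof -
    have "((\<lambda>t. (g t + g' t) * exp (- t)) has_real_derivative 0) (at t)" for t
      by (auto intro!: derivative_eq_intros dg dg' simp: algebra_simps)
    then have "(g t + g' t) * exp (- t) = (g 0 + g' 0) * exp (- 0)"
      by (intro real_constant_if_derivative_zero) (simp add: has_real_derivative_iff_has_vector_derivative)
    then show ?thesis by (simp add: \<alpha>_def)
  qed
  have 2: "(g t - g' t) * exp t = 2 * \<beta>" for t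
  proof -
    have "((\<lambda>t. (g t - g' t) * exp t) has_real_derivative 0) (at t)" for t
      by (auto intro!: derivative_eq_intros dg dg' simp: algebra_simps)
    then have "(g t - g' t) * exp t = (g 0 - g' 0) * exp 0"
      by (intro real_constant_if_derivative_zero) (simp add: has_real_derivative_iff_has_vector_derivative)
    then show ?thesis by (simp add: \<beta>_def)
  qed
  have p: "g t + g' t = 2 * \<alpha> * exp t" for t
    using 1[of t] by (simp add: exp_minus field_simps)
  have m: "g t - g' t = 2 * \<beta> * exp (- t)" for t
    using 2[of t] by (simp add: exp_minus field_simps)
  have geq: "g t = \<alpha> * exp t + \<beta> * exp (- t)" for t using p[of t] m[of t] by simp
  define w where "w = x' 0 /\<^sub>R (y 0)\<^sup>2"
  have xw: "x' t = (y t)\<^sup>2 *\<^sub>R w" for t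
  proof -
    have d2: "((\<lambda>t. inverse ((y t)\<^sup>2)) has_real_derivative - 2 * y' t / (y t)^3) (at t)" for t
      using ypos[of t]
      by (auto intro!: derivative_eq_intros dy simp: field_simps power2_eq_square power3_eq_cube)
    have "((\<lambda>t. x' t /\<^sub>R (y t)\<^sup>2) has_vector_derivative 0) (at t)" for t
    proof -
      have "((\<lambda>t. inverse ((y t)\<^sup>2) *\<^sub>R x' t) has_vector_derivative
          inverse ((y t)\<^sup>2) *\<^sub>R ((2 * y' t / y t) *\<^sub>R x' t) + (- 2 * y' t / (y t)^3) *\<^sub>R x' t) (at t)"
        by (rule has_vector_derivative_scaleR[OF d2 dx'])
      moreover have "inverse ((y t)\<^sup>2) *\<^sub>R ((2 * y' t / y t) *\<^sub>R x' t) + (- 2 * y' t / (y t)^3) *\<^sub>R x' t = 0"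
        by (simp add: power2_eq_square power3_eq_cube divide_inverse mult_ac)
      ultimately show ?thesis by (simp only:)
    qed
    then have "x' t /\<^sub>R (y t)\<^sup>2 = w"
      unfolding w_def by (rule real_constant_if_derivative_zero)
    then have "(y t)\<^sup>2 *\<^sub>R w = (y t)\<^sup>2 *\<^sub>R (x' t /\<^sub>R (y t)\<^sup>2)" by simp
    then show ?thesis using ypos[of t] by simp
  qed
  have ww: "w \<bullet> w = 4 * \<alpha> * \<beta>"
  proof -
    have "4 * \<alpha> * \<beta> = (g 0)\<^sup>2 - (g' 0)\<^sup>2" by (simp add: \<alpha>_def \<beta>_def power2_eq_square field_simps)
    also have "\<dots> = ((y 0)\<^sup>2 - (y' 0)\<^sup>2) / (y 0) ^ 4"
      using ypos[of 0] by (simp add: g_def g'_def field_simps power2_eq_square power4_eq_xxxx)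
    also have "(y 0)\<^sup>2 - (y' 0)\<^sup>2 = (y 0)^4 * (w \<bullet> w)"
      using speed[of 0] xw[of 0] by (simp add: power2_eq_square power4_eq_xxxx)
    finally show ?thesis using ypos[of 0] by simp
  qed
  have "g 0 > 0" using ypos[of 0] by (simp add: g_def)
  then have gpos: "\<alpha> + \<beta> > 0" using geq[of 0] by simp
  have "4 * \<alpha> * \<beta> \<ge> 0" using ww inner_ge_zero[of w] by simp
  then have ab: "\<alpha> \<ge> 0 \<and> \<beta> \<ge> 0"
    using gpos by (auto simp: zero_le_mult_iff)
  show ?thesis
  proof (rule that[of \<alpha> \<beta> w])
    show "inverse (snd (\<gamma> t)) = \<alpha> * exp t + \<beta> * exp (- t)" for t
      using geq[of t] by (simp add: g_def y_def)
    show "((\<lambda>s. fst (\<gamma> s)) has_vector_derivative (snd (\<gamma> t))\<^sup>2 *\<^sub>R w) (at t)" for t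
      using dx[of t] xw[of t] by (simp add: x_def[abs_def] y_def)
  qed (use ww ab in auto)
qed

text \<open>
  Either \<open>\<alpha> = 0\<close> and the geodesic is already a vertical line travelled upwards, or its forward end point
  is a finite ideal point \<open>(c, 0)\<close>, which an inversion centred there sends to infinity.
\<close>

lemma geodesic_normal_form:
  fixes \<gamma> :: "real \<Rightarrow> 'a::euclidean_space \<times> real"
  assumes \<gamma>: "geodesic_line \<gamma>"
  obtains T T' where "hyp_isometry T T'" "\<And>t. T (\<gamma> t) = (0, exp t)"
proof -
  obtain \<alpha> \<beta> w where g: "\<And>t. inverse (snd (\<gamma> t)) = \<alpha> * exp t + \<beta> * exp (- t)"
    and dx: "\<And>t. ((\<lambda>s. fst (\<gamma> s)) has_vector_derivative (snd (\<gamma> t))\<^sup>2 *\<^sub>R w) (at t)"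
    and ww: "w \<bullet> w = 4 * \<alpha> * \<beta>" and ab: "\<alpha> \<ge> 0" "\<beta> \<ge> 0"
    using geodesic_ode[OF \<gamma>] by blast
  have al: "arc_length_curve \<gamma>" using \<gamma> by (simp add: geodesic_line_def)
  have ypos: "snd (\<gamma> t) > 0" for t using arc_length_curveD(1)[OF al, of t] by (simp add: half_space_def)
  show ?thesis
  proof (cases "\<alpha> = 0")
    case True
    then have w0: "w = 0" using ww by simp
    have "inverse (snd (\<gamma> 0)) > 0" using ypos by simp
    then have b: "\<beta> > 0" unfolding g using True by simp
    define c where "c = fst (\<gamma> 0)"
    have x: "fst (\<gamma> t) = c" for t
      unfolding c_def by (rule real_constant_if_derivative_zero) (use dx w0 in simp)
    have y: "\<beta> * snd (\<gamma> t) = exp t" for t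
      using g[of t] True ypos[of t] b by (simp add: exp_minus field_simps)
    have "hyp_isometry ((\<lambda>q. \<beta> *\<^sub>R q) \<circ> (\<lambda>q. q + (- c, 0))) ((\<lambda>q. q - (- c, 0)) \<circ> (\<lambda>q. inverse \<beta> *\<^sub>R q))"
      by (rule hyp_isometry_compose[OF hyp_isometry_translation hyp_isometry_scaling[OF b]])
    then show ?thesis
      by (rule that) (simp add: prod_eq_iff x y)
  next
    case False
    then have a: "\<alpha> > 0" using ab by simp
    define s where "s t = \<alpha> * (exp t * exp t) + \<beta>" for t
    have s: "s t > 0" for t using a ab by (simp add: s_def add_pos_nonneg)
    have y: "snd (\<gamma> t) = exp t / s t" for t
    proof -
      have "inverse (snd (\<gamma> t)) = s t / exp t" unfolding g s_def by (simp add: exp_minus field_simps)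
      then show ?thesis by (metis inverse_divide inverse_inverse_eq)
    qed
    define c where "c = fst (\<gamma> 0) + (1 / (2 * \<alpha> * s 0)) *\<^sub>R w"
    have x: "fst (\<gamma> t) = c - (1 / (2 * \<alpha> * s t)) *\<^sub>R w" for t
    proof -
      have ds: "((\<lambda>t. 1 / (2 * \<alpha> * s t)) has_real_derivative - (snd (\<gamma> t))\<^sup>2) (at t)" for t
      proof -
        have "(s has_real_derivative 2 * \<alpha> * (exp t * exp t)) (at t)"
          unfolding s_def[abs_def] by (auto intro!: derivative_eq_intros)
        then show ?thesis
          using s[of t] a
          by (auto intro!: derivative_eq_intros simp: y field_simps power2_eq_square)
      qed
      have "((\<lambda>t. fst (\<gamma> t) + (1 / (2 * \<alpha> * s t)) *\<^sub>R w) has_vector_derivative 0) (at t)" for t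
      proof -
        have "((\<lambda>t. fst (\<gamma> t) + (1 / (2 * \<alpha> * s t)) *\<^sub>R w) has_vector_derivative
            (snd (\<gamma> t))\<^sup>2 *\<^sub>R w + ((1 / (2 * \<alpha> * s t)) *\<^sub>R 0 + (- (snd (\<gamma> t))\<^sup>2) *\<^sub>R w)) (at t)"
          by (intro has_vector_derivative_add has_vector_derivative_scaleR dx ds has_vector_derivative_const)
        then show ?thesis by simp
      qed
      from real_constant_if_derivative_zero[OF this, of t]
      show ?thesis by (simp add: c_def algebra_simps)
    qed
    define T where "T = (\<lambda>q. inverse \<alpha> *\<^sub>R q) \<circ> (\<lambda>q. q + ((1/2) *\<^sub>R w, 0)) \<circ> inversion \<circ> (\<lambda>q. q + (- c, 0 :: real))"
    have ia: "inverse \<alpha> > 0" using a by simp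
    have iso: "\<exists>T'. hyp_isometry T T'"
      using hyp_isometry_compose[OF hyp_isometry_compose[OF hyp_isometry_compose[OF
            hyp_isometry_translation[of "- c"] hyp_isometry_inversion]
            hyp_isometry_translation[of "(1/2) *\<^sub>R w"]] hyp_isometry_scaling[OF ia]]
      unfolding T_def comp_assoc by blast
    have "T (\<gamma> t) = (0, exp t)" for t
    proof -
      define z where "z = \<gamma> t + (- c, 0)"
      have z: "z = (- (1 / (2 * \<alpha> * s t)) *\<^sub>R w, exp t / s t)"
        using x[of t] y[of t] by (simp add: z_def prod_eq_iff)
      have "z \<bullet> z = (w \<bullet> w) / (2 * \<alpha> * s t)\<^sup>2 + (exp t * exp t) / (s t)\<^sup>2"
        unfolding z by (simp add: inner_prod_real power2_eq_square)
      also have "\<dots> = (\<alpha> * (exp t * exp t) + \<beta>) / (\<alpha> * (s t)\<^sup>2)"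
        unfolding ww using a s[of t] by (simp add: field_simps power2_eq_square)
      also have "\<dots> = 1 / (\<alpha> * s t)"
        using a s[of t] by (simp add: s_def[symmetric] power2_eq_square)
      finally have zz: "z \<bullet> z = 1 / (\<alpha> * s t)" .
      have "inversion z = (\<alpha> * s t) *\<^sub>R z" unfolding inversion_def zz by simp
      also have "\<dots> = (- (1/2) *\<^sub>R w, \<alpha> * exp t)"
        unfolding z using a s[of t] by simp
      finally have iz: "inversion z = (- (1/2) *\<^sub>R w, \<alpha> * exp t)" .
      have "T (\<gamma> t) = inverse \<alpha> *\<^sub>R (inversion z + ((1/2) *\<^sub>R w, 0))" by (simp add: T_def z_def)
      also have "\<dots> = (0, exp t)" unfolding iz using a by simp
      finally show ?thesis .
    qed
    then show ?thesis using that iso by blast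
  qed
qed

lemma cosh_dist_vertical:
  assumes "q \<in> half_space"
  shows "cosh_dist (0, exp t) q = 1 / (2 * snd q) * exp t + (q \<bullet> q) / (2 * snd q) * exp (- t)"
proof -
  have y: "snd q > 0" using assms by (simp add: half_space_def)
  have "((0, exp t) - q) \<bullet> ((0, exp t) - q) = q \<bullet> q - 2 * snd q * exp t + exp t * exp t"
    by (simp add: inner_prod_real algebra_simps)
  then show ?thesis
    using y by (simp add: cosh_dist_def exp_minus field_simps)
qed


section \<open>Coordinates adapted to a geodesic line\<close>

lemma isCont_eventually_nhds:
  assumes "isCont g t" "open V" "g t \<in> V"
  shows "\<forall>\<^sub>F s in nhds t. g s \<in> V"
  using assms topological_tendstoD unfolding isCont_def tendsto_at_iff_tendsto_nhds by blast

lemma differentiable_transform_open: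
  assumes "f differentiable (at x)" "open S" "x \<in> S" "\<And>y. y \<in> S \<Longrightarrow> f y = g y"
  shows "g differentiable (at x)"
proof -
  obtain D where D: "(f has_derivative D) (at x)" using assms(1) unfolding differentiable_def by blast
  show ?thesis
    by (rule differentiableI, rule has_derivative_transform_within_open[OF D assms(2,3)]) (rule assms(4))
qed

text \<open>
  A geodesic line with an isometry \<open>T\<close> onto the vertical line.  Only distances are transported by \<open>T\<close>;
  curvatures and foliations stay where they are.
\<close>

locale geodesic_frame =
  fixes \<gamma> :: "real \<Rightarrow> 'a::euclidean_space \<times> real" and T T' :: "'a \<times> real \<Rightarrow> 'a \<times> real"
  assumes geodesic: "geodesic_line \<gamma>"
    and isometry: "hyp_isometry T T'"
    and T_\<gamma>: "T (\<gamma> t) = (0, exp t)"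
begin

text \<open>
  \<open>A\<close> and \<open>B\<close> are the exponentials of the Busemann functions of the two ends of \<open>\<gamma>\<close>, up to a factor 2:
  \<open>cosh_dist (\<gamma> t) q = A q * exp t + B q * exp (- t)\<close>.
\<close>

definition A :: "'a \<times> real \<Rightarrow> real" where "A q = 1 / (2 * snd (T q))"

definition B :: "'a \<times> real \<Rightarrow> real" where "B q = (T q \<bullet> T q) / (2 * snd (T q))"

text \<open>
  \<open>\<eta> (C - 1) + C'\<close> for \<open>C = cosh_dist (\<gamma> t) q\<close>; its sign tells on which side of the hypersphere \<open>q\<close> lies.
\<close>

definition defect :: "real \<Rightarrow> real \<Rightarrow> 'a \<times> real \<Rightarrow> real" where
  "defect \<eta> t q = \<eta> * (A q * exp t + B q * exp (- t) - 1) + (A q * exp t - B q * exp (- t))"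

lemma arc_length: "arc_length_curve \<gamma>"
  using geodesic by (simp add: geodesic_line_def)

lemma \<gamma>_half_space: "\<gamma> t \<in> half_space"
  by (rule arc_length_curveD(1)[OF arc_length])

lemma T_half_space: "q \<in> half_space \<Longrightarrow> T q \<in> half_space"
  using isometry unfolding hyp_isometry_def homeomorphism_def by blast

lemma T'_half_space: "q \<in> half_space \<Longrightarrow> T' q \<in> half_space"
  using isometry unfolding hyp_isometry_def homeomorphism_def by blast

lemma T_T': "q \<in> half_space \<Longrightarrow> T (T' q) = q"
  using isometry unfolding hyp_isometry_def homeomorphism_def by blast

lemma T'_T: "q \<in> half_space \<Longrightarrow> T' (T q) = q"
  using isometry unfolding hyp_isometry_def homeomorphism_def by blast

lemma A_pos: "q \<in> half_space \<Longrightarrow> A q > 0"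
  using T_half_space[of q] by (simp add: A_def half_space_def)

lemma B_pos: "q \<in> half_space \<Longrightarrow> B q > 0"
proof -
  assume "q \<in> half_space"
  then have "snd (T q) > 0" using T_half_space[of q] by (simp add: half_space_def)
  moreover from this have "T q \<bullet> T q > 0" by (auto simp: zero_prod_def)
  ultimately show ?thesis by (simp add: B_def)
qed

text \<open>
  The vector \<open>fst (T q) /\<^sub>R snd (T q)\<close> completes \<open>A\<close> and \<open>B\<close> to coordinates of the hyperboloid model.
\<close>

lemma AB_eq: "q \<in> half_space \<Longrightarrow> 4 * (A q * B q) = 1 + (norm (fst (T q) /\<^sub>R snd (T q)))\<^sup>2"
  using T_half_space[of q]
  by (simp add: A_def B_def half_space_def inner_prod_real power_mult_distrib dot_square_norm power2_eq_square field_simps)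

lemma cosh_dist_\<gamma>: "q \<in> half_space \<Longrightarrow> cosh_dist (\<gamma> t) q = A q * exp t + B q * exp (- t)"
proof -
  assume q: "q \<in> half_space"
  have "cosh_dist (\<gamma> t) q = cosh_dist (T (\<gamma> t)) (T q)"
    using isometry \<gamma>_half_space q unfolding hyp_isometry_def by simp
  then show ?thesis
    unfolding T_\<gamma> cosh_dist_vertical[OF T_half_space[OF q]] by (simp add: A_def B_def)
qed

lemma A_\<gamma>: "A (\<gamma> s) = exp (- s) / 2"
  by (simp add: A_def T_\<gamma> exp_minus field_simps)

lemma B_\<gamma>: "B (\<gamma> s) = exp s / 2"
  by (simp add: B_def T_\<gamma> inner_prod_real)

lemma AB_surj:
  assumes "a > 0" "b > 0" "4 * (a * b) \<ge> 1"
  obtains q where "q \<in> half_space" "A q = a" "B q = b"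
proof -
  obtain e :: 'a where "e \<in> Basis" using nonempty_Basis by blast
  then have e: "e \<bullet> e = 1" by simp
  define x where "x = sqrt ((4 * (a * b) - 1) / (4 * a * a)) *\<^sub>R e"
  have xx: "x \<bullet> x = (4 * (a * b) - 1) / (4 * a * a)"
    using assms e by (simp add: x_def)
  let ?z = "(x, 1 / (2 * a))"
  have z: "?z \<in> half_space" using assms by (simp add: half_space_def)
  have "A (T' ?z) = a" using T_T'[OF z] by (simp add: A_def)
  moreover have "B (T' ?z) = b"
    using T_T'[OF z] assms by (simp add: B_def inner_prod_real xx field_simps)
  ultimately show ?thesis using that T'_half_space[OF z] by blast
qed

lemma cosh_dist_differentiable:
  assumes "p \<in> half_space" "q \<in> half_space"
  shows "cosh_dist p differentiable (at q)"
proof -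
  have "(\<lambda>q. 1 + ((p - q) \<bullet> (p - q)) * inverse (2 * snd p * snd q)) differentiable (at q)"
    by (intro differentiable_add differentiable_mult differentiable_inner differentiable_diff differentiable_inverse
         differentiable_const differentiable_ident bounded_linear_imp_differentiable bounded_linear_snd)
       (use assms in \<open>auto simp: half_space_def\<close>)
  then show ?thesis by (simp only: cosh_dist_def[abs_def] divide_inverse)
qed

lemma AB_differentiable:
  assumes q: "q \<in> half_space"
  shows "A differentiable (at q)" "B differentiable (at q)"
proof -
  define k where "k = exp 1 - exp (- 1 :: real)"
  have k: "k > 0" by (simp add: k_def)
  have Aeq: "A x = (cosh_dist (\<gamma> 1) x - exp (- 1) * cosh_dist (\<gamma> 0) x) * inverse k"
    and Beq: "B x = (exp 1 * cosh_dist (\<gamma> 0) x - cosh_dist (\<gamma> 1) x) * inverse k" if "x \<in> half_space" for x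
    using k unfolding cosh_dist_\<gamma>[OF that] by (auto simp: k_def field_simps)
  note cd = cosh_dist_differentiable[OF \<gamma>_half_space q]
  have "(\<lambda>x. (cosh_dist (\<gamma> 1) x - exp (- 1) * cosh_dist (\<gamma> 0) x) * inverse k) differentiable (at q)"
    by (intro differentiable_mult differentiable_diff cd differentiable_const)
  then show "A differentiable (at q)"
    by (rule differentiable_transform_open[OF _ open_half_space q]) (simp only: Aeq)
  have "(\<lambda>x. (exp 1 * cosh_dist (\<gamma> 0) x - cosh_dist (\<gamma> 1) x) * inverse k) differentiable (at q)"
    by (intro differentiable_mult differentiable_diff cd differentiable_const)
  then show "B differentiable (at q)"
    by (rule differentiable_transform_open[OF _ open_half_space q]) (simp only: Beq)
qed

lemma continuous_on_defect: "S \<subseteq> half_space \<Longrightarrow> continuous_on S (defect \<eta> t)"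
proof -
  assume S: "S \<subseteq> half_space"
  have "continuous_on S A" "continuous_on S B"
    using AB_differentiable S
    by (auto intro!: continuous_at_imp_continuous_on differentiable_imp_continuous_within)
  then show ?thesis unfolding defect_def[abs_def] by (intro continuous_intros)
qed

lemma orthogonal_hypersphere_eq: "orthogonal_hypersphere \<gamma> \<eta> t = {q \<in> half_space. defect \<eta> t q = 0}"
proof -
  have "deriv (\<lambda>s. cosh_dist (\<gamma> s) q) t = A q * exp t - B q * exp (- t)" if q: "q \<in> half_space" for q
    unfolding cosh_dist_\<gamma>[OF q] by (rule DERIV_imp_deriv) (auto intro!: derivative_eq_intros)
  then show ?thesis
    unfolding orthogonal_hypersphere_def defect_def by (auto simp: cosh_dist_\<gamma>)
qed

text \<open>
  The second factor locates the other intersection of the hypersphere with \<open>\<gamma>\<close>, which exists only for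
  \<open>\<bar>\<eta>\<bar> > 1\<close>.
\<close>

lemma defect_\<gamma>:
  "defect \<eta> t (\<gamma> s) * (2 * exp (t - s)) = (exp (t - s) - 1) * (exp (t - s) * (\<eta> + 1) - (\<eta> - 1))"
proof -
  define x where "x = exp (t - s)"
  have x: "x > 0" by (simp add: x_def)
  have 1: "A (\<gamma> s) * exp t = x / 2" by (simp add: A_\<gamma> x_def exp_diff exp_minus field_simps)
  have 2: "B (\<gamma> s) * exp (- t) = inverse x / 2" by (simp add: B_\<gamma> x_def exp_diff exp_minus field_simps)
  have xi: "x * inverse x = 1" using x by simp
  have "(\<eta> * (x / 2 + inverse x / 2 - 1) + (x / 2 - inverse x / 2)) * (2 * x)
      = \<eta> * (x * x + x * inverse x - 2 * x) + (x * x - x * inverse x)"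
    by (simp only: distrib_left distrib_right left_diff_distrib right_diff_distrib) simp
  also have "\<dots> = (x - 1) * (x * (\<eta> + 1) - (\<eta> - 1))"
    unfolding xi by (simp add: algebra_simps)
  finally show ?thesis unfolding defect_def 1 2 x_def[symmetric] .
qed

lemma \<gamma>_in_leaf: "\<gamma> t \<in> orthogonal_hypersphere \<gamma> \<eta> t"
proof -
  have "defect \<eta> t (\<gamma> t) = 0" using defect_\<gamma>[of \<eta> t t] by simp
  then show ?thesis unfolding orthogonal_hypersphere_eq using \<gamma>_half_space[of t] by blast
qed

lemma \<gamma>_in_leaf_imp_eq:
  assumes "\<bar>\<eta>\<bar> \<le> 1" "\<gamma> s \<in> orthogonal_hypersphere \<gamma> \<eta> t"
  shows "s = t"
proof (rule ccontr)
  assume "s \<noteq> t"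
  then have x: "exp (t - s) \<noteq> 1" by simp
  have "defect \<eta> t (\<gamma> s) = 0" using assms(2) by (simp add: orthogonal_hypersphere_eq)
  then have "exp (t - s) * (\<eta> + 1) = \<eta> - 1" using defect_\<gamma>[of \<eta> t s] x by auto
  moreover have "exp (t - s) * (\<eta> + 1) \<ge> 0" using assms(1) by auto
  ultimately have "\<eta> = 1" using assms(1) by auto
  then show False using \<open>exp (t - s) * (\<eta> + 1) = \<eta> - 1\<close> by simp
qed

lemma connected_leaf_meets:
  assumes "connected S" "S \<subseteq> half_space" "p \<in> S" "q \<in> S" "defect \<eta> t p < 0" "defect \<eta> t q > 0"
  shows "S \<inter> orthogonal_hypersphere \<gamma> \<eta> t \<noteq> {}"
proof -
  have "connected (defect \<eta> t ` S)"
    by (rule connected_continuous_image[OF continuous_on_defect[OF assms(2)] assms(1)])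
  then have "0 \<in> defect \<eta> t ` S"
    by (rule connectedD_interval[of _ "defect \<eta> t p" "defect \<eta> t q"]) (use assms in auto)
  then show ?thesis using assms(2) unfolding orthogonal_hypersphere_eq by auto
qed

end

section \<open>Necessity of the differential inequality\<close>

locale orthogonal_leaf_family = geodesic_frame +
  fixes h :: "real \<Rightarrow> real" and F :: "('a \<times> real) set set"
  assumes fol: "foliation F" and leaf: "orthogonal_hypersphere \<gamma> (h t) t \<in> F"
begin

abbreviation "E t \<equiv> orthogonal_hypersphere \<gamma> (h t) t"

lemma leaf_eq: "q \<in> E s \<Longrightarrow> q \<in> E t \<Longrightarrow> E s = E t"
  using fol leaf unfolding foliation_def partition_on_def disjoint_def by blast

lemma leaf_connected: "connected (E t)"
  using fol leaf path_connected_imp_connected unfolding foliation_def by blast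

lemma leaf_half_space: "E t \<subseteq> half_space"
  by (auto simp: orthogonal_hypersphere_eq)

lemma leaf_other_point:
  assumes "\<gamma> s \<in> E t" "s \<noteq> t"
  shows "exp (t - s) * (h t + 1) = h t - 1"
proof -
  have x: "exp (t - s) \<noteq> 1" using assms(2) by simp
  have "defect (h t) t (\<gamma> s) = 0" using assms(1) by (simp add: orthogonal_hypersphere_eq)
  then show ?thesis using defect_\<gamma>[of "h t" t s] x by auto
qed

text \<open>
  A leaf that crosses \<open>\<gamma>\<close> at \<open>a\<close> and \<open>b\<close> has \<open>h a > 1\<close> and \<open>h b < - 1\<close>.  At an intermediate \<open>c\<close> with \<open>h c = 0\<close> the leaf
  is totally geodesic and unbounded, but starts inside the ball bounded by the first leaf, so it meets that leaf.
\<close>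

lemma no_compact_leaf_ordered:
  assumes cont: "continuous_on UNIV h" and ab: "a < b" and E: "E a = E b"
  shows False
proof -
  have 1: "exp (a - b) * (h a + 1) = h a - 1"
    by (rule leaf_other_point) (use \<gamma>_in_leaf[of b "h b"] E ab in auto)
  have 2: "exp (b - a) * (h b + 1) = h b - 1"
    by (rule leaf_other_point) (use \<gamma>_in_leaf[of a "h a"] E ab in auto)
  have ha: "h a > 1"
  proof -
    define e where "e = exp (a - b)"
    have e: "0 < e" "e < 1" using ab by (auto simp: e_def)
    have "(1 - e) * (h a - 1) = 2 * e" using 1 by (simp add: e_def algebra_simps)
    then have "(1 - e) * (h a - 1) > 0" using e by simp
    then show ?thesis using e by (simp add: zero_less_mult_iff)
  qed
  have hb: "h b < - 1"
  proof -
    define e where "e = exp (b - a)"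
    have e: "e > 1" using ab by (simp add: e_def)
    have "(e - 1) * (h b + 1) = - 2" using 2 by (simp add: e_def algebra_simps)
    then have "(e - 1) * (h b + 1) < 0" by simp
    then show ?thesis using e by (simp add: mult_less_0_iff)
  qed
  obtain c where c: "a \<le> c" "c \<le> b" "h c = 0"
    using IVT2'[of h b 0 a] ha hb ab continuous_on_subset[OF cont] by auto
  have "c \<noteq> a" "c \<noteq> b" using c ha hb by auto
  then have ac: "a < c" "c < b" using c by auto
  have neg: "defect (h a) a (\<gamma> c) < 0"
  proof -
    have x1: "exp (a - c) - 1 < 0" using ac by simp
    have "exp (a - b) * (h a + 1) < exp (a - c) * (h a + 1)" using ac ha by simp
    then have "exp (a - c) * (h a + 1) - (h a - 1) > 0" using 1 by simp
    then have "defect (h a) a (\<gamma> c) * (2 * exp (a - c)) < 0"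
      unfolding defect_\<gamma> using x1 by (simp add: mult_neg_pos)
    then show ?thesis by (simp add: mult_less_0_iff)
  qed
  \<comment> \<open>The size of \<open>K\<close> makes the point \<open>q\<close> of the leaf at \<open>c\<close> lie outside the ball.\<close>
  define K where "K = h a / (h a - 1) + 1"
  have K: "K > 1" using ha by (simp add: K_def)
  have "1 * 1 \<le> K * K" using K by (intro mult_mono) auto
  moreover have "(K * exp (- c)) * (K * exp c) = K * K" by (simp add: exp_minus field_simps)
  ultimately have "4 * ((K * exp (- c)) * (K * exp c)) \<ge> 1" by linarith
  then obtain q where q: "q \<in> half_space" "A q = K * exp (- c)" "B q = K * exp c"
    using AB_surj[of "K * exp (- c)" "K * exp c"] K by auto
  have qc: "q \<in> E c" using q c(3) by (simp add: orthogonal_hypersphere_eq defect_def exp_minus)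
  have pos: "defect (h a) a q > 0"
  proof -
    define x where "x = exp (c - a)"
    have x: "x > 1" using ac by (simp add: x_def)
    have 1: "A q * exp a = K / x" by (simp add: q x_def exp_diff exp_minus field_simps)
    have 2: "B q * exp (- a) = K * x" by (simp add: q x_def exp_diff exp_minus field_simps)
    have "(h a - 1) * K = h a + (h a - 1)" using ha by (simp add: K_def field_simps)
    moreover have "((h a - 1) * K) * 1 \<le> ((h a - 1) * K) * x"
      using x ha K by (intro mult_left_mono) auto
    moreover have "(h a - 1) * (K * x) = ((h a - 1) * K) * x" by (simp only: mult.assoc)
    ultimately have "(h a - 1) * (K * x) \<ge> h a + (h a - 1)" by (simp only: mult_1_right)
    moreover have "(h a + 1) * (K / x) > 0" using ha K x by simp
    moreover have "defect (h a) a q = (h a + 1) * (K / x) + (h a - 1) * (K * x) - h a"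
      unfolding defect_def 1 2 by (simp add: algebra_simps)
    ultimately show ?thesis using ha by linarith
  qed
  obtain z where z: "z \<in> E c" "z \<in> E a"
    using connected_leaf_meets[OF leaf_connected[of c] leaf_half_space \<gamma>_in_leaf qc neg pos] by blast
  then have "E c = E a" using leaf_eq by blast
  then have "\<gamma> c \<in> E a" using \<gamma>_in_leaf by blast
  then show False using neg by (simp add: orthogonal_hypersphere_eq)
qed

lemma curvature_le_1:
  assumes cont: "continuous_on UNIV h"
  shows "\<bar>h t\<bar> \<le> 1"
proof (rule ccontr)
  assume "\<not> \<bar>h t\<bar> \<le> 1"
  then consider "h t > 1" | "h t < - 1" by linarith
  then have x: "(h t - 1) / (h t + 1) > 0" "h t + 1 \<noteq> 0"
    by (cases; auto simp: zero_less_divide_iff)+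
  define s where "s = t - ln ((h t - 1) / (h t + 1))"
  have e: "exp (t - s) = (h t - 1) / (h t + 1)" using x by (simp add: s_def)
  have st: "s \<noteq> t"
  proof
    assume "s = t"
    then have "(h t - 1) / (h t + 1) = 1" using e by simp
    then show False using x by (simp add: field_simps)
  qed
  have "exp (t - s) * (h t + 1) = h t - 1" unfolding e using x by simp
  then have "defect (h t) t (\<gamma> s) * (2 * exp (t - s)) = 0"
    by (simp only: defect_\<gamma> diff_self mult_zero_right)
  then have "\<gamma> s \<in> E t" using \<gamma>_half_space by (simp add: orthogonal_hypersphere_eq)
  then have "E s = E t" using leaf_eq \<gamma>_in_leaf by blast
  then show False
    using no_compact_leaf_ordered[OF cont, of s t] no_compact_leaf_ordered[OF cont, of t s] st
    by (metis linorder_neq_iff)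
qed

lemma defect_has_derivative:
  assumes "(h has_real_derivative h') (at t)"
  shows "((\<lambda>t. defect (h t) t q) has_real_derivative
     h' * (A q * exp t + B q * exp (- t) - 1) + h t * (A q * exp t - B q * exp (- t))
       + (A q * exp t + B q * exp (- t))) (at t)"
  unfolding defect_def by (auto intro!: derivative_eq_intros assms simp: algebra_simps)

text \<open>
  On \<open>E t\<close> the derivative of the defect in \<open>t\<close> equals \<open>1 - k (C - 1)\<close> with \<open>k = h\<^sup>2 - 1 - h'\<close>.  If \<open>k > 0\<close>, this is
  negative at points with \<open>C - 1 = 2 / k\<close>, which exist because \<open>\<bar>h\<bar> \<le> 1\<close>, and positive at \<open>\<gamma> t\<close>; so the next leaves
  meet \<open>E t\<close>.
\<close>

lemma curvature_derivative_ge: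
  assumes diff: "\<And>t. h differentiable (at t)"
  shows "deriv h t \<ge> (h t)\<^sup>2 - 1"
proof (rule ccontr)
  assume "\<not> deriv h t \<ge> (h t)\<^sup>2 - 1"
  then have k: "(h t)\<^sup>2 - 1 - deriv h t > 0" by simp
  define k where "k = (h t)\<^sup>2 - 1 - deriv h t"
  define D where "D = 2 / k"
  have kp: "k > 0" and Dp: "D > 0" using k by (auto simp: k_def D_def)
  have cont: "continuous_on UNIV h"
    using diff by (intro continuous_at_imp_continuous_on ballI differentiable_imp_continuous_within)
  note h1 = curvature_le_1[OF cont]
  have hder: "(h has_real_derivative deriv h t) (at t)"
    using diff by (simp add: DERIV_deriv_iff_real_differentiable)
  \<comment> \<open>\<open>u\<close> and \<open>v\<close> are the values of \<open>A q * exp t\<close> and \<open>B q * exp (- t)\<close> on \<open>E t\<close> where \<open>C - 1 = D\<close>.\<close>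
  define u v where "u = (1 + D - h t * D) / 2" and "v = (1 + D + h t * D) / 2"
  have hD: "\<bar>h t * D\<bar> \<le> D" using h1[of t] Dp by (simp add: abs_mult mult_left_le_one_le)
  have uv: "u > 0" "v > 0" using hD Dp by (auto simp: u_def v_def)
  have uv2: "2 * u = 1 + D - h t * D" "2 * v = 1 + D + h t * D" by (auto simp: u_def v_def)
  have "4 * (u * v) = (2 * u) * (2 * v)" by simp
  also have "\<dots> = 1 + 2 * D + (D\<^sup>2 - (h t * D)\<^sup>2)"
    unfolding uv2 by (simp add: power2_eq_square algebra_simps)
  finally have "4 * (u * v) = 1 + 2 * D + (D\<^sup>2 - (h t * D)\<^sup>2)" .
  moreover have "(h t * D)\<^sup>2 \<le> D\<^sup>2" using hD Dp by (metis abs_le_square_iff abs_of_pos)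
  ultimately have uv4: "4 * (u * v) \<ge> 1" using Dp by linarith
  have "(u * exp (- t)) * (v * exp t) = u * v" by (simp add: exp_minus field_simps)
  then have "4 * ((u * exp (- t)) * (v * exp t)) \<ge> 1" using uv4 by (simp only:)
  then obtain q where q: "q \<in> half_space" "A q = u * exp (- t)" "B q = v * exp t"
    using AB_surj[of "u * exp (- t)" "v * exp t"] uv by auto
  have Aq: "A q * exp t = u" and Bq: "B q * exp (- t) = v" by (auto simp: q exp_minus)
  have q0: "defect (h t) t q = 0"
    unfolding defect_def Aq Bq by (simp add: u_def v_def field_simps)
  then have qE: "q \<in> E t" using q by (simp add: orthogonal_hypersphere_eq)
  have "((\<lambda>t. defect (h t) t q) has_real_derivative - 1) (at t)"
  proof -
    have "deriv h t * (u + v - 1) + h t * (u - v) + (u + v) = 1 - k * D"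
      by (simp add: u_def v_def k_def power2_eq_square field_simps)
    also have "\<dots> = - 1" using kp by (simp add: D_def)
    finally show ?thesis using defect_has_derivative[OF hder, of q] unfolding Aq Bq by simp
  qed
  from DERIV_neg_dec_right[OF this] q0
  obtain d1 where d1: "d1 > 0" "\<And>e. e > 0 \<Longrightarrow> e < d1 \<Longrightarrow> defect (h (t + e)) (t + e) q < 0" by auto
  have Ag: "A (\<gamma> t) * exp t = 1 / 2" and Bg: "B (\<gamma> t) * exp (- t) = 1 / 2"
    by (auto simp: A_\<gamma> B_\<gamma> exp_minus)
  have g0: "defect (h t) t (\<gamma> t) = 0" using \<gamma>_in_leaf by (simp add: orthogonal_hypersphere_eq)
  have "((\<lambda>t'. defect (h t') t' (\<gamma> t)) has_real_derivative 1) (at t)"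
    using defect_has_derivative[OF hder, of "\<gamma> t"] unfolding Ag Bg by simp
  from DERIV_pos_inc_right[OF this] g0
  obtain d2 where d2: "d2 > 0" "\<And>e. e > 0 \<Longrightarrow> e < d2 \<Longrightarrow> defect (h (t + e)) (t + e) (\<gamma> t) > 0" by auto
  define e where "e = min d1 d2 / 2"
  have e: "e > 0" "e < d1" "e < d2" using d1 d2 by (auto simp: e_def)
  obtain z where "z \<in> E t" "z \<in> E (t + e)"
    using connected_leaf_meets[OF leaf_connected[of t] leaf_half_space qE \<gamma>_in_leaf
        d1(2)[OF e(1,2)] d2(2)[OF e(1,3)]] by blast
  then have "E t = E (t + e)" using leaf_eq by blast
  then have "\<gamma> (t + e) \<in> E t" using \<gamma>_in_leaf by blast
  from \<gamma>_in_leaf_imp_eq[OF h1 this] show False using e by simp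
qed

end

text \<open>
  Here \<open>\<rho>\<close> is \<open>g\<close> followed by the local inverse of \<open>f\<close>, which explains its differentiability at \<open>t\<close>.
\<close>

lemma local_inverse_differentiable:
  fixes f g :: "real \<Rightarrow> real"
  assumes r: "r > 0" and f: "\<And>x. \<bar>x\<bar> < r \<Longrightarrow> (f has_real_derivative f' x) (at x)"
    and cont: "continuous_on {-r<..<r} f'" and f0: "f' 0 \<noteq> 0"
    and g: "g differentiable (at t)" "g t = f 0"
  obtains \<rho> where "\<rho> t = 0" "\<rho> differentiable (at t)" "\<forall>\<^sub>F s in nhds t. \<bar>\<rho> s\<bar> < r \<and> f (\<rho> s) = g s"
proof -
  have U: "open {-r<..<r}" by simp
  have der: "(f has_derivative blinfun_apply (blinfun_scaleR_left (f' x))) (at x)" if "x \<in> {-r<..<r}" for x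
    using f[of x] that by (simp add: has_field_derivative_def mult_commute_abs abs_less_iff)
  have c: "continuous_on {-r<..<r} (\<lambda>x. blinfun_scaleR_left (f' x) :: real \<Rightarrow>\<^sub>L real)"
    using cont by (rule bounded_linear.continuous_on[OF bounded_linear_blinfun_scaleR_left])
  have inv: "blinfun_scaleR_left (inverse (f' 0)) o\<^sub>L blinfun_scaleR_left (f' 0) = (id_blinfun :: real \<Rightarrow>\<^sub>L real)"
    by (rule blinfun_eqI) (use f0 in simp)
  have z: "0 \<in> {-r<..<r}" using r by simp
  obtain U' V k k' where I: "open U'" "U' \<subseteq> {-r<..<r}" "0 \<in> U'" "open V" "f 0 \<in> V" "homeomorphism U' V f k"
    "\<And>y. y \<in> V \<Longrightarrow> (k has_derivative (k' y)) (at y)"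
    using inverse_function_theorem[OF U der c z inv] by metis
  show ?thesis
  proof (rule that[of "\<lambda>s. k (g s)"])
    show "k (g t) = 0" using g(2) I(3,6) by (metis homeomorphism_apply1)
    have "k differentiable (at (g t))" using I(5,7) g(2) differentiableI by metis
    then show "(\<lambda>s. k (g s)) differentiable (at t)"
      using g(1) by (rule differentiable_compose)
    have "isCont g t" using g(1) by (rule differentiable_imp_continuous_within)
    then have "\<forall>\<^sub>F s in nhds t. g s \<in> V"
      by (rule isCont_eventually_nhds[OF _ I(4)]) (use I(5) g(2) in simp)
    then show "\<forall>\<^sub>F s in nhds t. \<bar>k (g s)\<bar> < r \<and> f (k (g s)) = g s"
    proof eventually_elim
      case (elim s)
      then have "k (g s) \<in> U'" "f (k (g s)) = g s" using I(6) unfolding homeomorphism_def by blast+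
      then show ?case using I(2) by (auto simp: abs_less_iff)
    qed
  qed
qed

context orthogonal_leaf_family
begin

text \<open>
  On \<open>\<gamma>\<close> itself the equation of the leaves degenerates, because \<open>C - 1\<close> vanishes there.  So take another point
  \<open>q0\<close> of the plaque through \<open>\<gamma> t\<close> and a short transversal \<open>\<delta>\<close> through it.  The leaf through \<open>\<gamma> s\<close> meets \<open>\<delta>\<close> in
  a point \<open>\<delta> (\<rho> s)\<close> with \<open>\<rho>\<close> differentiable at \<open>t\<close>, and there the equation can be solved for \<open>h s\<close>.
\<close>

lemma curvature_differentiable:
  assumes C1: "transversely_C1 F"
  shows "h differentiable (at t)"
proof -
  define p where "p = \<gamma> t"
  have pH: "p \<in> half_space" by (simp add: p_def \<gamma>_half_space)
  obtain U \<phi> \<psi> where U: "p \<in> U" "foliated_chart F U \<phi> \<psi>"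
    and f1: "Ck_on 1 (\<lambda>q. snd (\<phi> q)) U" and nz: "\<And>q. q \<in> U \<Longrightarrow> grad (\<lambda>q. snd (\<phi> q)) q \<noteq> 0"
    using C1[unfolded transversely_C1_def, rule_format, OF pH] by blast
  define f where "f q = snd (\<phi> q)" for q
  have f1: "Ck_on 1 f U" and nz: "\<And>q. q \<in> U \<Longrightarrow> grad f q \<noteq> 0"
    using f1 nz by (auto simp: f_def[abs_def])
  have ch: "open U" "U \<subseteq> half_space" "homeomorphism U UNIV \<phi> \<psi>"
    "\<And>L C. L \<in> F \<Longrightarrow> C \<in> components (L \<inter> U) \<Longrightarrow> \<exists>c. C = {q \<in> U. f q = c}"
    using U(2) unfolding foliated_chart_def f_def by auto
  have level: "q \<in> E s" if s: "\<gamma> s \<in> U" and q: "q \<in> U" "f q = f (\<gamma> s)" for s q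
  proof -
    let ?C = "connected_component_set (E s \<inter> U) (\<gamma> s)"
    have in1: "\<gamma> s \<in> E s \<inter> U" using s \<gamma>_in_leaf by blast
    then obtain c where c: "?C = {q \<in> U. f q = c}" using ch(4)[OF leaf componentsI] by blast
    have "\<gamma> s \<in> ?C" using in1 by (simp add: connected_component_refl)
    then have "q \<in> ?C" using c q by auto
    then show ?thesis using connected_component_subset[of "E s \<inter> U" "\<gamma> s"] by blast
  qed
  obtain e :: 'a where "e \<in> Basis" using nonempty_Basis by blast
  then have e: "e \<noteq> 0" by auto
  define q0 where "q0 = \<psi> (fst (\<phi> p) + e, snd (\<phi> p))"
  have q0: "q0 \<in> U" "\<phi> q0 = (fst (\<phi> p) + e, snd (\<phi> p))"
    using ch(3) unfolding homeomorphism_def q0_def by blast+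
  have fq0: "f q0 = f p" by (simp add: f_def q0)
  have q0p: "q0 \<noteq> p" using q0(2) e by (metis add_cancel_left_right fst_conv)
  define w where "w = grad f q0"
  have w: "w \<noteq> 0" using nz q0 by (simp add: w_def)
  obtain r0 where r0: "r0 > 0" "ball q0 r0 \<subseteq> U" using ch(1) q0(1) open_contains_ball by blast
  define r where "r = r0 / norm w"
  have r: "r > 0" using r0 w by (simp add: r_def)
  define \<delta> where "\<delta> x = q0 + x *\<^sub>R w" for x
  have \<delta>U: "\<delta> x \<in> U" if "\<bar>x\<bar> < r" for x
  proof -
    have "norm (x *\<^sub>R w) < r0" using that w by (simp add: r_def field_simps)
    then have "\<delta> x \<in> ball q0 r0" by (simp add: \<delta>_def dist_norm)
    then show ?thesis using r0 by blast
  qed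
  have df: "((\<lambda>x. f (\<delta> x)) has_real_derivative grad f (\<delta> x) \<bullet> w) (at x)" if x: "\<bar>x\<bar> < r" for x
  proof -
    have "(f has_derivative (\<lambda>v. grad f (\<delta> x) \<bullet> v)) (at (\<delta> x))"
      using Ck_on_1D(1)[OF f1 \<delta>U[OF x]] by (rule has_derivative_grad)
    then have "((\<lambda>x. f (\<delta> x)) has_derivative (\<lambda>v. grad f (\<delta> x) \<bullet> (v *\<^sub>R w))) (at x)"
      by (rule has_derivative_compose[where f = \<delta>, rotated])
         (auto simp: \<delta>_def[abs_def] intro!: derivative_eq_intros)
    then show ?thesis by (simp add: has_field_derivative_def mult_commute_abs)
  qed
  have cont: "continuous_on {-r<..<r} (\<lambda>x. grad f (\<delta> x) \<bullet> w)"
  proof -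
    have "continuous_on {-r<..<r} (\<lambda>x. grad f (\<delta> x))"
      by (rule continuous_on_compose2[OF Ck_on_1D(3)[OF f1]])
         (auto simp: \<delta>_def[abs_def] intro!: continuous_intros \<delta>U[unfolded \<delta>_def])
    then show ?thesis by (intro continuous_intros)
  qed
  have ne: "grad f (\<delta> 0) \<bullet> w \<noteq> 0" using w by (simp add: \<delta>_def w_def)
  have \<gamma>d: "\<gamma> differentiable (at t)"
    using arc_length_curveD(2)[OF arc_length] differentiableI_vector by blast
  have fg: "(\<lambda>s. f (\<gamma> s)) differentiable (at t)"
    by (rule differentiable_compose[OF _ \<gamma>d]) (use Ck_on_1D(1)[OF f1] U(1) in \<open>simp add: p_def\<close>)
  have fg0: "f (\<gamma> t) = f (\<delta> 0)" using fq0 by (simp add: \<delta>_def p_def)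
  obtain \<rho> where \<rho>: "\<rho> t = 0" "\<rho> differentiable (at t)"
    "\<forall>\<^sub>F s in nhds t. \<bar>\<rho> s\<bar> < r \<and> f (\<delta> (\<rho> s)) = f (\<gamma> s)"
    using local_inverse_differentiable[OF r df cont ne fg fg0] by blast
  define k where "k s = \<delta> (\<rho> s)" for s
  have k0: "k t = q0" by (simp add: k_def \<rho> \<delta>_def)
  have kd: "k differentiable (at t)"
    unfolding k_def[abs_def] \<delta>_def by (intro differentiable_add differentiable_scaleR \<rho>(2) differentiable_const)
  have q0H: "q0 \<in> half_space" using q0 ch by blast
  have Ad: "(\<lambda>s. A (k s)) differentiable (at t)" "(\<lambda>s. B (k s)) differentiable (at t)"
    using AB_differentiable[OF q0H] kd by (auto intro: differentiable_compose simp: k0)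
  have ed: "(\<lambda>s. exp s :: real) differentiable (at t)" "(\<lambda>s. exp (- s) :: real) differentiable (at t)"
  proof -
    have "((\<lambda>s. exp s) has_real_derivative exp t) (at t)" "((\<lambda>s. exp (- s)) has_real_derivative - exp (- t)) (at t)"
      by (auto intro!: derivative_eq_intros)
    then show "(\<lambda>s. exp s :: real) differentiable (at t)" "(\<lambda>s. exp (- s) :: real) differentiable (at t)"
      unfolding real_differentiable_def by blast+
  qed
  define C where "C s = A (k s) * exp s + B (k s) * exp (- s) - 1" for s
  define C' where "C' s = A (k s) * exp s - B (k s) * exp (- s)" for s
  have Cd: "C differentiable (at t)" "C' differentiable (at t)"
    unfolding C_def[abs_def] C'_def[abs_def]
    by (intro differentiable_add differentiable_diff differentiable_mult Ad ed differentiable_const)+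
  have C0: "C t \<noteq> 0"
  proof -
    have "C t = cosh_dist (\<gamma> t) q0 - 1" by (simp add: C_def k0 cosh_dist_\<gamma>[OF q0H])
    then show ?thesis using cosh_dist_eq_1_iff[OF \<gamma>_half_space q0H, of t] q0p by (simp add: p_def)
  qed
  have "\<forall>\<^sub>F s in nhds t. C s \<noteq> 0"
  proof -
    have "isCont C t" using Cd(1) by (rule differentiable_imp_continuous_within)
    then have "\<forall>\<^sub>F s in nhds t. C s \<in> - {0}"
      by (rule isCont_eventually_nhds) (use C0 in auto)
    then show ?thesis by simp
  qed
  moreover have "\<forall>\<^sub>F s in nhds t. \<gamma> s \<in> U"
  proof -
    have "isCont \<gamma> t" using \<gamma>d by (rule differentiable_imp_continuous_within)
    then show ?thesis
      by (rule isCont_eventually_nhds[OF _ ch(1)]) (use U(1) in \<open>simp add: p_def\<close>)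
  qed
  ultimately have ev: "\<forall>\<^sub>F s in nhds t. - C' s * inverse (C s) = h s"
    using \<rho>(3)
  proof eventually_elim
    case (elim s)
    have "k s \<in> E s" using level[OF elim(2), of "k s"] \<delta>U elim(3) by (simp add: k_def)
    then have "h s * C s + C' s = 0" by (simp add: orthogonal_hypersphere_eq defect_def C_def C'_def)
    then show ?case using elim(1) by (simp add: field_simps)
  qed
  have "(\<lambda>s. - C' s * inverse (C s)) differentiable (at t)"
    using Cd C0 by (intro differentiable_mult differentiable_inverse differentiable_minus) auto
  then obtain D where "((\<lambda>s. - C' s * inverse (C s)) has_derivative D) (at t)" unfolding differentiable_def by blast
  then have "(h has_derivative D) (at t)"
    by (rule has_derivative_transform_eventually)
       (use ev eventually_nhds_x_imp_x[OF ev] in \<open>auto simp: eventually_at_filter elim: eventually_mono\<close>)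
  then show ?thesis by (rule differentiableI)
qed

end


lemma umbilical_foliation_curvature:
  fixes F :: "('a::euclidean_space \<times> real) set set"
  assumes F: "totally_umbilical_foliation F" "transversely_C1 F" and \<gamma>: "geodesic_line \<gamma>"
    and orth: "foliation_orthogonal_to F \<gamma>"
    and mc: "\<And>t L. L \<in> F \<Longrightarrow> \<gamma> t \<in> L \<Longrightarrow> has_mean_curvature L (\<gamma> t) (- velocity \<gamma> t) (h t)"
  shows "h differentiable (at t)" "deriv h t \<ge> (h t)\<^sup>2 - 1"
proof -
  have al: "arc_length_curve \<gamma>" using \<gamma> by (simp add: geodesic_line_def)
  have fol: "foliation F" using F(1) by (simp add: totally_umbilical_foliation_def)
  obtain T T' where T: "hyp_isometry T T'" "\<And>t. T (\<gamma> t) = (0, exp t)"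
    using geodesic_normal_form[OF \<gamma>] by blast
  have leaf: "orthogonal_hypersphere \<gamma> (h t) t \<in> F" for t
  proof -
    have "\<Union> F = half_space" using fol by (simp add: foliation_def partition_on_def)
    then obtain L where L: "L \<in> F" "\<gamma> t \<in> L" using arc_length_curveD(1)[OF al, of t] by blast
    obtain a v d where q: "unit_quad a v d" "L = quadric a v d"
      using totally_umbilical_foliation_leaf_is_quadric[OF F(1) L(1)] by blast
    have "orthogonal_at L \<gamma> t" using orth L unfolding foliation_orthogonal_to_def by blast
    then have "quadric a v d = orthogonal_hypersphere \<gamma> (h t) t"
      using quadric_eq_if_orthogonal[OF al q(1)] L mc[OF L] unfolding q(2) by blast
    then show ?thesis using L(1) q(2) by simp
  qed
  interpret orthogonal_leaf_family \<gamma> T T' h F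
    by unfold_locales (rule \<gamma> T fol leaf)+
  show "h differentiable (at t)" by (rule curvature_differentiable[OF F(2)])
  show "deriv h t \<ge> (h t)\<^sup>2 - 1"
    by (rule curvature_derivative_ge) (rule curvature_differentiable[OF F(2)])
qed

text \<open>
  Multiplication by \<open>exp (- \<integral> h)\<close> makes \<open>g\<close> strictly increasing.
\<close>


section \<open>Sufficiency of the differential inequality\<close>

lemma riccati_zero_unique:
  fixes g h :: "real \<Rightarrow> real"
  assumes h: "continuous_on {a..b} h" and ab: "a < b"
    and g: "\<And>t. t \<in> {a..b} \<Longrightarrow> (g has_real_derivative g' t) (at t)"
    and ge: "\<And>t. t \<in> {a..b} \<Longrightarrow> g' t \<ge> h t * g t + 1"
    and g0: "g a \<ge> 0"
  shows "g b > 0"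
proof -
  obtain k where k: "\<And>x. x \<in> {a..b} \<Longrightarrow> (k has_vector_derivative h x) (at x within {a..b})"
    using antiderivative_continuous[OF h] by blast
  define E where "E t = exp (- k t) * g t" for t
  have kd: "(k has_real_derivative h x) (at x within {a..b})" if "x \<in> {a..b}" for x
    using k[OF that] by (simp add: has_real_derivative_iff_has_vector_derivative)
  have Ed: "(E has_real_derivative exp (- k t) * (g' t - h t * g t)) (at t within {a..b})" if t: "t \<in> {a..b}" for t
    unfolding E_def[abs_def]
    by (auto intro!: derivative_eq_intros kd[OF t] has_field_derivative_at_within[OF g[OF t]] simp: algebra_simps)
  have cont: "continuous_on {a..b} E"
    using Ed by (rule DERIV_continuous_on)
  have "E a < E b"
  proof (rule DERIV_pos_imp_increasing_open[OF ab _ cont])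
    fix x assume x: "a < x" "x < b"
    then have "(E has_real_derivative exp (- k x) * (g' x - h x * g x)) (at x)"
      using Ed[of x] by (simp add: at_within_Icc_at)
    moreover have "g' x - h x * g x > 0" using ge[of x] x by simp
    ultimately show "\<exists>y. (E has_real_derivative y) (at x) \<and> 0 < y"
      by (intro exI conjI) auto
  qed
  moreover have "E a \<ge> 0" using g0 by (simp add: E_def)
  ultimately have "E b > 0" by simp
  then show ?thesis by (simp add: E_def zero_less_mult_iff)
qed

text \<open>
  The bound makes the hyperspheres sweep out the whole space, the differential inequality keeps
  them disjoint.
\<close>

locale umbilical_curvature = geodesic_frame +
  fixes h :: "real \<Rightarrow> real"
  assumes bound: "\<bar>h t\<bar> \<le> 1" and diff: "h differentiable (at t)" and ge: "deriv h t \<ge> (h t)\<^sup>2 - 1"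
begin

lemma h_continuous: "continuous_on S h"
  using diff by (intro continuous_at_imp_continuous_on ballI differentiable_imp_continuous_within)

lemma defect_derivative:
  assumes q: "q \<in> half_space"
  obtains g' where "((\<lambda>t. defect (h t) t q) has_real_derivative g') (at t)"
    "g' \<ge> h t * defect (h t) t q + 1"
proof -
  let ?C = "A q * exp t + B q * exp (- t)" and ?C' = "A q * exp t - B q * exp (- t)"
  have hder: "(h has_real_derivative deriv h t) (at t)"
    using diff by (simp add: DERIV_deriv_iff_real_differentiable)
  have d: "((\<lambda>t. defect (h t) t q) has_real_derivative
     deriv h t * (?C - 1) + h t * ?C' + ?C) (at t)"
    unfolding defect_def by (auto intro!: derivative_eq_intros hder simp: algebra_simps)
  have C1: "?C - 1 \<ge> 0"
    using cosh_dist_ge_1[OF \<gamma>_half_space q] cosh_dist_\<gamma>[OF q] by simp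
  have "((h t)\<^sup>2 - 1) * (?C - 1) \<le> deriv h t * (?C - 1)"
    using ge C1 by (rule mult_right_mono)
  moreover have "((h t)\<^sup>2 - 1) * (?C - 1) + h t * ?C' + ?C = h t * defect (h t) t q + 1"
    by (simp add: defect_def power2_eq_square algebra_simps)
  ultimately have "deriv h t * (?C - 1) + h t * ?C' + ?C \<ge> h t * defect (h t) t q + 1" by linarith
  with d show ?thesis by (rule that)
qed

lemma defect_increasing_zero:
  assumes q: "q \<in> half_space" and st: "s < t" and s: "defect (h s) s q \<ge> 0"
  shows "defect (h t) t q > 0"
proof -
  obtain g' where g': "\<And>t. ((\<lambda>t. defect (h t) t q) has_real_derivative g' t) (at t)"
    "\<And>t. g' t \<ge> h t * defect (h t) t q + 1"
  proof -
    have "\<forall>t. \<exists>g'. ((\<lambda>t. defect (h t) t q) has_real_derivative g') (at t) \<and> g' \<ge> h t * defect (h t) t q + 1"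
      using defect_derivative[OF q] by blast
    from choice[OF this] show ?thesis using that by blast
  qed
  show ?thesis
    by (rule riccati_zero_unique[where g = "\<lambda>t. defect (h t) t q", OF h_continuous st g'(1) g'(2) s])
qed

text \<open>
  With \<open>x = A q * exp t\<close> large and \<open>y = B q * exp (- t)\<close> small the defect is \<open>(1 + h t) x - (1 - h t) y - h t\<close>.
  The first term may stay small, but only where \<open>h t\<close> is close to \<open>- 1\<close>, and then \<open>- h t\<close> is positive.
\<close>

lemma defect_pos_ex:
  assumes q: "q \<in> half_space"
  shows "\<exists>t. defect (h t) t q > 0"
proof -
  have "filterlim (\<lambda>t. A q * exp t) at_top at_top"
    by (intro filterlim_tendsto_pos_mult_at_top[OF tendsto_const A_pos[OF q]] exp_at_top)
  then have 1: "\<forall>\<^sub>F t in at_top. A q * exp t > 4" by (simp add: filterlim_at_top_dense)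
  have "((\<lambda>t. B q * exp (- t)) \<longlongrightarrow> B q * 0) at_top"
    by (intro tendsto_mult tendsto_const filterlim_compose[OF exp_at_bot filterlim_uminus_at_bot_at_top])
  then have 2: "\<forall>\<^sub>F t in at_top. B q * exp (- t) < 1 / 8"
    using order_tendstoD(2)[of _ "B q * 0" at_top "1 / 8"] by simp
  obtain t where t: "A q * exp t > 4" "B q * exp (- t) < 1 / 8"
    using eventually_happens[OF eventually_conj[OF 1 2]] by auto
  define x y where "x = A q * exp t" and "y = B q * exp (- t)"
  have xy: "x > 4" "0 < y" "y < 1 / 8" using t B_pos[OF q] by (auto simp: x_def y_def)
  have h1: "- 1 \<le> h t" "h t \<le> 1" using bound[of t] by auto
  have D: "defect (h t) t q = (1 + h t) * x - (1 - h t) * y - h t"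
    by (simp add: defect_def x_def y_def algebra_simps)
  have "(1 - h t) * y \<le> 2 * (1 / 8)" using xy h1 by (intro mult_mono) auto
  moreover have "(1 + h t) * x \<ge> (1 + h t) * 4" using xy h1 by (intro mult_left_mono) auto
  ultimately have "defect (h t) t q > 0" unfolding D using h1 by argo
  then show ?thesis by blast
qed

lemma defect_neg_ex:
  assumes q: "q \<in> half_space"
  shows "\<exists>t. defect (h t) t q < 0"
proof -
  have "filterlim (\<lambda>t. B q * exp (- t)) at_top at_bot"
    by (intro filterlim_tendsto_pos_mult_at_top[OF tendsto_const B_pos[OF q]]
          filterlim_compose[OF exp_at_top filterlim_uminus_at_top_at_bot])
  then have 1: "\<forall>\<^sub>F t in at_bot. B q * exp (- t) > 4" by (simp add: filterlim_at_top_dense)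
  have "((\<lambda>t. A q * exp t) \<longlongrightarrow> A q * 0) at_bot"
    by (intro tendsto_mult tendsto_const exp_at_bot)
  then have 2: "\<forall>\<^sub>F t in at_bot. A q * exp t < 1 / 8"
    using order_tendstoD(2)[of _ "A q * 0" at_bot "1 / 8"] by simp
  obtain t where t: "B q * exp (- t) > 4" "A q * exp t < 1 / 8"
    using eventually_happens[OF eventually_conj[OF 1 2]] by auto
  define x y where "x = A q * exp t" and "y = B q * exp (- t)"
  have xy: "y > 4" "0 < x" "x < 1 / 8" using t A_pos[OF q] by (auto simp: x_def y_def)
  have h1: "- 1 \<le> h t" "h t \<le> 1" using bound[of t] by auto
  have D: "defect (h t) t q = (1 + h t) * x - (1 - h t) * y - h t"
    by (simp add: defect_def x_def y_def algebra_simps)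
  have "(1 + h t) * x \<le> 2 * (1 / 8)" using xy h1 by (intro mult_mono) auto
  moreover have "(1 - h t) * y \<ge> (1 - h t) * 4" using xy h1 by (intro mult_left_mono) auto
  ultimately have "defect (h t) t q < 0" unfolding D using h1 by argo
  then show ?thesis by blast
qed

lemma leaf_through_unique:
  assumes q: "q \<in> half_space"
  shows "\<exists>!t. q \<in> orthogonal_hypersphere \<gamma> (h t) t"
proof (rule ex_ex1I)
  obtain a b where ab: "defect (h a) a q < 0" "defect (h b) b q > 0"
    using defect_neg_ex[OF q] defect_pos_ex[OF q] by blast
  have "\<not> b < a" using defect_increasing_zero[OF q, of b a] ab by auto
  then have le: "a \<le> b" by simp
  have "continuous_on {a..b} (\<lambda>t. defect (h t) t q)"
    unfolding defect_def by (intro continuous_intros h_continuous)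
  then obtain t where "defect (h t) t q = 0"
    using IVT'[of "\<lambda>t. defect (h t) t q" a 0 b] ab le by auto
  then show "\<exists>t. q \<in> orthogonal_hypersphere \<gamma> (h t) t" using q by (auto simp: orthogonal_hypersphere_eq)
next
  fix s t assume "q \<in> orthogonal_hypersphere \<gamma> (h s) s" "q \<in> orthogonal_hypersphere \<gamma> (h t) t"
  then have 0: "defect (h s) s q = 0" "defect (h t) t q = 0" by (auto simp: orthogonal_hypersphere_eq)
  show "s = t"
  proof (rule ccontr)
    assume "s \<noteq> t"
    then consider "s < t" | "t < s" by linarith
    then show False
      using defect_increasing_zero[OF q, of s t] defect_increasing_zero[OF q, of t s] 0 by cases auto
  qed
qed

text \<open>
  Coordinates on the leaf at \<open>t\<close>: let \<open>z = fst (T q) /\<^sub>R snd (T q)\<close>.  On the leaf, \<open>D = C - 1\<close> is the nonnegative root of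
  \<open>(1 - h\<^sup>2) D\<^sup>2 + 2 D = z \<bullet> z\<close>; this form of the root remains valid for \<open>h\<^sup>2 = 1\<close>.
  From \<open>D\<close> one recovers \<open>A q\<close>, hence the height \<open>leaf_height\<close> of \<open>T q\<close>, hence \<open>q = leaf_point (z, t)\<close>.
\<close>

definition leaf_radius :: "'a \<Rightarrow> real \<Rightarrow> real" where
  "leaf_radius z t = (z \<bullet> z) / (1 + sqrt (1 + (1 - (h t)\<^sup>2) * (z \<bullet> z)))"

definition leaf_height :: "'a \<Rightarrow> real \<Rightarrow> real" where
  "leaf_height z t = exp t / (1 + leaf_radius z t - h t * leaf_radius z t)"

definition leaf_point :: "'a \<times> real \<Rightarrow> 'a \<times> real" where
  "leaf_point w = T' (leaf_height (fst w) (snd w) *\<^sub>R fst w, leaf_height (fst w) (snd w))"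

lemma h_square_le_1: "(h t)\<^sup>2 \<le> 1"
  using bound[of t] by (simp add: abs_square_le_1)

lemma radicand_ge_1: "1 + (1 - (h t)\<^sup>2) * (z \<bullet> z) \<ge> 1"
  using h_square_le_1[of t] by simp

lemma leaf_radius_nonneg: "leaf_radius z t \<ge> 0"
  using radicand_ge_1[of t z] unfolding leaf_radius_def by (intro divide_nonneg_nonneg) auto

lemma leaf_radius_quadratic:
  "(1 - (h t)\<^sup>2) * (leaf_radius z t)\<^sup>2 + 2 * leaf_radius z t = z \<bullet> z"
proof -
  define S where "S = sqrt (1 + (1 - (h t)\<^sup>2) * (z \<bullet> z))"
  have S: "S \<ge> 1" "S\<^sup>2 = 1 + (1 - (h t)\<^sup>2) * (z \<bullet> z)"
    using radicand_ge_1[of t z] by (auto simp: S_def)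
  define D where "D = leaf_radius z t"
  have "D = (z \<bullet> z) / (1 + S)" by (simp add: D_def leaf_radius_def S_def)
  then have D: "D * (1 + S) = z \<bullet> z" using S(1) by simp
  have "(1 - (h t)\<^sup>2) * D\<^sup>2 * (1 + S) = (1 - (h t)\<^sup>2) * (z \<bullet> z) * D"
    unfolding D[symmetric] by (simp add: power2_eq_square mult_ac)
  also have "(1 - (h t)\<^sup>2) * (z \<bullet> z) = (S - 1) * (S + 1)" using S(2) by (simp add: power2_eq_square algebra_simps)
  finally have "((1 - (h t)\<^sup>2) * D\<^sup>2 + 2 * D) * (1 + S) = ((S - 1) * D + 2 * D) * (1 + S)"
    by (simp add: algebra_simps)
  then have "(1 - (h t)\<^sup>2) * D\<^sup>2 + 2 * D = (S - 1) * D + 2 * D" using S(1) by simp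
  also have "\<dots> = z \<bullet> z" using D by (simp add: algebra_simps)
  finally show ?thesis by (simp add: D_def)
qed

lemma leaf_radius_unique:
  assumes "D \<ge> 0" "(1 - (h t)\<^sup>2) * D\<^sup>2 + 2 * D = z \<bullet> z"
  shows "D = leaf_radius z t"
proof -
  define E where "E = leaf_radius z t"
  have E: "E \<ge> 0" "(1 - (h t)\<^sup>2) * E\<^sup>2 + 2 * E = z \<bullet> z"
    using leaf_radius_nonneg leaf_radius_quadratic by (auto simp: E_def)
  have "(D - E) * ((1 - (h t)\<^sup>2) * (D + E) + 2)
      = ((1 - (h t)\<^sup>2) * D\<^sup>2 + 2 * D) - ((1 - (h t)\<^sup>2) * E\<^sup>2 + 2 * E)"
    by (simp add: power2_eq_square algebra_simps)
  also have "\<dots> = 0" using assms(2) E(2) by simp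
  finally have "(D - E) * ((1 - (h t)\<^sup>2) * (D + E) + 2) = 0" .
  moreover have "(1 - (h t)\<^sup>2) * (D + E) \<ge> 0" using h_square_le_1[of t] assms(1) E(1) by simp
  ultimately show ?thesis by (simp add: E_def)
qed

lemma leaf_height_pos: "leaf_height z t > 0"
  and leaf_height_denominator: "1 + leaf_radius z t - h t * leaf_radius z t \<ge> 1"
proof -
  have "h t * leaf_radius z t \<le> 1 * leaf_radius z t"
    using bound[of t] leaf_radius_nonneg by (intro mult_right_mono) auto
  then show "1 + leaf_radius z t - h t * leaf_radius z t \<ge> 1" by simp
  then show "leaf_height z t > 0" unfolding leaf_height_def by (intro divide_pos_pos) auto
qed

lemma leaf_point_half_space: "leaf_point w \<in> half_space"
  unfolding leaf_point_def by (rule T'_half_space) (simp add: half_space_def leaf_height_pos)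

lemma T_leaf_point: "T (leaf_point w) = (leaf_height (fst w) (snd w) *\<^sub>R fst w, leaf_height (fst w) (snd w))"
  unfolding leaf_point_def by (rule T_T') (simp add: half_space_def leaf_height_pos)

lemma leaf_point_in_leaf: "leaf_point (z, t) \<in> orthogonal_hypersphere \<gamma> (h t) t"
proof -
  define D where "D = leaf_radius z t"
  define y where "y = leaf_height z t"
  define u where "u = (1 + D - h t * D) / 2"
  define v where "v = (1 + D + h t * D) / 2"
  have u: "u > 0" using leaf_height_denominator[of z t] by (simp add: u_def D_def)
  have "2 * u = 1 + D - h t * D" by (simp add: u_def)
  then have y: "y = exp t / (2 * u)" by (simp only: y_def leaf_height_def D_def)
  have uv: "4 * (u * v) = 1 + z \<bullet> z"
  proof -
    have uv2: "2 * u = 1 + D - h t * D" "2 * v = 1 + D + h t * D" by (auto simp: u_def v_def)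
    have "4 * (u * v) = (2 * u) * (2 * v)" by simp
    also have "\<dots> = 1 + ((1 - (h t)\<^sup>2) * D\<^sup>2 + 2 * D)"
      unfolding uv2 by (simp add: power2_eq_square algebra_simps)
    also have "\<dots> = 1 + z \<bullet> z" using leaf_radius_quadratic by (simp add: D_def)
    finally show ?thesis .
  qed
  have Tq: "T (leaf_point (z, t)) = (y *\<^sub>R z, y)" by (simp add: T_leaf_point y_def)
  have A: "A (leaf_point (z, t)) * exp t = u"
    using u by (simp add: A_def Tq y)
  have "B (leaf_point (z, t)) = y * (1 + z \<bullet> z) / 2"
    using leaf_height_pos[of z t] by (simp add: B_def Tq inner_prod_real y_def[symmetric] field_simps)
  also have "\<dots> = exp t * v" using u by (simp add: y uv[symmetric])
  finally have B: "B (leaf_point (z, t)) * exp (- t) = v" by (simp add: exp_minus)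
  have "defect (h t) t (leaf_point (z, t)) = 0"
    unfolding defect_def A B by (simp add: u_def v_def field_simps)
  then show ?thesis using leaf_point_half_space by (simp add: orthogonal_hypersphere_eq)
qed

lemma leaf_point_surj:
  assumes q: "q \<in> orthogonal_hypersphere \<gamma> (h t) t"
  shows "q = leaf_point (fst (T q) /\<^sub>R snd (T q), t)"
proof -
  have qH: "q \<in> half_space" and d0: "defect (h t) t q = 0" using q by (auto simp: orthogonal_hypersphere_eq)
  define z where "z = fst (T q) /\<^sub>R snd (T q)"
  have yT: "snd (T q) > 0" using T_half_space[OF qH] by (simp add: half_space_def)
  define u v where "u = A q * exp t" and "v = B q * exp (- t)"
  define D where "D = u + v - 1"
  have uv: "u - v = - h t * D" using d0 by (simp add: defect_def u_def v_def D_def)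
  have u2: "2 * u = 1 + D - h t * D" and v2: "2 * v = 1 + D + h t * D"
    using uv by (auto simp: D_def algebra_simps)
  have D0: "D \<ge> 0"
    using cosh_dist_ge_1[OF \<gamma>_half_space qH] cosh_dist_\<gamma>[OF qH] by (simp add: D_def u_def v_def)
  have "4 * (u * v) = 4 * (A q * B q)" by (simp add: u_def v_def exp_minus)
  also have "\<dots> = 1 + z \<bullet> z" unfolding AB_eq[OF qH] z_def by (simp add: dot_square_norm)
  finally have zz: "(2 * u) * (2 * v) = 1 + z \<bullet> z" by simp
  have "(1 - (h t)\<^sup>2) * D\<^sup>2 + 2 * D = (1 + D - h t * D) * (1 + D + h t * D) - 1"
    by (simp add: power2_eq_square algebra_simps)
  also have "\<dots> = z \<bullet> z" using zz unfolding u2 v2 by simp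
  finally have D: "D = leaf_radius z t" using leaf_radius_unique D0 by blast
  have "leaf_height z t = exp t / (2 * u)" unfolding leaf_height_def D[symmetric] u2 ..
  also have "\<dots> = snd (T q)" using yT by (simp add: u_def A_def)
  finally have "leaf_point (z, t) = T' (snd (T q) *\<^sub>R z, snd (T q))" by (simp add: leaf_point_def)
  also have "(snd (T q) *\<^sub>R z, snd (T q)) = T q" using yT by (simp add: z_def prod_eq_iff)
  finally show ?thesis using T'_T[OF qH] by (simp add: z_def)
qed

lemma leaf_point_inj: "inj leaf_point"
proof (rule injI)
  fix w w' :: "'a \<times> real" assume eq: "leaf_point w = leaf_point w'"
  obtain z t z' t' where w: "w = (z, t)" "w' = (z', t')" by (metis surj_pair)
  have "t = t'"
    using leaf_through_unique[OF leaf_point_half_space[of w]] leaf_point_in_leaf[of z t] leaf_point_in_leaf[of z' t'] eq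
    unfolding w by auto
  moreover have "z = z'"
  proof -
    have "fst (T (leaf_point (z, t))) /\<^sub>R snd (T (leaf_point (z, t))) = z" for z t
      using leaf_height_pos[of z t] by (simp add: T_leaf_point)
    then show ?thesis using eq unfolding w by metis
  qed
  ultimately show "w = w'" by (simp add: w)
qed

lemma leaf_point_continuous: "continuous_on UNIV leaf_point"
proof -
  have cT': "continuous_on half_space T'"
    using isometry unfolding hyp_isometry_def homeomorphism_def by blast
  have ch: "continuous_on UNIV (\<lambda>w :: 'a \<times> real. h (snd w))"
    by (rule continuous_on_compose2[OF h_continuous[of UNIV]]) (auto intro!: continuous_intros)
  have cr: "continuous_on UNIV (\<lambda>w :: 'a \<times> real. leaf_radius (fst w) (snd w))"
    unfolding leaf_radius_def
  proof (intro continuous_intros ch ballI)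
    fix w :: "'a \<times> real"
    have "sqrt (1 + (1 - (h (snd w))\<^sup>2) * (fst w \<bullet> fst w)) \<ge> 0"
      using radicand_ge_1[of "snd w" "fst w"] by simp
    then show "1 + sqrt (1 + (1 - (h (snd w))\<^sup>2) * (fst w \<bullet> fst w)) \<noteq> 0" by linarith
  qed
  have cl: "continuous_on UNIV (\<lambda>w :: 'a \<times> real. leaf_height (fst w) (snd w))"
    unfolding leaf_height_def
  proof (intro continuous_intros ch cr ballI)
    fix w :: "'a \<times> real"
    show "1 + leaf_radius (fst w) (snd w) - h (snd w) * leaf_radius (fst w) (snd w) \<noteq> 0"
      using leaf_height_denominator[of "fst w" "snd w"] by linarith
  qed
  show ?thesis
    unfolding leaf_point_def[abs_def]
    by (rule continuous_on_compose2[OF cT'])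
       (auto intro!: continuous_intros cl simp: half_space_def leaf_height_pos)
qed

text \<open>
  \<open>leaf_point\<close> is a continuous bijection from a Euclidean space to the half-space.  Invariance of domain makes it
  a homeomorphism, and its inverse is a foliated chart on the whole half-space whose plaques are the leaves.
\<close>

lemma leaf_foliation: "totally_umbilical_foliation (range (\<lambda>t. orthogonal_hypersphere \<gamma> (h t) t))"
proof -
  let ?F = "range (\<lambda>t. orthogonal_hypersphere \<gamma> (h t) t)"
  have route: "route_leaf \<gamma> h t (orthogonal_hypersphere \<gamma> (h t) t)" "totally_umbilical (orthogonal_hypersphere \<gamma> (h t) t)"
    "path_connected (orthogonal_hypersphere \<gamma> (h t) t)" for t
    by (rule route_leaf_orthogonal_hypersphere[where h = h, OF arc_length bound])+
  have unique: "orthogonal_hypersphere \<gamma> (h s) s = orthogonal_hypersphere \<gamma> (h t) t"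
    if "q \<in> orthogonal_hypersphere \<gamma> (h s) s" "q \<in> orthogonal_hypersphere \<gamma> (h t) t" for q s t
  proof -
    have "q \<in> half_space" using that(1) by (auto simp: orthogonal_hypersphere_eq)
    from leaf_through_unique[OF this] have "s = t" using that by blast
    then show ?thesis by simp
  qed
  have sub: "orthogonal_hypersphere \<gamma> (h t) t \<subseteq> half_space" for t by (auto simp: orthogonal_hypersphere_eq)
  have "partition_on half_space ?F"
    unfolding partition_on_def
  proof (intro conjI)
    show "\<Union> ?F = half_space"
    proof
      show "\<Union> ?F \<subseteq> half_space" using sub by blast
      show "half_space \<subseteq> \<Union> ?F"
      proof
        fix q :: "'a \<times> real" assume "q \<in> half_space"
        from ex1_implies_ex[OF leaf_through_unique[OF this]] show "q \<in> \<Union> ?F" by blast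
      qed
    qed
    show "disjoint ?F"
      unfolding disjoint_def using unique by blast
    show "{} \<notin> ?F" using \<gamma>_in_leaf by blast
  qed
  moreover have "\<forall>L\<in>?F. path_connected L" using route(3) by blast
  moreover have "\<exists>U \<phi> \<psi>. p \<in> U \<and> foliated_chart ?F U \<phi> \<psi>" if p: "p \<in> half_space" for p
  proof -
    obtain \<phi> where \<phi>: "homeomorphism UNIV (leaf_point ` UNIV) leaf_point \<phi>"
      using invariance_of_domain_homeomorphism[OF open_UNIV leaf_point_continuous _ leaf_point_inj] by auto
    have im: "range leaf_point = half_space"
    proof
      show "range leaf_point \<subseteq> half_space" using leaf_point_half_space by blast
      show "half_space \<subseteq> range leaf_point"
      proof
        fix q :: "'a \<times> real" assume "q \<in> half_space"
        from ex1_implies_ex[OF leaf_through_unique[OF this]] obtain t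
          where "q \<in> orthogonal_hypersphere \<gamma> (h t) t" by blast
        from leaf_point_surj[OF this] show "q \<in> range leaf_point" by (rule range_eqI)
      qed
    qed
    have hom: "homeomorphism half_space UNIV \<phi> leaf_point"
      using \<phi> unfolding im by (rule homeomorphism_symD)
    have leafs: "orthogonal_hypersphere \<gamma> (h t) t = {q \<in> half_space. snd (\<phi> q) = t}" for t
    proof (intro set_eqI iffI)
      fix q assume q: "q \<in> orthogonal_hypersphere \<gamma> (h t) t"
      then have "\<phi> q = (fst (T q) /\<^sub>R snd (T q), t)"
        using leaf_point_surj[OF q] \<phi> unfolding homeomorphism_def by (metis UNIV_I)
      then show "q \<in> {q \<in> half_space. snd (\<phi> q) = t}" using q sub by auto
    next
      fix q assume q: "q \<in> {q \<in> half_space. snd (\<phi> q) = t}"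
      then have "q = leaf_point (fst (\<phi> q), t)"
        using hom unfolding homeomorphism_def by (metis (mono_tags, lifting) mem_Collect_eq prod.collapse)
      then show "q \<in> orthogonal_hypersphere \<gamma> (h t) t" using leaf_point_in_leaf by metis
    qed
    have "foliated_chart ?F half_space \<phi> leaf_point"
      unfolding foliated_chart_def
    proof (intro conjI ballI open_half_space subset_refl hom)
      fix L C assume L: "L \<in> ?F" and C: "C \<in> components (L \<inter> half_space)"
      obtain t where t: "L = orthogonal_hypersphere \<gamma> (h t) t" using L by blast
      have "L \<inter> half_space = L" using sub t by blast
      moreover have "connected L" using route(3)[of t] path_connected_imp_connected t by blast
      moreover have "L \<noteq> {}" using \<gamma>_in_leaf t by blast
      ultimately have "C = L" using C connected_eq_connected_components_eq components_eq_sing_iff by (metis singletonD)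
      then show "\<exists>c. C = {q \<in> half_space. snd (\<phi> q) = c}" using leafs t by blast
    qed
    then show ?thesis using p by blast
  qed
  ultimately have "foliation ?F" unfolding foliation_def by blast
  moreover have "generalized_hypersphere L" if "L \<in> ?F" for L
    using route(1) that unfolding route_leaf_def by blast
  moreover have "totally_umbilical L" if "L \<in> ?F" for L using route(2) that by blast
  ultimately show ?thesis unfolding totally_umbilical_foliation_def by simp
qed

lemma umbilical_route_curvature: "umbilical_route \<gamma> h"
  unfolding umbilical_route_def
proof (intro conjI exI allI)
  show "route_leaf \<gamma> h t (orthogonal_hypersphere \<gamma> (h t) t)" for t
    by (rule route_leaf_orthogonal_hypersphere(1)[where h = h, OF arc_length bound])
qed (use arc_length leaf_foliation in auto)

end

theorem theorem2p7:
  shows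
    "(\<forall>(F :: ('a::euclidean_space \<times> real) set set) (\<gamma> :: real \<Rightarrow> 'a \<times> real) (h :: real \<Rightarrow> real).
        totally_umbilical_foliation F \<and> transversely_C1 F \<and>
        geodesic_line \<gamma> \<and> foliation_orthogonal_to F \<gamma> \<and>
        (\<forall>t. \<forall>L\<in>F. \<gamma> t \<in> L \<longrightarrow> has_mean_curvature L (\<gamma> t) (- velocity \<gamma> t) (h t))
        \<longrightarrow> (\<exists>tm tp :: ereal.
               (\<forall>t. ereal t \<le> tm \<longrightarrow> h t = -1) \<and>
               (\<forall>t. h differentiable (at t) \<and> deriv h t \<ge> (h t)\<^sup>2 - 1) \<and>
               (\<forall>t. tp \<le> ereal t \<longrightarrow> h t = 1)))
     \<and>
     (\<forall>h :: real \<Rightarrow> real.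
        range h \<subseteq> {-1..1} \<and> h C1_differentiable_on UNIV \<and>
        (\<exists>tm tp :: ereal.
           (\<forall>t. ereal t \<le> tm \<longrightarrow> h t = -1) \<and>
           (\<forall>t. h differentiable (at t) \<and> deriv h t \<ge> (h t)\<^sup>2 - 1) \<and>
           (\<forall>t. tp \<le> ereal t \<longrightarrow> h t = 1))
        \<longrightarrow> (\<forall>\<gamma> :: real \<Rightarrow> 'a \<times> real. geodesic_line \<gamma> \<longrightarrow> umbilical_route \<gamma> h))"
proof (intro conjI allI impI)
  fix F :: "('a \<times> real) set set" and \<gamma> :: "real \<Rightarrow> 'a \<times> real" and h :: "real \<Rightarrow> real"
  assume "totally_umbilical_foliation F \<and> transversely_C1 F \<and>
        geodesic_line \<gamma> \<and> foliation_orthogonal_to F \<gamma> \<and>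
        (\<forall>t. \<forall>L\<in>F. \<gamma> t \<in> L \<longrightarrow> has_mean_curvature L (\<gamma> t) (- velocity \<gamma> t) (h t))"
  then have "h differentiable (at t) \<and> deriv h t \<ge> (h t)\<^sup>2 - 1" for t
    using umbilical_foliation_curvature[of F \<gamma> h t] by blast
  then show "\<exists>tm tp :: ereal.
               (\<forall>t. ereal t \<le> tm \<longrightarrow> h t = -1) \<and>
               (\<forall>t. h differentiable (at t) \<and> deriv h t \<ge> (h t)\<^sup>2 - 1) \<and>
               (\<forall>t. tp \<le> ereal t \<longrightarrow> h t = 1)"
    \<comment> \<open>For infinite \<open>t\<^sub>-\<close> and \<open>t\<^sub>+\<close> of these signs, (i) and (iii) are empty.\<close>
    by (intro exI[of _ "- \<infinity>"] exI[of _ "\<infinity>"]) simp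
next
  fix h :: "real \<Rightarrow> real" and \<gamma> :: "real \<Rightarrow> 'a \<times> real"
  assume h: "range h \<subseteq> {-1..1} \<and> h C1_differentiable_on UNIV \<and>
        (\<exists>tm tp :: ereal.
           (\<forall>t. ereal t \<le> tm \<longrightarrow> h t = -1) \<and>
           (\<forall>t. h differentiable (at t) \<and> deriv h t \<ge> (h t)\<^sup>2 - 1) \<and>
           (\<forall>t. tp \<le> ereal t \<longrightarrow> h t = 1))"
    and \<gamma>: "geodesic_line \<gamma>"
  have bound: "\<bar>h t\<bar> \<le> 1" for t
    using h by (auto simp: abs_le_iff image_subset_iff minus_le_iff)
  obtain T T' where T: "hyp_isometry T T'" "\<And>t. T (\<gamma> t) = (0, exp t)"
    using geodesic_normal_form[OF \<gamma>] by blast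
  interpret umbilical_curvature \<gamma> T T' h
    by unfold_locales (use \<gamma> T bound h in auto)
  show "umbilical_route \<gamma> h" by (rule umbilical_route_curvature)
qed

end
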